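(* With the setting of the context, where $\alpha:Q\to[0,\infty)$ is continuous, there exists $y^*\in X$ with $\mathcal{G}(y^* )=\sup_{y\in X}\mathcal{G}(y)$. Suppose moreover that this maximizer $y^*$ is unique. Then $\|\pi^N-y^*\|_{\sup}\to0$ almost surely. In addition, for every $\delta>0$ there are constants $c,C>0$ such that $$P\bigl(\|\pi^N-y^*\|_{\sup}>\delta\bigr)<Ce^{-cN}\quad\text{for all }N\in\mathbb{N}.$$
   Context: Inhomogeneous last passage percolation. Fix $l>0$ and $b\in\mathbb{R}$ with $|b|<l$, and let $Q=\{(x,y)\in\mathbb{R}^2: 0\le x\le l,\ |y|\le x,\ |b-y|\le l-x\}$. Let $\widetilde{\mathbb{Z}}^2=\{(x,y)\in\mathbb{Z}^2: x+y\text{ even}\}$, and for $N\in\mathbb{N}$ let $S_N=Q\cap\frac1N\widetilde{\mathbb{Z}}^2$. Let $\alpha:Q\to[0,\infty)$ be continuous. For each $N$, let $(\xi_p)_{p\in S_N}$ be independent random variables with $\xi_p$ distributed as $\frac{\alpha(p)}{N}E_p$, where $E_p$ is exponential with mean $1$. $\Pi_N$ is the set of oriented paths $\pi=(p_0,\dots,p_k)$ with $p_0=(0,0)$, $p_i\in S_N$, $p_i-p_{i-1}=\frac1N(1,\pm1)$, and $p_k$ the rightmost point of $S_N$. Define $\xi_N\cdot\pi=\sum_{p\in\pi}\xi_p$. Let $\pi^N$ be the almost surely unique path in $\Pi_N$ maximizing $\xi_N\cdot\pi$. This path is identified with the function whose graph is the piecewise linear interpolation of its points, and $\|\cdot\|_{\sup}$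 denotes the sup norm. Let $\gamma(w)=1+\sqrt{1-w^2}$ for $|w|\le 1$. Let $X$ be the set of $1$-Lipschitz functions $y:[0,l]\to\mathbb{R}$ with $y(0)=0$ and $y(l)=b$. For $y\in X$, define $\mathcal{G}(y)=\int_0^l\alpha(x,y(x))\,\gamma(\dot y(x))\,dx$. *)

theory Defs
  imports "HOL-Probability.Probability"
begin

definition Qreg :: "real \<Rightarrow> real \<Rightarrow> (real \<times> real) set" where
  "Qreg l b = {(x, y). 0 \<le> x \<and> x \<le> l \<and> \<bar>y\<bar> \<le> x \<and> \<bar>b - y\<bar> \<le> l - x}"

definition SN :: "real \<Rightarrow> real \<Rightarrow> nat \<Rightarrow> (real \<times> real) set" where
  "SN l b N = {p \<in> Qreg l b. \<exists>i j :: int. even (i + j) \<and> p = (of_int i / real N, of_int j / real N)}"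

definition rightmost :: "real \<Rightarrow> real \<Rightarrow> nat \<Rightarrow> real \<times> real" where
  "rightmost l b N = (THE p. p \<in> SN l b N \<and> (\<forall>q \<in> SN l b N. fst q \<le> fst p))"

definition paths :: "real \<Rightarrow> real \<Rightarrow> nat \<Rightarrow> (real \<times> real) list set" where
  "paths l b N = {\<pi>. \<pi> \<noteq> [] \<and> hd \<pi> = (0, 0) \<and> set \<pi> \<subseteq> SN l b N \<and>
     (\<forall>i. Suc i < length \<pi> \<longrightarrow>
        fst (\<pi> ! Suc i) - fst (\<pi> ! i) = 1 / real N \<and>
        (snd (\<pi> ! Suc i) - snd (\<pi> ! i) = 1 / real N \<or> snd (\<pi> ! Suc i) - snd (\<pi> ! i) = - 1 / real N)) \<and>
     last \<pi> = rightmost l b N}"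

definition weight :: "((real \<times> real) \<Rightarrow> real) \<Rightarrow> (nat \<Rightarrow> real \<times> real \<Rightarrow> 'a \<Rightarrow> real)
    \<Rightarrow> nat \<Rightarrow> 'a \<Rightarrow> (real \<times> real) list \<Rightarrow> real" where
  "weight \<alpha> E N \<omega> \<pi> = sum_list (map (\<lambda>p. \<alpha> p / real N * E N p \<omega>) \<pi>)"

definition is_geodesic :: "real \<Rightarrow> real \<Rightarrow> ((real \<times> real) \<Rightarrow> real) \<Rightarrow> (nat \<Rightarrow> real \<times> real \<Rightarrow> 'a \<Rightarrow> real)
    \<Rightarrow> nat \<Rightarrow> 'a \<Rightarrow> (real \<times> real) list \<Rightarrow> bool" where
  "is_geodesic l b \<alpha> E N \<omega> \<pi> \<longleftrightarrow>
     \<pi> \<in> paths l b N \<and> (\<forall>\<pi>' \<in> paths l b N. weight \<alpha> E N \<omega> \<pi>' \<le> weight \<alpha> E N \<omega> \<pi>)"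

text \<open>Piecewise linear interpolation of a path (points have x-coordinates i/N).\<close>
definition interp :: "nat \<Rightarrow> (real \<times> real) list \<Rightarrow> real \<Rightarrow> real" where
  "interp N \<pi> x = (let i = nat \<lfloor>real N * x\<rfloor>; t = real N * x - real i
                   in (1 - t) * snd (\<pi> ! i) + t * snd (\<pi> ! Suc i))"

definition supdist :: "nat \<Rightarrow> (real \<times> real) list \<Rightarrow> (real \<Rightarrow> real) \<Rightarrow> real" where
  "supdist N \<pi> y = (SUP x \<in> {0 .. fst (last \<pi>)}. \<bar>interp N \<pi> x - y x\<bar>)"

definition gam :: "real \<Rightarrow> real" where
  "gam w = 1 + sqrt (1 - w\<^sup>2)"

definition Xset :: "real \<Rightarrow> real \<Rightarrow> (real \<Rightarrow> real) set" where
  "Xset l b = {y. 1-lipschitz_on {0..l} y \<and> y 0 = 0 \<and> y l = b}"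

text \<open>The functional G(y) = int_0^l alpha(x,y(x)) gamma(y'(x)) dx (the derivative
  exists almost everywhere for Lipschitz y).\<close>
definition Gfun :: "real \<Rightarrow> ((real \<times> real) \<Rightarrow> real) \<Rightarrow> (real \<Rightarrow> real) \<Rightarrow> real" where
  "Gfun l \<alpha> y = integral {0..l} (\<lambda>x. \<alpha> (x, y x) * gam (deriv y x))"

end

theory Submission
  imports Defs "HOL-Complex_Analysis.Great_Picard"
begin

text \<open>
  In the coordinates \<open>u = (x + y) / 2\<close>, \<open>v = (x - y) / 2\<close> the region is a rectangle, \<open>SN\<close> is a rectangle of lattice
  points, and paths are up-right paths, so a path segment is compared with homogeneous exponential last passage
  percolation, whose limit shape is \<open>(sqrt u + sqrt v)\<^sup>2\<close>.

  Shape theorem with exponential tails: with boundary weights of rates \<open>1 - \<rho>\<close> and \<open>\<rho>\<close> on the two axes, the increments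
  of the passage time along any row are again independent exponentials (Burke), so the stationary passage time is a sum
  of two Gamma variables. It dominates the bulk passage time, and optimising over \<open>\<rho>\<close> gives the upper tail. For the lower
  tail, strict concavity of the shape forces the stationary geodesic to leave the axes after a short distance, so the
  bulk value is almost the stationary one.

  Deterministic part: replace \<open>Gfun\<close> by sums over partitions with \<open>K\<close> intervals. These sums are continuous in \<open>y\<close>,
  they converge to \<open>Gfun\<close> for fixed \<open>y\<close> (here the almost everywhere derivative enters), and refining the partition
  increases them by at most a small error because the shape is superadditive. With Arzela-Ascoli this gives a
  maximizer and, if it is unique, a gap for all curves at distance \<open>\<delta>\<close>, uniformly in large \<open>K\<close>. Once all passage times
  between lattice points are close to the shape, the weight of any path is at most the partition sum of an interpolating
  curve, while some path has weight close to the maximum; hence the geodesic is close to the maximizer.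
\<close>

section \<open>Almost everywhere differentiability of Lipschitz functions\<close>

text \<open>\<open>Gfun\<close> depends on the slope of the curve, so it is not continuous for the
  sup norm: rapid zigzags change the integral while the curve hardly moves. Concavity of
  \<open>gam\<close> leaves upper semicontinuity, and this is all that the existence of a maximizer
  and the gap require. Partition sums capture it: each is continuous, and up to a small error they
  decrease under refinement. Partitions into 2^k intervals are used because they are nested.

  On the random side the number of paths is exponential in N, so no union bound over paths is
  possible. It is taken over sub-rectangles of the lattice instead. Their number is of order N^4, so
  exponential tails survive.

  The comparison with a stationary model degenerates when a rectangle is thin, because the matching
  rate then approaches 0 or 1. For the upper tail the rate is kept away from 0 and 1 at a small
  cost. For the lower tail a thin rectangle is treated separately: the path along its long side
  already collects almost the whole limit value.\<close>

lemma lipschitz_differentiable_off_negligible: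
  fixes f :: "real \<Rightarrow> real"
  assumes lip: "1-lipschitz_on UNIV f"
  obtains S where "negligible S" "\<And>x. x \<notin> S \<Longrightarrow> f differentiable (at x)"
proof -
  \<comment> \<open>The added slope 2 makes \<open>F\<close> strictly increasing with slopes between
    1 and 3, hence a bijection with 1-Lipschitz inverse. Differentiability of \<open>f\<close> is
    that of \<open>F\<close>, and \<open>F\<close> is treated as the distribution function of a
    measure: Radon-Nikodym gives a density, and Lebesgue differentiation recovers it as the
    derivative.\<close>
  define F where "F x = f x + 2 * x" for x
  have F1: "b - a \<le> F b - F a" and F2: "F b - F a \<le> 3 * (b - a)" if "a \<le> b" for a b
    using lipschitz_onD[OF lip, of a b] that by (auto simp: F_def dist_real_def abs_le_iff)
  have Flip: "\<bar>F x - F y\<bar> \<le> 3 * \<bar>x - y\<bar>" for x y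
    using F1[of x y] F1[of y x] F2[of x y] F2[of y x] by (cases "x \<le> y") (auto simp: abs_real_def)
  have Flip': "3-lipschitz_on UNIV F"
    by (rule lipschitz_onI) (auto simp: dist_real_def Flip)
  have Fcont: "continuous_on A F" for A
    by (rule continuous_on_subset[OF lipschitz_on_continuous_on[OF Flip']]) simp
  have Finj: "inj F"
  proof (rule injI)
    fix x y assume "F x = F y" then show "x = y" by (smt (verit) F1)
  qed
  have Fle: "F x \<le> F y \<longleftrightarrow> x \<le> y" for x y
    by (smt (verit) F1)
  have Fsurj: "surj F"
  proof -
    have "\<exists>x. F x = z" for z
    proof -
      define B where "B = \<bar>z - F 0\<bar>"
      have "B \<ge> 0" "z - F 0 \<le> B" "F 0 - z \<le> B" by (auto simp: B_def)
      then have "F (-B) \<le> z" "z \<le> F B" "-B \<le> B" using F1[of "-B" 0] F1[of 0 B] by auto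
      then show ?thesis using IVT'[of F "-B" z B] Fcont by auto
    qed
    then show ?thesis by (metis surj_def)
  qed
  define G where "G = inv F"
  have FG: "F (G z) = z" and GF: "G (F x) = x" for x z
    by (simp_all add: G_def Finj Fsurj surj_f_inv_f)
  have Glip: "1-lipschitz_on UNIV G"
  proof (rule lipschitz_onI)
    fix x y show "dist (G x) (G y) \<le> 1 * dist x y"
      using F1[of "G x" "G y"] F1[of "G y" "G x"] by (cases "G x \<le> G y") (auto simp: FG dist_real_def)
  qed simp
  have Gmeas[measurable]: "G \<in> borel_measurable borel"
    using lipschitz_on_continuous_on[OF Glip] borel_measurable_continuous_onI by blast
  \<comment> \<open>The Stieltjes measure of \<open>F\<close>: the mass of a set is the Lebesgue
    measure of its image under \<open>F\<close>. Lipschitz maps send null sets to null sets, which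
    yields absolute continuity.\<close>
  define \<nu> where "\<nu> = distr lborel borel G"
  have vG: "G -` A = F ` A" for A by (auto simp: GF) (metis FG image_eqI)
  have \<nu>I: "emeasure \<nu> {a..b} = ennreal (F b - F a)" if "a \<le> b" for a b
  proof -
    have "G -` {a..b} = {F a..F b}" by auto (metis FG Fle)+
    then show ?thesis using that by (simp add: \<nu>_def emeasure_distr Fle)
  qed
  have ac: "absolutely_continuous lborel \<nu>"
    unfolding absolutely_continuous_def
  proof
    fix A assume A: "A \<in> null_sets (lborel :: real measure)"
    then have Ab: "A \<in> sets borel" by auto
    have "negligible A" using A by (simp add: negligible_iff_null_sets null_sets_completionI)
    then have "negligible (F ` A)"
      by (rule negligible_locally_Lipschitz_image[rotated]) (auto intro!: exI[of _ UNIV] exI[of _ 3] simp: Flip)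
    then have "F ` A \<in> null_sets lebesgue" by (simp add: negligible_iff_null_sets)
    moreover have "F ` A \<in> sets borel" using measurable_sets[OF Gmeas Ab] by (simp add: vG)
    ultimately have "emeasure lborel (F ` A) = 0"
      by (metis null_sets_completion_iff null_setsD1 sets_lborel)
    then show "A \<in> null_sets \<nu>" using Ab by (auto simp: null_sets_def \<nu>_def emeasure_distr vG)
  qed
  obtain h where h[measurable]: "h \<in> borel_measurable lborel" and hd: "density lborel h = \<nu>"
    using sigma_finite_measure.Radon_Nikodym[OF sigma_finite_lborel ac] by (auto simp: \<nu>_def)
  \<comment> \<open>The density has values in \<open>ennreal\<close>. Its integral over a bounded
    interval is finite, so passing to a real function changes it only on a null set.\<close>
  define k where "k x = enn2real (h x)" for x
  have kI: "(k has_integral (F b - F a)) {a..b}" if "a \<le> b" for a b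
  proof -
    have e: "(\<integral>\<^sup>+x. h x * indicator {a..b} x \<partial>lborel) = ennreal (F b - F a)"
      using \<nu>I[OF that] emeasure_density[OF h, of "{a..b}"] by (simp add: hd)
    then have "AE x in lborel. h x * indicator {a..b} x \<noteq> \<infinity>"
      by (intro nn_integral_noteq_infinite) auto
    then have "AE x in lborel. ennreal (k x * indicator {a..b} x) = h x * indicator {a..b} x"
      by eventually_elim (auto simp: k_def indicator_def less_top)
    then have "(\<integral>\<^sup>+x. ennreal (k x * indicator {a..b} x) \<partial>lborel) = ennreal (F b - F a)"
      using e by (simp cong: nn_integral_cong_AE)
    then have "((\<lambda>x. k x * indicator {a..b} x) has_integral (F b - F a)) UNIV"
      by (intro nn_integral_has_integral) (auto simp: k_def Fle that)
    moreover have "(\<lambda>x. k x * indicator {a..b} x) = (\<lambda>x. if x \<in> {a..b} then k x else 0)" by auto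
    ultimately show ?thesis by (simp only: has_integral_restrict_UNIV)
  qed
  \<comment> \<open>The differentiation theorem applied below controls averages over intervals to
    the right of a point. Applying it also to the reflected density covers the left difference
    quotients.\<close>
  have kI2: "((\<lambda>x. k (-x)) has_integral (F (-a) - F (-b))) {a..b}" if "a \<le> b" for a b
    using kI[of "-b" "-a"] that by (subst has_integral_reflect_real[symmetric]) auto
  have ik: "k integrable_on cbox a b" "(\<lambda>x. k (-x)) integrable_on cbox a b" for a b
    using kI[of a b] kI2[of a b] by (cases "a \<le> b"; force simp: integrable_on_def)+
  obtain S1 where S1: "negligible S1" "\<And>x e. \<lbrakk>x \<notin> S1; 0 < e\<rbrakk> \<Longrightarrow>
         \<exists>d>0. \<forall>h. 0 < h \<and> h < d \<longrightarrow> norm(integral (cbox x (x + h *\<^sub>R One)) k /\<^sub>R h ^ DIM(real) - k x) < e"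
    using integrable_ccontinuous_explicit[OF ik(1)] by blast
  obtain S2 where S2: "negligible S2" "\<And>x e. \<lbrakk>x \<notin> S2; 0 < e\<rbrakk> \<Longrightarrow>
         \<exists>d>0. \<forall>h. 0 < h \<and> h < d \<longrightarrow> norm(integral (cbox x (x + h *\<^sub>R One)) (\<lambda>x. k (-x)) /\<^sub>R h ^ DIM(real) - k (-x)) < e"
    using integrable_ccontinuous_explicit[OF ik(2)] by blast
  show ?thesis
  proof (rule that)
    have "negligible (uminus ` S2)"
    proof (rule negligible_locally_Lipschitz_image[OF order_refl S2(1)])
      fix x :: real
      show "\<exists>T B. open T \<and> x \<in> T \<and> (\<forall>y\<in>S2 \<inter> T. norm (- y - - x) \<le> B * norm (y - x))"
        by (intro exI[of _ UNIV] exI[of _ 1]) auto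
    qed
    with S1(1) show "negligible (S1 \<union> uminus ` S2)" by (rule negligible_Un)
    fix x assume x: "x \<notin> S1 \<union> uminus ` S2"
    then have x1: "x \<notin> S1" and x2: "-x \<notin> S2" by force+
    have "DERIV F x :> k x"
      unfolding DERIV_def LIM_eq
    proof (intro allI impI)
      fix e :: real assume e: "e > 0"
      obtain d1 where d1: "d1 > 0" "\<And>h. 0 < h \<Longrightarrow> h < d1 \<Longrightarrow> \<bar>(F (x + h) - F x) / h - k x\<bar> < e"
        using S1(2)[OF x1 e] kI[THEN integral_unique] by (auto simp: divide_inverse mult.commute)
      obtain d2 where d2: "d2 > 0" "\<And>h. 0 < h \<Longrightarrow> h < d2 \<Longrightarrow> \<bar>(F x - F (x - h)) / h - k x\<bar> < e"
        using S2(2)[OF x2 e] kI2[THEN integral_unique] by (auto simp: divide_inverse mult.commute)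
      show "\<exists>s>0. \<forall>z. z \<noteq> 0 \<and> norm (z - 0) < s \<longrightarrow> norm ((F (x + z) - F x) / z - k x) < e"
      proof (intro exI[of _ "min d1 d2"] conjI allI impI)
        fix z :: real assume z: "z \<noteq> 0 \<and> norm (z - 0) < min d1 d2"
        show "norm ((F (x + z) - F x) / z - k x) < e"
        proof (cases "z > 0")
          case True then show ?thesis using d1(2)[of z] z by auto
        next
          case False
          have "(F x - F (x - (-z))) / (-z) = (F (x + z) - F x) / z" using z by (simp add: field_simps)
          then show ?thesis using d2(2)[of "-z"] z False by auto
        qed
      qed (use d1 d2 in auto)
    qed
    then have "DERIV (\<lambda>x. F x - 2 * x) x :> k x - 2"
      by (auto intro!: derivative_eq_intros)
    then show "f differentiable (at x)"
      unfolding F_def by (auto simp: real_differentiable_def)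
  qed
qed

section \<open>Discretisation of the functional\<close>

text \<open>The homogeneous extension \<open>dx * gam (dy / dx)\<close>, written without division.
  Being homogeneous and concave, it is superadditive.\<close>

definition seg_shape :: "real \<Rightarrow> real \<Rightarrow> real" where
  "seg_shape dx dy = dx + sqrt (dx\<^sup>2 - dy\<^sup>2)"

text \<open>The value of the functional on the polygon through K + 1 points of \<open>y\<close>,
  with the weight frozen at the left end of each piece.\<close>

definition disc_fun :: "real \<Rightarrow> (real \<times> real \<Rightarrow> real) \<Rightarrow> nat \<Rightarrow> (real \<Rightarrow> real) \<Rightarrow> real" where
  "disc_fun l \<alpha> K y = (\<Sum>j<K. \<alpha> (l * real j / real K, y (l * real j / real K)) *
     seg_shape (l / real K) (y (l * real (Suc j) / real K) - y (l * real j / real K)))"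

lemma seg_shape_eq_gam: "0 < dx \<Longrightarrow> seg_shape dx dy = dx * gam (dy / dx)"
proof -
  assume "0 < dx"
  then have "dx\<^sup>2 - dy\<^sup>2 = dx\<^sup>2 * (1 - (dy / dx)\<^sup>2)" by (simp add: field_simps)
  then have "sqrt (dx\<^sup>2 - dy\<^sup>2) = dx * sqrt (1 - (dy / dx)\<^sup>2)"
    using \<open>0 < dx\<close> by (simp add: real_sqrt_mult)
  then show ?thesis by (simp add: seg_shape_def gam_def algebra_simps)
qed

lemma abs_le_imp_power2_le: "\<bar>b\<bar> \<le> a \<Longrightarrow> b\<^sup>2 \<le> (a::real)\<^sup>2"
  by (rule power2_le_iff_abs_le[THEN iffD2]) auto

lemma seg_shape_nonneg: "\<bar>dy\<bar> \<le> dx \<Longrightarrow> 0 \<le> seg_shape dx dy"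
  using abs_le_imp_power2_le[of dy dx] by (auto simp: seg_shape_def intro!: add_nonneg_nonneg)

lemma seg_shape_le: "0 \<le> dx \<Longrightarrow> seg_shape dx dy \<le> 2 * dx"
proof -
  assume "0 \<le> dx"
  moreover have "sqrt (dx\<^sup>2 - dy\<^sup>2) \<le> sqrt (dx\<^sup>2)" by (rule real_sqrt_le_mono) simp
  ultimately show ?thesis by (simp add: seg_shape_def)
qed

text \<open>The reverse triangle inequality of the Minkowski form
  \<open>a\<^sup>2 - b\<^sup>2\<close> on its forward cone. It follows from the reverse
  Cauchy-Schwarz inequality, where the two squares differ by the square
  \<open>(a1 * b2 - a2 * b1)\<^sup>2\<close>.\<close>

lemma seg_shape_superadditive:
  assumes "\<bar>b1\<bar> \<le> a1" "\<bar>b2\<bar> \<le> a2"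
  shows "seg_shape a1 b1 + seg_shape a2 b2 \<le> seg_shape (a1 + a2) (b1 + b2)"
proof -
  define s1 s2 where "s1 = sqrt (a1\<^sup>2 - b1\<^sup>2)" and "s2 = sqrt (a2\<^sup>2 - b2\<^sup>2)"
  have p: "b1\<^sup>2 \<le> a1\<^sup>2" "b2\<^sup>2 \<le> a2\<^sup>2" using assms by (auto intro: abs_le_imp_power2_le)
  have s: "s1\<^sup>2 = a1\<^sup>2 - b1\<^sup>2" "s2\<^sup>2 = a2\<^sup>2 - b2\<^sup>2" "0 \<le> s1" "0 \<le> s2"
    using p by (auto simp: s1_def s2_def)
  have "\<bar>b1\<bar> * \<bar>b2\<bar> \<le> a1 * a2" using assms by (intro mult_mono) auto
  then have nn: "0 \<le> a1 * a2 - b1 * b2" using abs_ge_self[of "b1 * b2"] by (simp add: abs_mult)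
  have "(a1 * a2 - b1 * b2)\<^sup>2 - (s1 * s2)\<^sup>2 = (a1 * b2 - a2 * b1)\<^sup>2"
    unfolding power_mult_distrib s(1,2) by (simp add: power2_eq_square algebra_simps)
  moreover have "0 \<le> (a1 * b2 - a2 * b1)\<^sup>2" by simp
  ultimately have "(s1 * s2)\<^sup>2 \<le> (a1 * a2 - b1 * b2)\<^sup>2" by linarith
  then have "s1 * s2 \<le> a1 * a2 - b1 * b2" using nn by (rule power2_le_imp_le)
  then have "(s1 + s2)\<^sup>2 \<le> (a1 + a2)\<^sup>2 - (b1 + b2)\<^sup>2"
    unfolding power2_sum s(1,2) by (simp add: algebra_simps)
  then have "s1 + s2 \<le> sqrt ((a1 + a2)\<^sup>2 - (b1 + b2)\<^sup>2)" by (rule real_le_rsqrt)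
  then show ?thesis by (simp add: seg_shape_def s1_def s2_def)
qed

lemma seg_shape_sum_superadditive:
  assumes "finite A" "\<And>i. i \<in> A \<Longrightarrow> \<bar>b i\<bar> \<le> a i"
  shows "(\<Sum>i\<in>A. seg_shape (a i) (b i)) \<le> seg_shape (\<Sum>i\<in>A. a i) (\<Sum>i\<in>A. b i)"
  using assms
proof (induction A rule: finite_induct)
  case empty then show ?case by (simp add: seg_shape_def)
next
  case (insert x A)
  have "\<bar>sum b A\<bar> \<le> (\<Sum>i\<in>A. \<bar>b i\<bar>)" by simp
  also have "\<dots> \<le> sum a A" using insert by (intro sum_mono) auto
  finally show ?case using insert seg_shape_superadditive[of "b x" "a x" "sum b A" "sum a A"] by force
qed

lemma Xset_dist: "y \<in> Xset l b \<Longrightarrow> 0 \<le> s \<Longrightarrow> s \<le> t \<Longrightarrow> t \<le> l \<Longrightarrow> \<bar>y t - y s\<bar> \<le> t - s"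
  using lipschitz_onD[of 1 "{0..l}" y t s] by (auto simp: Xset_def dist_real_def)

lemma Xset_graph: "0 \<le> l \<Longrightarrow> y \<in> Xset l b \<Longrightarrow> 0 \<le> x \<Longrightarrow> x \<le> l \<Longrightarrow> (x, y x) \<in> Qreg l b"
  using Xset_dist[of y l b 0 x] Xset_dist[of y l b x l] by (auto simp: Qreg_def Xset_def)

lemma compact_Qreg: "compact (Qreg l b)"
proof (subst compact_eq_bounded_closed, intro conjI)
  have "Qreg l b \<subseteq> cbox (0, -l) (l, l)" by (auto simp: Qreg_def)
  then show "bounded (Qreg l b)" using bounded_cbox bounded_subset by blast
  have "Qreg l b = {p. 0 \<le> fst p} \<inter> {p. fst p \<le> l} \<inter> {p. \<bar>snd p\<bar> \<le> fst p} \<inter> {p. \<bar>b - snd p\<bar> \<le> l - fst p}"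
    by (auto simp: Qreg_def)
  also have "closed \<dots>" by (intro closed_Int closed_Collect_le continuous_intros)
  finally show "closed (Qreg l b)" .
qed

text \<open>The point x only has to lie in the shrinking intervals, not at an end. The linearisation
  errors at both ends are at most e/2 times their distances to x, and these distances add up to the
  interval length.\<close>

lemma slope_tendsto_deriv:
  fixes y :: "real \<Rightarrow> real"
  assumes D: "(y has_real_derivative D) (at x)"
    and ab: "\<And>n. a n \<le> x" "\<And>n. x \<le> c n" "\<And>n. a n < c n" and lim: "(\<lambda>n. c n - a n) \<longlonglongrightarrow> 0"
  shows "(\<lambda>n. (y (c n) - y (a n)) / (c n - a n)) \<longlonglongrightarrow> D"
proof (rule LIMSEQ_I)
  fix e :: real assume e: "0 < e"
  have "((\<lambda>z. (y z - y x) / (z - x)) \<longlongrightarrow> D) (at x)"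
    using D by (simp add: has_field_derivative_iff)
  then obtain d where d: "d > 0" "\<And>z. z \<noteq> x \<Longrightarrow> \<bar>z - x\<bar> < d \<Longrightarrow> \<bar>(y z - y x) / (z - x) - D\<bar> < e / 2"
    using e by (force simp: LIM_eq dest: spec[of _ "e/2"])
  have bd: "\<bar>y z - y x - D * (z - x)\<bar> \<le> e / 2 * \<bar>z - x\<bar>" if "\<bar>z - x\<bar> < d" for z
  proof (cases "z = x")
    case False
    have "y z - y x - D * (z - x) = ((y z - y x) / (z - x) - D) * (z - x)" using False by (simp add: field_simps)
    then have "\<bar>y z - y x - D * (z - x)\<bar> = \<bar>(y z - y x) / (z - x) - D\<bar> * \<bar>z - x\<bar>" by (simp only: abs_mult)
    also have "\<dots> \<le> e / 2 * \<bar>z - x\<bar>" using d(2)[OF False that] by (intro mult_right_mono) auto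
    finally show ?thesis .
  qed simp
  obtain n0 where n0: "\<And>n. n \<ge> n0 \<Longrightarrow> \<bar>c n - a n\<bar> < d"
    using LIMSEQ_D[OF lim d(1)] by auto
  show "\<exists>n0. \<forall>n\<ge>n0. norm ((y (c n) - y (a n)) / (c n - a n) - D) < e"
  proof (intro exI allI impI)
    fix n assume "n \<ge> n0"
    then have "\<bar>c n - x\<bar> < d" "\<bar>a n - x\<bar> < d" using n0[of n] ab(1,2,3)[of n] by auto
    from bd[OF this(1)] bd[OF this(2)]
    have "\<bar>(y (c n) - y x - D * (c n - x)) - (y (a n) - y x - D * (a n - x))\<bar> \<le> e / 2 * \<bar>c n - x\<bar> + e / 2 * \<bar>a n - x\<bar>"
      by linarith
    also have "(y (c n) - y x - D * (c n - x)) - (y (a n) - y x - D * (a n - x)) = y (c n) - y (a n) - D * (c n - a n)"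
      by (simp add: algebra_simps)
    also have "e / 2 * \<bar>c n - x\<bar> + e / 2 * \<bar>a n - x\<bar> = e / 2 * (c n - a n)"
      using ab(1,2)[of n] by (simp add: field_simps)
    finally have "\<bar>y (c n) - y (a n) - D * (c n - a n)\<bar> \<le> e / 2 * (c n - a n)" .
    moreover have "(y (c n) - y (a n)) / (c n - a n) - D = (y (c n) - y (a n) - D * (c n - a n)) / (c n - a n)"
      using ab(3)[of n] by (simp add: field_simps)
    ultimately have "\<bar>(y (c n) - y (a n)) / (c n - a n) - D\<bar> \<le> e / 2"
      using ab(3)[of n] by (simp add: abs_divide pos_divide_le_eq)
    then show "norm ((y (c n) - y (a n)) / (c n - a n) - D) < e" using e by simp
  qed
qed

text \<open>Constant continuation beyond the interval makes the curve Lipschitz on the whole line.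
  The two end points join the null set, since \<open>deriv\<close> is two-sided and the continuation
  agrees with \<open>y\<close> near interior points only.\<close>

lemma Xset_differentiable_off_negligible:
  assumes l: "0 < l" and y: "y \<in> Xset l b"
  obtains S where "negligible S"
    "\<And>x. x \<in> {0..l} - S \<Longrightarrow> 0 < x \<and> x < l \<and> (y has_real_derivative deriv y x) (at x)"
proof -
  define z where "z x = y (max 0 (min l x))" for x
  have "1-lipschitz_on UNIV z"
  proof (rule lipschitz_onI)
    fix s t :: real
    show "dist (z s) (z t) \<le> 1 * dist s t"
      using lipschitz_onD[of 1 "{0..l}" y "max 0 (min l s)" "max 0 (min l t)"] y l
      by (auto simp: Xset_def z_def dist_real_def max_def min_def split: if_splits)
  qed simp
  then obtain S where S: "negligible S" "\<And>x. x \<notin> S \<Longrightarrow> z differentiable (at x)"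
    using lipschitz_differentiable_off_negligible by blast
  show ?thesis
  proof (rule that)
    show "negligible (S \<union> {0, l})" using S(1) by (intro negligible_Un) auto
    fix x assume x: "x \<in> {0..l} - (S \<union> {0, l})"
    then obtain D where D: "(z has_real_derivative D) (at x)" using S(2)[of x] by (auto simp: real_differentiable_def)
    have "(y has_real_derivative D) (at x)"
    proof (rule has_field_derivative_transform_within_open[OF D, of "{0<..<l}"])
      show "x \<in> {0<..<l}" using x by auto
    qed (auto simp: z_def)
    then show "0 < x \<and> x < l \<and> (y has_real_derivative deriv y x) (at x)"
      using x DERIV_imp_deriv by fastforce
  qed
qed

lemma continuous_gam: "continuous_on UNIV gam"
  unfolding gam_def by (intro continuous_intros)

text \<open>Each partition sum is the integral of a step function \<open>h K\<close>. At every point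
  of differentiability its slopes converge to the derivative, and 2A dominates, A being a bound for
  the weight.\<close>

lemma disc_fun_tendsto_Gfun:
  assumes l: "0 < l" and y: "y \<in> Xset l b" and \<alpha>: "continuous_on (Qreg l b) \<alpha>"
  shows "(\<lambda>K. disc_fun l \<alpha> (Suc K) y) \<longlonglongrightarrow> Gfun l \<alpha> y"
proof -
  obtain A where A: "\<And>p. p \<in> Qreg l b \<Longrightarrow> \<bar>\<alpha> p\<bar> \<le> A"
    using compact_imp_bounded[OF compact_continuous_image[OF \<alpha> compact_Qreg]]
    by (auto simp: bounded_iff)
  have A0: "0 \<le> A" using A[OF Xset_graph[OF _ y, of 0]] l by auto
  define P where "P K j = l * real j / real (Suc K)" for K j
  define sl where "sl K j = (y (P K (Suc j)) - y (P K j)) / (P K (Suc j) - P K j)" for K j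
  define idx where "idx K x = nat \<lfloor>real (Suc K) * x / l\<rfloor>" for K x
  define h where "h K x = \<alpha> (P K (idx K x), y (P K (idx K x))) * gam (sl K (idx K x))" for K x
  have Pd: "P K (Suc j) - P K j = l / Suc K" for K j
    by (simp add: P_def diff_divide_distrib[symmetric] algebra_simps del: of_nat_Suc) (simp add: algebra_simps)
  have P0: "0 \<le> P K j" for K j using l by (simp add: P_def)
  have Pl: "P K j \<le> l" if "j \<le> Suc K" for K j
    using that l by (simp add: P_def pos_divide_le_eq del: of_nat_Suc)
  have P_less: "P K j < P K (Suc j)" for K j using Pd[of K j] l by (smt (verit) divide_pos_pos of_nat_0_less_iff zero_less_Suc)
  have idx: "idx K x = j" if "P K j \<le> x" "x < P K (Suc j)" for K j x
  proof -
    have "real j \<le> real (Suc K) * x / l" "real (Suc K) * x / l < real j + 1"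
      using that l by (auto simp: P_def field_simps simp del: of_nat_Suc) (simp add: algebra_simps)
    then show ?thesis unfolding idx_def by (simp add: floor_eq_iff nat_eq_iff)
  qed
  have int: "(h K has_integral (\<Sum>j<n. \<alpha> (P K j, y (P K j)) * seg_shape (l / Suc K) (y (P K (Suc j)) - y (P K j)))) {0..P K n}" for K n
  proof (induction n)
    case 0
    have "(h K has_integral 0) (cbox 0 0)" by (rule has_integral_refl)
    then show ?case by (simp add: P_def)
  next
    case (Suc n)
    have "((\<lambda>x. \<alpha> (P K n, y (P K n)) * gam (sl K n)) has_integral
        measure lborel (cbox (P K n) (P K (Suc n))) *\<^sub>R (\<alpha> (P K n, y (P K n)) * gam (sl K n))) (cbox (P K n) (P K (Suc n)))"
      by (rule has_integral_const)
    moreover have "measure lborel (cbox (P K n) (P K (Suc n))) *\<^sub>R (\<alpha> (P K n, y (P K n)) * gam (sl K n))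
       = \<alpha> (P K n, y (P K n)) * seg_shape (l / Suc K) (y (P K (Suc n)) - y (P K n))"
      using P_less[of K n] l by (simp add: Pd seg_shape_eq_gam sl_def del: of_nat_Suc)
    ultimately have "((\<lambda>x. \<alpha> (P K n, y (P K n)) * gam (sl K n)) has_integral
        \<alpha> (P K n, y (P K n)) * seg_shape (l / Suc K) (y (P K (Suc n)) - y (P K n))) {P K n..P K (Suc n)}"
      by (simp only: cbox_interval)
    \<comment> \<open>The right end point is exempted because \<open>idx\<close> jumps to the next
      cell there.\<close>
    then have "(h K has_integral \<alpha> (P K n, y (P K n)) * seg_shape (l / Suc K) (y (P K (Suc n)) - y (P K n))) {P K n..P K (Suc n)}"
      by (rule has_integral_spike_finite[of "{P K (Suc n)}", rotated 2]) (auto simp: h_def idx)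
    from has_integral_combine[OF P0 less_imp_le[OF P_less] Suc this] show ?case by simp
  qed
  have dI: "(h K has_integral disc_fun l \<alpha> (Suc K) y) {0..l}" for K
    using int[of K "Suc K"] by (simp add: disc_fun_def P_def del: of_nat_Suc sum.lessThan_Suc)
  obtain S where S: "negligible S"
    "\<And>x. x \<in> {0..l} - S \<Longrightarrow> 0 < x \<and> x < l \<and> (y has_real_derivative deriv y x) (at x)"
    using Xset_differentiable_off_negligible[OF l y] by blast
  \<comment> \<open>The dominated convergence theorem in use asks for convergence at every point, so
    the exceptional null set is removed from the domain.\<close>
  have spike: "(f has_integral i) {0..l} \<longleftrightarrow> (f has_integral i) ({0..l} - S)" for f :: "real \<Rightarrow> real" and i
    by (rule has_integral_spike_set_eq; rule negligible_subset[OF S(1)]) auto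
  have floor: "P K (idx K x) \<le> x" "x < P K (Suc (idx K x))" "idx K x < Suc K" if "0 < x" "x < l" for K x
  proof -
    have f: "of_int \<lfloor>real (Suc K) * x / l\<rfloor> \<le> real (Suc K) * x / l" "real (Suc K) * x / l < of_int \<lfloor>real (Suc K) * x / l\<rfloor> + 1"
      by linarith+
    have g: "0 \<le> real (Suc K) * x / l" using that l by simp
    then have "real (idx K x) = of_int \<lfloor>real (Suc K) * x / l\<rfloor>" unfolding idx_def by simp
    then have r: "real (idx K x) \<le> real (Suc K) * x / l" "real (Suc K) * x / l < real (idx K x) + 1" using f by auto
    show 1: "P K (idx K x) \<le> x" "x < P K (Suc (idx K x))"
      using r l by (simp_all add: P_def field_simps del: of_nat_Suc) (simp_all add: algebra_simps)
    have "P K (idx K x) < l" using 1 that by auto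
    then have "real (idx K x) < real (Suc K)" using l by (simp add: P_def pos_divide_less_eq del: of_nat_Suc)
    then show "idx K x < Suc K" by linarith
  qed
  have "(\<lambda>K. integral ({0..l} - S) (h K)) \<longlonglongrightarrow> integral ({0..l} - S) (\<lambda>x. \<alpha> (x, y x) * gam (deriv y x))"
  proof (rule dominated_convergence(2))
    show "h K integrable_on ({0..l} - S)" for K using dI spike by (auto simp: integrable_on_def)
    show "(\<lambda>x. A * 2) integrable_on ({0..l} - S)"
      using spike integrable_const_ivl[of "A * 2" 0 l] by (auto simp: integrable_on_def)
    fix x assume x: "x \<in> {0..l} - S"
    then have x0: "0 < x" "x < l" and D: "(y has_real_derivative deriv y x) (at x)" using S(2) by auto
    note fl = floor[OF x0]
    have G: "(P K (idx K x), y (P K (idx K x))) \<in> Qreg l b" for K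
      using fl(3)[of K] by (intro Xset_graph[OF _ y]) (use l P0 Pl in auto)
    show "norm (h K x) \<le> A * 2" for K
    proof -
      have "\<bar>y (P K (Suc (idx K x))) - y (P K (idx K x))\<bar> \<le> P K (Suc (idx K x)) - P K (idx K x)"
        using fl(3)[of K] P_less[of K] by (intro Xset_dist[OF y] P0 Pl) (auto intro: less_imp_le)
      then have "\<bar>sl K (idx K x)\<bar> \<le> 1" using P_less[of K "idx K x"] by (simp add: sl_def abs_divide)
      then have "(sl K (idx K x))\<^sup>2 \<le> 1" by (simp add: abs_square_le_1)
      then have "sqrt (1 - (sl K (idx K x))\<^sup>2) \<le> 1" "0 \<le> sqrt (1 - (sl K (idx K x))\<^sup>2)" by auto
      then have "\<bar>gam (sl K (idx K x))\<bar> \<le> 2" by (simp add: gam_def)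
      then show ?thesis unfolding h_def real_norm_def abs_mult using A[OF G] A0 by (intro mult_mono) auto
    qed
    have lim0: "(\<lambda>K. P K (Suc (idx K x)) - P K (idx K x)) \<longlonglongrightarrow> 0"
      unfolding Pd using LIMSEQ_Suc[OF lim_const_over_n[of l]] by simp
    have ps: "(\<lambda>K. P K (idx K x)) \<longlonglongrightarrow> x"
    proof (rule tendsto_sandwich)
      show "\<forall>\<^sub>F K in sequentially. x - (P K (Suc (idx K x)) - P K (idx K x)) \<le> P K (idx K x)"
        using less_imp_le[OF fl(2)] by (auto intro!: always_eventually)
      show "\<forall>\<^sub>F K in sequentially. P K (idx K x) \<le> x" using fl(1) by (auto intro!: always_eventually)
      show "(\<lambda>K. x - (P K (Suc (idx K x)) - P K (idx K x))) \<longlonglongrightarrow> x" using tendsto_diff[OF tendsto_const lim0, of x] by simp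
    qed simp
    have sl: "(\<lambda>K. sl K (idx K x)) \<longlonglongrightarrow> deriv y x"
      unfolding sl_def by (rule slope_tendsto_deriv[OF D _ _ _ lim0]) (use fl P_less in \<open>auto intro: less_imp_le\<close>)
    have cy: "isCont y x" using D by (rule DERIV_isCont)
    have "(\<lambda>K. (P K (idx K x), y (P K (idx K x)))) \<longlonglongrightarrow> (x, y x)"
      by (rule tendsto_Pair[OF ps isCont_tendsto_compose[OF cy ps]])
    then have "(\<lambda>K. \<alpha> (P K (idx K x), y (P K (idx K x)))) \<longlonglongrightarrow> \<alpha> (x, y x)"
      by (rule continuous_on_tendsto_compose[OF \<alpha>]) (use G x0 l in \<open>auto intro!: Xset_graph[OF _ y]\<close>)
    moreover have "(\<lambda>K. gam (sl K (idx K x))) \<longlonglongrightarrow> gam (deriv y x)"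
      by (rule continuous_on_tendsto_compose[OF continuous_gam sl]) auto
    ultimately show "(\<lambda>K. h K x) \<longlonglongrightarrow> \<alpha> (x, y x) * gam (deriv y x)"
      unfolding h_def by (rule tendsto_mult)
  qed
  moreover have "integral ({0..l} - S) f = integral {0..l} f" for f :: "real \<Rightarrow> real"
    unfolding integral_def integrable_on_def spike ..
  ultimately show ?thesis
    using integral_unique[OF dI] by (simp add: Gfun_def)
qed

text \<open>With the weight frozen on a coarse cell, superadditivity merges the r fine pieces into
  one coarse piece. Freezing costs at most w times the shape of a cell, which is at most 2l / J, and
  there are J cells.\<close>

lemma disc_fun_refine:
  assumes l: "0 < l" and y: "y \<in> Xset l b" and J: "0 < J" and r: "0 < r" and w: "0 \<le> w"
    and \<alpha>0: "\<And>p. p \<in> Qreg l b \<Longrightarrow> 0 \<le> \<alpha> p"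
    and osc: "\<And>p q. p \<in> Qreg l b \<Longrightarrow> q \<in> Qreg l b \<Longrightarrow> \<bar>fst p - fst q\<bar> \<le> l / J \<Longrightarrow> \<bar>snd p - snd q\<bar> \<le> l / J \<Longrightarrow> \<bar>\<alpha> p - \<alpha> q\<bar> \<le> w"
  shows "disc_fun l \<alpha> (J * r) y \<le> disc_fun l \<alpha> J y + 2 * l * w"
proof -
  define P where "P j = l * real j / real (J * r)" for j
  define d where "d = l / real (J * r)"
  have d0: "0 < d" using l J r by (simp add: d_def)
  have Pd: "P j = d * real j" for j by (simp add: P_def d_def)
  have Pl: "P j \<le> l" if "j \<le> J * r" for j
  proof -
    have "real j \<le> real (J * r)" using that by (simp only: of_nat_le_iff)
    then show ?thesis using l J r by (simp add: P_def pos_divide_le_eq del: of_nat_mult)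
  qed
  have P0: "0 \<le> P j" for j using d0 by (simp add: Pd)
  have Pm: "P i \<le> P j" if "i \<le> j" for i j using that d0 by (simp add: Pd)
  have PJ: "P (q * r) = l * real q / real J" for q using r by (simp add: P_def)
  have dist: "\<bar>y (P j) - y (P i)\<bar> \<le> P j - P i" if "i \<le> j" "j \<le> J * r" for i j
    using that by (intro Xset_dist[OF y] P0 Pl Pm)
  define \<Delta> where "\<Delta> j = y (P (Suc j)) - y (P j)" for j
  have \<Delta>: "\<bar>\<Delta> j\<bar> \<le> d" if "j < J * r" for j
    using dist[of j "Suc j"] that by (simp add: \<Delta>_def Pd algebra_simps)
  have "disc_fun l \<alpha> (J * r) y = (\<Sum>j<J * r. \<alpha> (P j, y (P j)) * seg_shape d (\<Delta> j))"
    by (simp add: disc_fun_def P_def d_def \<Delta>_def)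
  also have "\<dots> = (\<Sum>q<J. \<Sum>j=q * r..<q * r + r. \<alpha> (P j, y (P j)) * seg_shape d (\<Delta> j))"
    by (rule sum.nat_group[symmetric])
  also have "\<dots> \<le> (\<Sum>q<J. \<alpha> (P (q * r), y (P (q * r))) * seg_shape (l / J) (y (P (Suc q * r)) - y (P (q * r))) + w * (2 * (l / J)))"
  proof (rule sum_mono)
    fix q assume q: "q \<in> {..<J}"
    then have qr: "q * r + r \<le> J * r" by (metis Suc_leI add.commute lessThan_iff mult_Suc mult_le_mono1)
    have Plen: "P (q * r + r) - P (q * r) = l / J"
      using r J by (simp add: P_def field_simps)
    have gq: "(\<Sum>j=q * r..<q * r + r. seg_shape d (\<Delta> j)) \<le> seg_shape (l / J) (y (P (Suc q * r)) - y (P (q * r)))"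
    proof -
      have "(\<Sum>j=q * r..<q * r + r. seg_shape d (\<Delta> j)) \<le> seg_shape (\<Sum>j=q * r..<q * r + r. d) (\<Sum>j=q * r..<q * r + r. \<Delta> j)"
        by (rule seg_shape_sum_superadditive) (use \<Delta> qr in auto)
      also have "(\<Sum>j=q * r..<q * r + r. \<Delta> j) = y (P (q * r + r)) - y (P (q * r))"
        unfolding \<Delta>_def by (rule sum_Suc_diff') simp
      also have "(\<Sum>j=q * r..<q * r + r. d) = l / J" using r by (simp add: d_def)
      finally show ?thesis by (simp add: add.commute)
    qed
    have Gr: "(P j, y (P j)) \<in> Qreg l b" if "j \<le> J * r" for j
      using that by (intro Xset_graph[OF _ y] P0 Pl) (use l in auto)
    let ?a = "\<alpha> (P (q * r), y (P (q * r)))"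
    have a0: "0 \<le> ?a" using qr by (intro \<alpha>0 Gr) (rule add_leD1)
    have "(\<Sum>j=q * r..<q * r + r. \<alpha> (P j, y (P j)) * seg_shape d (\<Delta> j)) \<le> (\<Sum>j=q * r..<q * r + r. (?a + w) * seg_shape d (\<Delta> j))"
    proof (intro sum_mono mult_right_mono)
      fix j assume j: "j \<in> {q * r..<q * r + r}"
      then have "P j - P (q * r) \<le> l / J" "0 \<le> P j - P (q * r)" using Plen Pm[of j "q * r + r"] Pm[of "q * r" j] by auto
      moreover have "\<bar>y (P j) - y (P (q * r))\<bar> \<le> P j - P (q * r)" using j qr by (intro dist) auto
      moreover have "j \<le> J * r" "q * r \<le> J * r" using j qr by (simp_all only: atLeastLessThan_iff) linarith+
      ultimately have "\<bar>\<alpha> (P j, y (P j)) - ?a\<bar> \<le> w" by (intro osc Gr) auto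
      then show "\<alpha> (P j, y (P j)) \<le> ?a + w" by simp
      show "0 \<le> seg_shape d (\<Delta> j)" using \<Delta>[of j] j qr by (intro seg_shape_nonneg) auto
    qed
    also have "\<dots> = (?a + w) * (\<Sum>j=q * r..<q * r + r. seg_shape d (\<Delta> j))" by (simp add: sum_distrib_left)
    also have "\<dots> \<le> (?a + w) * seg_shape (l / J) (y (P (Suc q * r)) - y (P (q * r)))"
      using gq a0 w by (intro mult_left_mono) auto
    also have "\<dots> \<le> ?a * seg_shape (l / J) (y (P (Suc q * r)) - y (P (q * r))) + w * (2 * (l / J))"
      using seg_shape_le[of "l / J"] l J w by (simp add: distrib_right mult_left_mono del: times_divide_eq_right)
    finally show "(\<Sum>j=q * r..<q * r + r. \<alpha> (P j, y (P j)) * seg_shape d (\<Delta> j))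
       \<le> ?a * seg_shape (l / J) (y (P (Suc q * r)) - y (P (q * r))) + w * (2 * (l / J))" .
  qed
  also have "\<dots> = disc_fun l \<alpha> J y + 2 * l * w"
    using J by (simp add: disc_fun_def PJ sum.distrib del: of_nat_Suc mult_Suc)
  finally show ?thesis .
qed

section \<open>Compactness and maximizers\<close>

lemma continuous_on_Qreg_oscillation:
  assumes \<alpha>: "continuous_on (Qreg l b) \<alpha>" and w: "0 < (w::real)"
  obtains d where "0 < d" "\<And>p q. p \<in> Qreg l b \<Longrightarrow> q \<in> Qreg l b \<Longrightarrow> \<bar>fst p - fst q\<bar> \<le> d \<Longrightarrow> \<bar>snd p - snd q\<bar> \<le> d \<Longrightarrow> \<bar>\<alpha> p - \<alpha> q\<bar> \<le> w"
proof -
  obtain d where d: "d > 0" "\<And>p q. p \<in> Qreg l b \<Longrightarrow> q \<in> Qreg l b \<Longrightarrow> dist q p < d \<Longrightarrow> dist (\<alpha> q) (\<alpha> p) < w"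
    using compact_uniformly_continuous[OF \<alpha> compact_Qreg] w unfolding uniformly_continuous_on_def by metis
  show ?thesis
  proof (rule that[of "d / 3"])
    fix p q assume pq: "p \<in> Qreg l b" "q \<in> Qreg l b" "\<bar>fst p - fst q\<bar> \<le> d / 3" "\<bar>snd p - snd q\<bar> \<le> d / 3"
    have "dist p q \<le> \<bar>fst p - fst q\<bar> + \<bar>snd p - snd q\<bar>"
      by (simp add: dist_prod_def dist_real_def sqrt_sum_squares_le_sum_abs)
    then have "dist p q < d" using pq d(1) by linarith
    then show "\<bar>\<alpha> p - \<alpha> q\<bar> \<le> w" using d(2)[of q p] pq by (simp add: dist_real_def)
  qed (use d in auto)
qed

lemma Qreg_bounded:
  assumes "continuous_on (Qreg l b) (\<alpha> :: _ \<Rightarrow> real)"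
  obtains A where "0 < A" "\<And>p. p \<in> Qreg l b \<Longrightarrow> \<alpha> p \<le> A"
proof -
  obtain A where A: "A > 0" "\<And>p. p \<in> Qreg l b \<Longrightarrow> \<bar>\<alpha> p\<bar> \<le> A"
    using compact_imp_bounded[OF compact_continuous_image[OF assms compact_Qreg]]
    by (auto simp: bounded_pos)
  show ?thesis using that[of A] A by force
qed

text \<open>Along powers of two any two partitions are nested, so the refinement estimate compares
  arbitrary levels.\<close>

lemma disc_fun_pow2_tendsto:
  assumes "0 < l" "y \<in> Xset l b" "continuous_on (Qreg l b) \<alpha>"
  shows "(\<lambda>k. disc_fun l \<alpha> (2 ^ k) y) \<longlonglongrightarrow> Gfun l \<alpha> y"
proof -
  have "strict_mono (\<lambda>k::nat. 2 ^ k - 1 :: nat)"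
  proof (rule strict_monoI)
    fix i j :: nat assume "i < j"
    then have "(2::nat) ^ i < 2 ^ j" by simp
    moreover have "(1::nat) \<le> 2 ^ i" by simp
    ultimately show "(2::nat) ^ i - 1 < 2 ^ j - 1" by linarith
  qed
  from LIMSEQ_subseq_LIMSEQ[OF disc_fun_tendsto_Gfun[OF assms] this] show ?thesis by (simp add: o_def)
qed

lemma disc_fun_tendsto_pointwise:
  assumes l: "0 < l" and K: "0 < K" and \<alpha>: "continuous_on (Qreg l b) \<alpha>"
    and y: "\<And>n. y n \<in> Xset l b" "Y \<in> Xset l b"
    and lim: "\<And>x. 0 \<le> x \<Longrightarrow> x \<le> l \<Longrightarrow> (\<lambda>n. y n x) \<longlonglongrightarrow> Y x"
  shows "(\<lambda>n. disc_fun l \<alpha> K (y n)) \<longlonglongrightarrow> disc_fun l \<alpha> K Y"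
  unfolding disc_fun_def
proof (intro tendsto_sum tendsto_mult)
  fix j assume j: "j \<in> {..<K}"
  define u v where "u = l * real j / real K" and "v = l * real (Suc j) / real K"
  have uv: "0 \<le> u" "u \<le> l" "0 \<le> v" "v \<le> l" using l j K by (auto simp: u_def v_def pos_divide_le_eq simp del: of_nat_Suc)
  have "(\<lambda>n. \<alpha> (u, y n u)) \<longlonglongrightarrow> \<alpha> (u, Y u)"
    using uv l y by (intro continuous_on_tendsto_compose[OF \<alpha>] tendsto_Pair lim always_eventually allI Xset_graph) auto
  then show "(\<lambda>n. \<alpha> (l * real j / real K, y n (l * real j / real K))) \<longlonglongrightarrow> \<alpha> (l * real j / real K, Y (l * real j / real K))"
    by (simp only: u_def)
  have "(\<lambda>n. seg_shape (l / real K) (y n v - y n u)) \<longlonglongrightarrow> seg_shape (l / real K) (Y v - Y u)"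
    unfolding seg_shape_def by (intro tendsto_intros lim uv)
  then show "(\<lambda>n. seg_shape (l / real K) (y n (l * real (Suc j) / real K) - y n (l * real j / real K)))
     \<longlonglongrightarrow> seg_shape (l / real K) (Y (l * real (Suc j) / real K) - Y (l * real j / real K))"
    by (simp only: u_def v_def)
qed

lemma Xset_limit:
  assumes l: "0 < l" and y: "\<And>n. y n \<in> Xset l b"
    and lim: "\<And>x. 0 \<le> x \<Longrightarrow> x \<le> l \<Longrightarrow> (\<lambda>n. y n x) \<longlonglongrightarrow> Y x"
  shows "Y \<in> Xset l b"
proof -
  have "(\<lambda>n. y n 0) \<longlonglongrightarrow> Y 0" "(\<lambda>n. y n l) \<longlonglongrightarrow> Y l" using lim l by auto
  then have "Y 0 = 0" "Y l = b" using y by (simp_all add: Xset_def LIMSEQ_const_iff)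
  moreover have "1-lipschitz_on {0..l} Y"
  proof (rule lipschitz_onI)
    fix s t assume st: "s \<in> {0..l}" "t \<in> {0..l}"
    have "(\<lambda>n. dist (y n s) (y n t)) \<longlonglongrightarrow> dist (Y s) (Y t)" using st by (intro tendsto_dist lim) auto
    moreover have "dist (y n s) (y n t) \<le> 1 * dist s t" for n
      using y[of n] st by (intro lipschitz_onD[of 1 "{0..l}"]) (auto simp: Xset_def)
    ultimately show "dist (Y s) (Y t) \<le> 1 * dist s t" by (intro LIMSEQ_le_const2) auto
  qed simp
  ultimately show ?thesis by (simp add: Xset_def)
qed

text \<open>Upper semicontinuity with the partition level varying along the sequence. Both the
  existence of a maximizer and the gap reduce to this statement.\<close>

lemma disc_fun_compactness:
  assumes l: "0 < l" and \<alpha>: "continuous_on (Qreg l b) \<alpha>" and \<alpha>0: "\<forall>p\<in>Qreg l b. 0 \<le> \<alpha> p"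
    and y: "\<And>n. y n \<in> Xset l b" and k: "\<And>n. n \<le> k n"
    and c: "\<And>n. c - 1 / real (Suc n) \<le> disc_fun l \<alpha> (2 ^ k n) (y n)"
  obtains Y r where "Y \<in> Xset l b" "strict_mono (r :: nat \<Rightarrow> nat)" "c \<le> Gfun l \<alpha> Y"
    "\<And>e. 0 < e \<Longrightarrow> \<exists>n0. \<forall>n\<ge>n0. \<forall>x\<in>{0..l}. \<bar>y (r n) x - Y x\<bar> < e"
proof -
  obtain Y r where r: "strict_mono (r :: nat \<Rightarrow> nat)" and
    unif: "\<And>e. 0 < e \<Longrightarrow> \<exists>N. \<forall>n x. n \<ge> N \<and> x \<in> {0..l} \<longrightarrow> norm (y (r n) x - Y x) < e"
  proof (rule Arzela_Ascoli[of "{0..l}" y l])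
    show "norm (y n x) \<le> l" if "x \<in> {0..l}" for n x
      using Xset_dist[OF y[of n], of 0 x] y[of n] that by (auto simp: Xset_def)
    show "\<exists>d>0. \<forall>n z. z \<in> {0..l} \<and> norm (x - z) < d \<longrightarrow> norm (y n x - y n z) < e" if "x \<in> {0..l}" "0 < e" for x e
    proof (intro exI[of _ e] conjI allI impI)
      fix n z assume z: "z \<in> {0..l} \<and> norm (x - z) < e"
      have "dist (y n x) (y n z) \<le> 1 * dist x z"
        using y[of n] z that by (intro lipschitz_onD[of 1 "{0..l}"]) (auto simp: Xset_def)
      then show "norm (y n x - y n z) < e" using z by (simp add: dist_norm)
    qed fact
  qed auto
  have lim: "(\<lambda>n. y (r n) x) \<longlonglongrightarrow> Y x" if "0 \<le> x" "x \<le> l" for x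
    by (rule LIMSEQ_I) (use unif that in fastforce)
  have Y: "Y \<in> Xset l b" by (rule Xset_limit[OF l y lim])
  \<comment> \<open>Two limits in a safe order: for a fixed level j the refinement estimate bounds
    the finer sums, continuity at level j lets n tend to infinity, and only then does j tend to
    infinity.\<close>
  have "c \<le> Gfun l \<alpha> Y + 2 * l * e" if e: "0 < e" for e
  proof -
    obtain d where d: "0 < d" "\<And>p q. p \<in> Qreg l b \<Longrightarrow> q \<in> Qreg l b \<Longrightarrow> \<bar>fst p - fst q\<bar> \<le> d \<Longrightarrow> \<bar>snd p - snd q\<bar> \<le> d \<Longrightarrow> \<bar>\<alpha> p - \<alpha> q\<bar> \<le> e"
      using continuous_on_Qreg_oscillation[OF \<alpha> e] by blast
    have "(\<lambda>j. l / 2 ^ j) \<longlonglongrightarrow> 0" by (rule LIMSEQ_divide_realpow_zero) simp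
    from order_tendstoD(2)[OF this d(1)] obtain j0 where j0: "\<And>j. j \<ge> j0 \<Longrightarrow> l / 2 ^ j < d"
      by (auto simp: eventually_sequentially)
    have "c \<le> disc_fun l \<alpha> (2 ^ j) Y + 2 * l * e" if j: "j \<ge> j0" for j
    proof (rule LIMSEQ_le)
      have "(\<lambda>n. 1 / real (Suc (r n))) \<longlonglongrightarrow> 0"
        using LIMSEQ_subseq_LIMSEQ[OF LIMSEQ_inverse_real_of_nat r] by (simp add: o_def inverse_eq_divide)
      from tendsto_diff[OF tendsto_const this, of c] show "(\<lambda>n. c - 1 / real (Suc (r n))) \<longlonglongrightarrow> c" by simp
      show "(\<lambda>n. disc_fun l \<alpha> (2 ^ j) (y (r n)) + 2 * l * e) \<longlonglongrightarrow> disc_fun l \<alpha> (2 ^ j) Y + 2 * l * e"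
        by (intro tendsto_add tendsto_const disc_fun_tendsto_pointwise[OF l _ \<alpha>] y Y lim) auto
      show "\<exists>n0. \<forall>n\<ge>n0. c - 1 / real (Suc (r n)) \<le> disc_fun l \<alpha> (2 ^ j) (y (r n)) + 2 * l * e"
      proof (intro exI[of _ j] allI impI)
        fix n assume "n \<ge> j"
        then have jk: "j \<le> k (r n)" using k[of "r n"] seq_suble[OF r, of n] by linarith
        have "c - 1 / real (Suc (r n)) \<le> disc_fun l \<alpha> (2 ^ k (r n)) (y (r n))" by (rule c)
        also have "(2::nat) ^ k (r n) = 2 ^ j * 2 ^ (k (r n) - j)" using jk by (simp add: power_add[symmetric])
        also have "disc_fun l \<alpha> \<dots> (y (r n)) \<le> disc_fun l \<alpha> (2 ^ j) (y (r n)) + 2 * l * e"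
          using e j0[OF j] by (intro disc_fun_refine[OF l y] \<alpha>0[rule_format] d(2)) auto
        finally show "c - 1 / real (Suc (r n)) \<le> disc_fun l \<alpha> (2 ^ j) (y (r n)) + 2 * l * e" .
      qed
    qed
    then show ?thesis
      by (intro LIMSEQ_le_const[OF tendsto_add[OF disc_fun_pow2_tendsto[OF l Y \<alpha>] tendsto_const]]) blast
  qed
  from this[of "_ / (2 * l)"] have "c \<le> Gfun l \<alpha> Y + e" if "0 < e" for e using that l by (force simp: field_simps)
  then have "c \<le> Gfun l \<alpha> Y" by (rule field_le_epsilon)
  then show ?thesis using that[OF Y r] unif by fastforce
qed

lemma disc_fun_le:
  assumes l: "0 < l" and K: "0 < K" and A: "0 \<le> A" "\<And>p. p \<in> Qreg l b \<Longrightarrow> \<alpha> p \<le> A" and y: "y \<in> Xset l b"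
  shows "disc_fun l \<alpha> K y \<le> 2 * l * A"
proof -
  have "disc_fun l \<alpha> K y \<le> (\<Sum>j<K. A * (2 * (l / K)))"
    unfolding disc_fun_def
  proof (intro sum_mono)
    fix j assume j: "j \<in> {..<K}"
    define u v where "u = l * real j / real K" and "v = l * real (Suc j) / real K"
    have "l * real (Suc j) \<le> l * real K" using l j by (intro mult_left_mono) auto
    then have uv: "0 \<le> u" "u \<le> l" "u \<le> v" "v \<le> l" "v - u = l / K"
      using l j K by (auto simp: u_def v_def field_simps)
    have "0 \<le> seg_shape (l / K) (y v - y u)" "seg_shape (l / K) (y v - y u) \<le> 2 * (l / K)"
      using Xset_dist[OF y uv(1,3,4)] uv(5) l by (auto intro!: seg_shape_nonneg seg_shape_le simp del: times_divide_eq_right)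
    then have "\<alpha> (u, y u) * seg_shape (l / K) (y v - y u) \<le> A * (2 * (l / K))"
      using Xset_graph[OF _ y uv(1,2)] l A by (intro mult_mono) auto
    then show "\<alpha> (l * real j / real K, y (l * real j / real K)) *
         seg_shape (l / real K) (y (l * real (Suc j) / real K) - y (l * real j / real K)) \<le> A * (2 * (l / K))"
      by (simp only: u_def v_def)
  qed
  then show ?thesis using K by (simp add: mult.commute)
qed

lemma Gfun_bdd_above:
  assumes l: "0 < l" and \<alpha>: "continuous_on (Qreg l b) \<alpha>"
  shows "bdd_above (Gfun l \<alpha> ` Xset l b)"
proof -
  obtain A where A: "0 < A" "\<And>p. p \<in> Qreg l b \<Longrightarrow> \<alpha> p \<le> A" using Qreg_bounded[OF \<alpha>] by blast
  show ?thesis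
  proof (rule bdd_aboveI2)
    fix y assume y: "y \<in> Xset l b"
    show "Gfun l \<alpha> y \<le> 2 * l * A"
      using A by (intro LIMSEQ_le_const2[OF disc_fun_tendsto_Gfun[OF l y \<alpha>]] exI allI impI disc_fun_le[OF l]) (auto intro: y)
  qed
qed

text \<open>The direct method, run on partition sums: each near-maximizer of \<open>Gfun\<close> is
  already near-maximal at some level above n. The straight line to (l, b) shows that the class of
  curves is nonempty.\<close>

lemma Gfun_maximizer:
  assumes l: "0 < l" and b: "\<bar>b\<bar> < l" and \<alpha>: "continuous_on (Qreg l b) \<alpha>" and \<alpha>0: "\<forall>p\<in>Qreg l b. 0 \<le> \<alpha> p"
  shows "\<exists>ys\<in>Xset l b. Gfun l \<alpha> ys = (SUP y\<in>Xset l b. Gfun l \<alpha> y)"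
proof -
  let ?s = "SUP y\<in>Xset l b. Gfun l \<alpha> y"
  have "(\<lambda>x. b * x / l) \<in> Xset l b"
  proof -
    have "\<bar>b * s / l - b * t / l\<bar> \<le> \<bar>s - t\<bar>" for s t
    proof -
      have "\<bar>b * s / l - b * t / l\<bar> = \<bar>b\<bar> / l * \<bar>s - t\<bar>"
        using l by (simp add: diff_divide_distrib[symmetric] right_diff_distrib[symmetric] abs_mult abs_divide)
      also have "\<dots> \<le> 1 * \<bar>s - t\<bar>" using l b by (intro mult_right_mono) auto
      finally show ?thesis by simp
    qed
    then show ?thesis using l by (auto simp: Xset_def dist_real_def intro!: lipschitz_onI)
  qed
  then have ne: "Xset l b \<noteq> {}" by auto
  have "\<exists>y k. y \<in> Xset l b \<and> n \<le> k \<and> ?s - 1 / real (Suc n) \<le> disc_fun l \<alpha> (2 ^ k) y" for n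
  proof -
    have "?s - 1 / real (Suc n) < ?s" by simp
    then obtain y where y: "y \<in> Xset l b" "?s - 1 / real (Suc n) < Gfun l \<alpha> y"
      using less_cSUP_iff[OF ne Gfun_bdd_above[OF l \<alpha>]] by blast
    have "\<forall>\<^sub>F k in sequentially. ?s - 1 / real (Suc n) < disc_fun l \<alpha> (2 ^ k) y"
      by (rule order_tendstoD(1)[OF disc_fun_pow2_tendsto[OF l y(1) \<alpha>] y(2)])
    then obtain k0 where "\<And>k. k \<ge> k0 \<Longrightarrow> ?s - 1 / real (Suc n) < disc_fun l \<alpha> (2 ^ k) y"
      by (auto simp: eventually_sequentially)
    then show ?thesis using y(1) by (intro exI[of _ y] exI[of _ "max n k0"]) (auto intro: less_imp_le)
  qed
  then obtain y k where yk: "\<And>n. y n \<in> Xset l b" "\<And>n. n \<le> k n" "\<And>n. ?s - 1 / real (Suc n) \<le> disc_fun l \<alpha> (2 ^ k n) (y n)"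
    by metis
  obtain Y where Y: "Y \<in> Xset l b" "?s \<le> Gfun l \<alpha> Y"
    using disc_fun_compactness[OF l \<alpha> \<alpha>0 yk] by metis
  moreover have "Gfun l \<alpha> Y \<le> ?s" by (rule cSUP_upper[OF Y(1) Gfun_bdd_above[OF l \<alpha>]])
  ultimately show ?thesis by (intro bexI[of _ Y]) auto
qed

text \<open>Otherwise there are curves at distance \<delta> with values nearly s at ever higher
  levels. Their uniform limit reaches s, hence equals \<open>ys\<close>, yet it keeps its distance
  from \<open>ys\<close>. One \<kappa> serves all levels from \<open>k0\<close> on, so the level can
  be fixed later by other requirements.\<close>

lemma disc_fun_gap:
  assumes l: "0 < l" and \<alpha>: "continuous_on (Qreg l b) \<alpha>" and \<alpha>0: "\<forall>p\<in>Qreg l b. 0 \<le> \<alpha> p"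
    and uniq: "\<And>y. y \<in> Xset l b \<Longrightarrow> s \<le> Gfun l \<alpha> y \<Longrightarrow> \<forall>x\<in>{0..l}. y x = ys x"
    and \<delta>: "0 < \<delta>"
  obtains \<kappa> k0 where "0 < \<kappa>" "\<And>k y x. k0 \<le> k \<Longrightarrow> y \<in> Xset l b \<Longrightarrow> x \<in> {0..l} \<Longrightarrow> \<delta> \<le> \<bar>y x - ys x\<bar> \<Longrightarrow> disc_fun l \<alpha> (2 ^ k) y \<le> s - \<kappa>"
proof (rule ccontr)
  note T = that
  assume nt: "\<not> thesis"
  have *: "\<not> (\<forall>k y x. k0 \<le> k \<longrightarrow> y \<in> Xset l b \<longrightarrow> x \<in> {0..l} \<longrightarrow> \<delta> \<le> \<bar>y x - ys x\<bar> \<longrightarrow> disc_fun l \<alpha> (2 ^ k) y \<le> s - \<kappa>)"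
    if "0 < \<kappa>" for k0 \<kappa> using T[OF that] nt by blast
  have "\<exists>y k x. y \<in> Xset l b \<and> n \<le> k \<and> x \<in> {0..l} \<and> \<delta> \<le> \<bar>y x - ys x\<bar> \<and> s - 1 / real (Suc n) \<le> disc_fun l \<alpha> (2 ^ k) y" for n
    using *[of "1 / real (Suc n)" n] by (force simp: not_le)
  then obtain y k x where yk: "\<And>n. y n \<in> Xset l b" "\<And>n. n \<le> k n" "\<And>n. s - 1 / real (Suc n) \<le> disc_fun l \<alpha> (2 ^ k n) (y n)"
    and x: "\<And>n. x n \<in> {0..l}" "\<And>n. \<delta> \<le> \<bar>y n (x n) - ys (x n)\<bar>"
    by metis
  obtain Y r where Y1: "Y \<in> Xset l b" and "strict_mono (r :: nat \<Rightarrow> nat)" and Y2: "s \<le> Gfun l \<alpha> Y"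
    and c: "\<And>e. 0 < e \<Longrightarrow> \<exists>n0. \<forall>n\<ge>n0. \<forall>x\<in>{0..l}. \<bar>y (r n) x - Y x\<bar> < e"
    by (rule disc_fun_compactness[OF l \<alpha> \<alpha>0 yk]) (rule that)
  obtain n where "\<forall>x\<in>{0..l}. \<bar>y (r n) x - Y x\<bar> < \<delta>" using c[OF \<delta>] by blast
  then show False using uniq[OF Y1 Y2] x[of "r n"] by force
qed

section \<open>Last passage values on the quadrant\<close>

text \<open>Both endpoints of a path contribute their weight, so a path from \<open>(0, 0)\<close> to \<open>(m, n)\<close> lives on \<open>Suc m\<close> columns and
  \<open>Suc n\<close> rows; this is why the limit shape appears with successors in the tail bounds.\<close>
fun lpp :: "(nat \<Rightarrow> nat \<Rightarrow> real) \<Rightarrow> nat \<Rightarrow> nat \<Rightarrow> real" where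
  "lpp f 0 0 = f 0 0"
| "lpp f (Suc m) 0 = lpp f m 0 + f (Suc m) 0"
| "lpp f 0 (Suc n) = lpp f 0 n + f 0 (Suc n)"
| "lpp f (Suc m) (Suc n) = max (lpp f m (Suc n)) (lpp f (Suc m) n) + f (Suc m) (Suc n)"

definition shift :: "(nat \<Rightarrow> nat \<Rightarrow> real) \<Rightarrow> nat \<Rightarrow> nat \<Rightarrow> nat \<Rightarrow> nat \<Rightarrow> real" where
  "shift f a b i j = f (a + i) (b + j)"

lemma shift_shift: "shift (shift f a b) c d = shift f (a + c) (b + d)"
  by (auto simp: shift_def fun_eq_iff add.assoc)

lemma lpp_step_right: "lpp f m n + f (Suc m) n \<le> lpp f (Suc m) n"
  by (cases n) auto

lemma lpp_step_up: "lpp f m n + f m (Suc n) \<le> lpp f m (Suc n)"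
  by (cases m) auto

lemma lpp_cong: "(\<And>i j. i \<le> m \<Longrightarrow> j \<le> n \<Longrightarrow> f i j = h i j) \<Longrightarrow> lpp f m n = lpp h m n"
  by (induction f m n rule: lpp.induct) auto

lemma lpp_mono: "(\<And>i j. i \<le> m \<Longrightarrow> j \<le> n \<Longrightarrow> f i j \<le> h i j) \<Longrightarrow> lpp f m n \<le> lpp h m n"
proof (induction f m n rule: lpp.induct)
  case (4 f m n)
  have "lpp f m (Suc n) \<le> lpp h m (Suc n)" "lpp f (Suc m) n \<le> lpp h (Suc m) n" "f (Suc m) (Suc n) \<le> h (Suc m) (Suc n)"
    using 4 by auto
  then show ?case by (auto simp: max_def)
qed (auto intro!: add_mono)

lemma lpp_scale: "0 \<le> c \<Longrightarrow> lpp (\<lambda>i j. c * f i j) m n = c * lpp f m n"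
  by (induction f m n rule: lpp.induct) (auto simp: algebra_simps max_mult_distrib_left)

lemma lpp_ge_last: "(\<And>i j. i \<le> m \<Longrightarrow> j \<le> n \<Longrightarrow> 0 \<le> f i j) \<Longrightarrow> f m n \<le> lpp f m n \<and> 0 \<le> lpp f m n"
  by (induction f m n rule: lpp.induct) (auto simp: le_max_iff_disj)

text \<open>Optimal paths to and from (a, b) are concatenated. The site (a, b) belongs to both and
  is subtracted once.\<close>

lemma lpp_superadditive: "lpp f a b + lpp (shift f a b) m n - f a b \<le> lpp f (a + m) (b + n)"
proof (induction "shift f a b" m n rule: lpp.induct)
  case 1 then show ?case by (simp add: shift_def)
next
  case (2 m) then show ?case using lpp_step_right[of f "a + m" b] by (simp add: shift_def)
next
  case (3 n) then show ?case using lpp_step_up[of f a "b + n"] by (simp add: shift_def)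
next
  case (4 m n)
  then show ?case using lpp_step_right[of f "a + m" "b + Suc n"] lpp_step_up[of f "a + Suc m" "b + n"]
    by (auto simp: shift_def max_def)
qed

lemma lpp_shift_le:
  assumes "\<And>i j. i \<le> a + m \<Longrightarrow> j \<le> b + n \<Longrightarrow> 0 \<le> f i j"
  shows "lpp (shift f a b) m n \<le> lpp f (a + m) (b + n)"
  using lpp_superadditive[of f a b m n] lpp_ge_last[of a b f] assms by fastforce

text \<open>A maximal path to a site off the axes runs along exactly one axis and leaves it after
  \<open>Suc k\<close> steps, entering the bulk from row or column 0 to row or column 1. The
  induction peels off the last step, which also extends the bulk part.\<close>

lemma lpp_exit:
  "(\<exists>k\<le>m. lpp f (Suc m) (Suc n) \<le> lpp f (Suc k) 0 + lpp (shift f (Suc k) 1) (m - k) n) \<or>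
   (\<exists>k\<le>n. lpp f (Suc m) (Suc n) \<le> lpp f 0 (Suc k) + lpp (shift f 1 (Suc k)) m (n - k))"
proof (induction "m + n" arbitrary: m n rule: less_induct)
  case less
  let ?w = "f (Suc m) (Suc n)"
  have R: "lpp (shift f a b) i j + f (a + Suc i) (b + j) \<le> lpp (shift f a b) (Suc i) j"
    and U: "lpp (shift f a b) i j + f (a + i) (b + Suc j) \<le> lpp (shift f a b) i (Suc j)" for a b i j
    using lpp_step_right[of "shift f a b" i j] lpp_step_up[of "shift f a b" i j] by (simp_all add: shift_def)
  consider "lpp f (Suc m) (Suc n) = lpp f m (Suc n) + ?w" | "lpp f (Suc m) (Suc n) = lpp f (Suc m) n + ?w"
    by (simp add: max_def) (metis (full_types))
  then show ?case
  proof cases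
    case 1
    show ?thesis
    proof (cases m)
      case 0
      then show ?thesis using 1 by (intro disjI2 exI[of _ n]) (simp add: shift_def)
    next
      case (Suc m')
      have "(\<exists>k\<le>m'. lpp f (Suc m') (Suc n) \<le> lpp f (Suc k) 0 + lpp (shift f (Suc k) 1) (m' - k) n) \<or>
        (\<exists>k\<le>n. lpp f (Suc m') (Suc n) \<le> lpp f 0 (Suc k) + lpp (shift f 1 (Suc k)) m' (n - k))"
        using Suc by (intro less) simp
      then show ?thesis
      proof (elim disjE exE conjE)
        fix k assume k: "k \<le> m'" "lpp f (Suc m') (Suc n) \<le> lpp f (Suc k) 0 + lpp (shift f (Suc k) 1) (m' - k) n"
        then have "lpp f (Suc m) (Suc n) \<le> lpp f (Suc k) 0 + lpp (shift f (Suc k) 1) (m - k) n"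
          using 1 Suc R[of "Suc k" 1 "m' - k" n] by (simp add: Suc_diff_le)
        then show ?thesis using k Suc by (intro disjI1 exI[of _ k]) auto
      next
        fix k assume k: "k \<le> n" "lpp f (Suc m') (Suc n) \<le> lpp f 0 (Suc k) + lpp (shift f 1 (Suc k)) m' (n - k)"
        then have "lpp f (Suc m) (Suc n) \<le> lpp f 0 (Suc k) + lpp (shift f 1 (Suc k)) m (n - k)"
          using 1 Suc R[of 1 "Suc k" m' "n - k"] by simp
        then show ?thesis using k by (intro disjI2 exI[of _ k]) auto
      qed
    qed
  next
    case 2
    show ?thesis
    proof (cases n)
      case 0
      then show ?thesis using 2 by (intro disjI1 exI[of _ m]) (simp add: shift_def)
    next
      case (Suc n')
      have "(\<exists>k\<le>m. lpp f (Suc m) (Suc n') \<le> lpp f (Suc k) 0 + lpp (shift f (Suc k) 1) (m - k) n') \<or>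
        (\<exists>k\<le>n'. lpp f (Suc m) (Suc n') \<le> lpp f 0 (Suc k) + lpp (shift f 1 (Suc k)) m (n' - k))"
        using Suc by (intro less) simp
      then show ?thesis
      proof (elim disjE exE conjE)
        fix k assume k: "k \<le> m" "lpp f (Suc m) (Suc n') \<le> lpp f (Suc k) 0 + lpp (shift f (Suc k) 1) (m - k) n'"
        then have "lpp f (Suc m) (Suc n) \<le> lpp f (Suc k) 0 + lpp (shift f (Suc k) 1) (m - k) n"
          using 2 Suc U[of "Suc k" 1 "m - k" n'] by simp
        then show ?thesis using k by (intro disjI1 exI[of _ k]) auto
      next
        fix k assume k: "k \<le> n'" "lpp f (Suc m) (Suc n') \<le> lpp f 0 (Suc k) + lpp (shift f 1 (Suc k)) m (n' - k)"
        then have "lpp f (Suc m) (Suc n) \<le> lpp f 0 (Suc k) + lpp (shift f 1 (Suc k)) m (n - k)"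
          using 2 Suc U[of 1 "Suc k" m "n' - k"] by (simp add: Suc_diff_le)
        then show ?thesis using k Suc by (intro disjI2 exI[of _ k]) auto
      qed
    qed
  qed
qed

section \<open>Up-right paths and the last passage value as their maximal weight\<close>

definition lattice_path :: "(nat \<Rightarrow> nat \<times> nat) \<Rightarrow> nat \<Rightarrow> bool" where
  "lattice_path P k \<longleftrightarrow> (\<forall>i<k. P (Suc i) = (Suc (fst (P i)), snd (P i)) \<or> P (Suc i) = (fst (P i), Suc (snd (P i))))"

lemma lattice_path_mono: "lattice_path P k \<Longrightarrow> s \<le> t \<Longrightarrow> t \<le> k \<Longrightarrow> fst (P s) \<le> fst (P t) \<and> snd (P s) \<le> snd (P t)"
proof (induction t)
  case (Suc t)
  then show ?case by (cases "s = Suc t") (auto simp: lattice_path_def Suc_le_eq dest!: spec[of _ t])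
qed simp

lemma lattice_path_sum: "lattice_path P k \<Longrightarrow> t \<le> k \<Longrightarrow> P 0 = (0, 0) \<Longrightarrow> fst (P t) + snd (P t) = t"
  by (induction t) (auto simp: lattice_path_def Suc_le_eq dest!: spec)

text \<open>Stated for an arbitrary stretch of a path, so that a long path can be cut and each
  stretch compared with the rectangle spanned by its ends.\<close>

lemma lattice_path_le_lpp:
  assumes "lattice_path P k" "s \<le> t" "t \<le> k"
  shows "(\<Sum>i=s..t. f (fst (P i)) (snd (P i))) \<le>
     lpp (shift f (fst (P s)) (snd (P s))) (fst (P t) - fst (P s)) (snd (P t) - snd (P s))"
  using assms(2,3)
proof (induction t)
  case 0 then show ?case by (simp add: shift_def)
next
  case (Suc t)
  show ?case
  proof (cases "s = Suc t")
    case True then show ?thesis by (simp add: shift_def)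
  next
    case False
    then have st: "s \<le> t" "t < k" using Suc.prems by auto
    note IH = Suc.IH[OF st(1) less_imp_le[OF st(2)]]
    note mono = lattice_path_mono[OF assms(1) st(1) less_imp_le[OF st(2)]]
    let ?f = "shift f (fst (P s)) (snd (P s))" and ?m = "fst (P t) - fst (P s)" and ?n = "snd (P t) - snd (P s)"
    have 1: "(\<Sum>i=s..Suc t. f (fst (P i)) (snd (P i))) = (\<Sum>i=s..t. f (fst (P i)) (snd (P i))) + f (fst (P (Suc t))) (snd (P (Suc t)))"
      using st by simp
    have 2: "?f (Suc ?m) ?n = f (Suc (fst (P t))) (snd (P t))" "?f ?m (Suc ?n) = f (fst (P t)) (Suc (snd (P t)))"
      using mono by (simp_all add: shift_def)
    have "P (Suc t) = (Suc (fst (P t)), snd (P t)) \<or> P (Suc t) = (fst (P t), Suc (snd (P t)))"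
      using assms(1) st by (auto simp: lattice_path_def)
    then show ?thesis unfolding 1
      using IH mono 2 lpp_step_right[of ?f ?m ?n] lpp_step_up[of ?f ?m ?n]
      by (auto simp: Suc_diff_le)
  qed
qed

lemma lpp_attained:
  "\<exists>P. lattice_path P (m + n) \<and> P 0 = (0, 0) \<and> P (m + n) = (m, n) \<and>
     (\<Sum>i\<le>m + n. f (fst (P i)) (snd (P i))) = lpp f m n"
proof -
  have ext: "\<exists>P. lattice_path P (Suc k) \<and> P 0 = (0, 0) \<and> P (Suc k) = q \<and>
     (\<Sum>i\<le>Suc k. f (fst (P i)) (snd (P i))) = c + f (fst q) (snd q)"
    if P: "lattice_path P k" "P 0 = (0, 0)" "(\<Sum>i\<le>k. f (fst (P i)) (snd (P i))) = c"
      and q: "q = (Suc (fst (P k)), snd (P k)) \<or> q = (fst (P k), Suc (snd (P k)))" for f P k q c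
  proof (intro exI[of _ "P(Suc k := q)"] conjI)
    show "lattice_path (P(Suc k := q)) (Suc k)" using P(1) q by (auto simp: lattice_path_def less_Suc_eq)
    show "(\<Sum>i\<le>Suc k. f (fst ((P(Suc k := q)) i)) (snd ((P(Suc k := q)) i))) = c + f (fst q) (snd q)"
      using P(3) by simp
  qed (use P in auto)
  show ?thesis
  proof (induction f m n rule: lpp.induct)
    case (1 f)
    show ?case by (intro exI[of _ "\<lambda>_. (0, 0)"]) (simp add: lattice_path_def)
  next
    case (2 f m)
    then obtain P where "lattice_path P m" "P 0 = (0, 0)" "P m = (m, 0)" "(\<Sum>i\<le>m. f (fst (P i)) (snd (P i))) = lpp f m 0" by auto
    then show ?case using ext[of P m f "lpp f m 0" "(Suc m, 0)"] by auto
  next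
    case (3 f n)
    then obtain P where "lattice_path P n" "P 0 = (0, 0)" "P n = (0, n)" "(\<Sum>i\<le>n. f (fst (P i)) (snd (P i))) = lpp f 0 n" by auto
    then show ?case using ext[of P n f "lpp f 0 n" "(0, Suc n)"] by auto
  next
    case (4 f m n)
    show ?case
    proof (cases "lpp f (Suc m) n \<le> lpp f m (Suc n)")
      case True
      from 4(1) obtain P where "lattice_path P (m + Suc n)" "P 0 = (0, 0)" "P (m + Suc n) = (m, Suc n)"
        "(\<Sum>i\<le>m + Suc n. f (fst (P i)) (snd (P i))) = lpp f m (Suc n)" by blast
      then show ?thesis using True ext[of P "m + Suc n" f "lpp f m (Suc n)" "(Suc m, Suc n)"] by (auto simp: max_def)
    next
      case False
      from 4(2) obtain P where "lattice_path P (Suc m + n)" "P 0 = (0, 0)" "P (Suc m + n) = (Suc m, n)"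
        "(\<Sum>i\<le>Suc m + n. f (fst (P i)) (snd (P i))) = lpp f (Suc m) n" by blast
      then show ?thesis using False ext[of P "Suc m + n" f "lpp f (Suc m) n" "(Suc m, Suc n)"] by (auto simp: max_def)
    qed
  qed
qed

section \<open>The Burke property\<close>

definition exp_measure :: "real \<Rightarrow> real measure" where
  "exp_measure r = density lborel (exponential_density r)"

lemma sets_exp_measure [simp, measurable_cong]: "sets (exp_measure r) = sets borel" by (simp add: exp_measure_def)
lemma space_exp_measure [simp]: "space (exp_measure r) = UNIV" by (simp add: exp_measure_def)
lemma prob_space_exp_measure: "0 < r \<Longrightarrow> prob_space (exp_measure r)"
  unfolding exp_measure_def by (rule prob_space_exponential_density)

lemma nn_integral_lborel_shift:
  "f \<in> borel_measurable borel \<Longrightarrow> (\<integral>\<^sup>+x. f (x + t) \<partial>lborel) = (\<integral>\<^sup>+x. f x \<partial>(lborel :: real measure))"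
  using nn_integral_real_affine[of f 1 t] by (simp add: add.commute)

text \<open>On each of the regions \<open>u > v\<close> and \<open>u \<le> v\<close> the map
  \<open>(u, v, w) \<mapsto> (w + (u - v)\<^sup>+, w + (v - u)\<^sup>+, min u v)\<close> is, up to a permutation of the coordinates, a shift
  in one coordinate, and it leaves the product density invariant because \<open>a + b = 1\<close>.\<close>
lemma burke_nn_integral:
  fixes f :: "real \<times> real \<times> real \<Rightarrow> ennreal"
  assumes f [measurable]: "f \<in> borel_measurable (borel \<Otimes>\<^sub>M borel \<Otimes>\<^sub>M borel)"
    and ab: "0 < a" "0 < b" "a + b = 1"
  shows "(\<integral>\<^sup>+w. \<integral>\<^sup>+v. \<integral>\<^sup>+u. f (w + max 0 (u - v), w + max 0 (v - u), min u v) \<partial>exp_measure a \<partial>exp_measure b \<partial>exp_measure 1)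
       = (\<integral>\<^sup>+w. \<integral>\<^sup>+v. \<integral>\<^sup>+u. f (u, v, w) \<partial>exp_measure a \<partial>exp_measure b \<partial>exp_measure 1)"
proof -
  define e :: "real \<Rightarrow> real \<Rightarrow> ennreal" where "e r x = ennreal (exponential_density r x)" for r x
  have [measurable]: "e r \<in> borel_measurable borel" for r unfolding e_def by measurable
  have dens: "(\<integral>\<^sup>+w. \<integral>\<^sup>+v. \<integral>\<^sup>+u. h (u, v, w) \<partial>exp_measure a \<partial>exp_measure b \<partial>exp_measure 1)
    = (\<integral>\<^sup>+w. \<integral>\<^sup>+v. \<integral>\<^sup>+u. e 1 w * e b v * e a u * h (u, v, w) \<partial>lborel \<partial>lborel \<partial>lborel)"
    if [measurable]: "h \<in> borel_measurable (borel \<Otimes>\<^sub>M borel \<Otimes>\<^sub>M borel)" for h :: "real \<times> real \<times> real \<Rightarrow> ennreal"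
    unfolding exp_measure_def
    by (simp add: nn_integral_density nn_integral_cmult[symmetric] e_def[symmetric] mult.assoc)
  have fub: "(\<integral>\<^sup>+x. \<integral>\<^sup>+y. h (x, y) \<partial>lborel \<partial>lborel) = (\<integral>\<^sup>+y. \<integral>\<^sup>+x. h (x, y) \<partial>lborel \<partial>(lborel :: real measure))"
    if [measurable]: "h \<in> borel_measurable (borel \<Otimes>\<^sub>M borel)" for h :: "real \<times> real \<Rightarrow> ennreal"
    by (rule lborel_pair.Fubini'[symmetric]) simp
  \<comment> \<open>On u > v the substitution of u + (v - w) for u turns the image point into (u, w,
    v), so the density must match with v and w exchanged. The exponents differ by (1 - (a + b)) (v -
    w), which vanishes. \<open>D2\<close> is the same computation on u \<le> v, with the shift
    acting on v.\<close>
  have D1: "e 1 w * e b v * e a (u + (v - w)) = e b w * e 1 v * e a u" if "u > w" for u v w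
  proof (cases "w \<ge> 0 \<and> v \<ge> 0")
    case True
    have "exp (- w) * (b * exp (- (v * b))) * (a * exp (- ((u + (v - w)) * a))) = (b * exp (- (w * b))) * exp (- v) * (a * exp (- (u * a)))"
    proof -
      have "(- w) + (- (v * b)) + (- ((u + (v - w)) * a)) = (- (w * b)) + (- v) + (- (u * a)) + (1 - (a + b)) * (v - w)"
        by (simp add: algebra_simps)
      then have "exp (- w) * exp (- (v * b)) * exp (- ((u + (v - w)) * a)) = exp (- (w * b)) * exp (- v) * exp (- (u * a))"
        unfolding exp_add[symmetric] using ab(3) by simp
      then show ?thesis by (simp add: mult_ac)
    qed
    moreover have "e 1 w = ennreal (exp (- w))" "e b v = ennreal (b * exp (- (v * b)))" "e a (u + (v - w)) = ennreal (a * exp (- ((u + (v - w)) * a)))"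
      "e b w = ennreal (b * exp (- (w * b)))" "e 1 v = ennreal (exp (- v))" "e a u = ennreal (a * exp (- (u * a)))"
      using True that by (auto simp: e_def exponential_density_def algebra_simps)
    ultimately show ?thesis using ab by (simp only: ennreal_mult[symmetric] mult_nonneg_nonneg less_imp_le exp_ge_zero)
  next
    case False
    then show ?thesis using ab that by (auto simp: e_def exponential_density_def)
  qed
  have D2: "e 1 w * e b (v + (u - w)) * e a u = e 1 u * e b v * e a w" if "w \<le> v" for u v w
  proof (cases "w \<ge> 0 \<and> u \<ge> 0")
    case True
    have "exp (- w) * (b * exp (- ((v + (u - w)) * b))) * (a * exp (- (u * a))) = exp (- u) * (b * exp (- (v * b))) * (a * exp (- (w * a)))"
    proof -
      have "(- w) + (- ((v + (u - w)) * b)) + (- (u * a)) = (- u) + (- (v * b)) + (- (w * a)) + (1 - (a + b)) * (u - w)"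
        by (simp add: algebra_simps)
      then have "exp (- w) * exp (- ((v + (u - w)) * b)) * exp (- (u * a)) = exp (- u) * exp (- (v * b)) * exp (- (w * a))"
        unfolding exp_add[symmetric] using ab(3) by simp
      then show ?thesis by (simp add: mult_ac)
    qed
    moreover have "e 1 w = ennreal (exp (- w))" "e b (v + (u - w)) = ennreal (b * exp (- ((v + (u - w)) * b)))" "e a u = ennreal (a * exp (- (u * a)))"
      "e 1 u = ennreal (exp (- u))" "e b v = ennreal (b * exp (- (v * b)))" "e a w = ennreal (a * exp (- (w * a)))"
      using True that by (auto simp: e_def exponential_density_def algebra_simps)
    ultimately show ?thesis using ab by (simp only: ennreal_mult[symmetric] mult_nonneg_nonneg less_imp_le exp_ge_zero)
  next
    case False
    then show ?thesis using ab that by (auto simp: e_def exponential_density_def)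
  qed
  define k1 :: "real \<times> real \<times> real \<Rightarrow> ennreal" where "k1 = (\<lambda>(u, v, w). if u > v then 1 else 0)"
  define k2 :: "real \<times> real \<times> real \<Rightarrow> ennreal" where "k2 = (\<lambda>(u, v, w). if u \<le> v then 1 else 0)"
  have [measurable]: "k1 \<in> borel_measurable (borel \<Otimes>\<^sub>M borel \<Otimes>\<^sub>M borel)" "k2 \<in> borel_measurable (borel \<Otimes>\<^sub>M borel \<Otimes>\<^sub>M borel)"
    unfolding k1_def k2_def case_prod_unfold by measurable
  define T where "T = (\<lambda>(u, v, w). (w + max 0 (u - v), w + max 0 (v - u), min u (v::real)))"
  have [measurable]: "T \<in> borel \<Otimes>\<^sub>M borel \<Otimes>\<^sub>M borel \<rightarrow>\<^sub>M borel \<Otimes>\<^sub>M borel \<Otimes>\<^sub>M borel"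
    unfolding T_def case_prod_unfold by measurable
  let ?I = "\<lambda>g. \<integral>\<^sup>+w. \<integral>\<^sup>+v. \<integral>\<^sup>+u. e 1 w * e b v * e a u * g (u, v, w) \<partial>lborel \<partial>lborel \<partial>lborel"
  have split: "?I g = ?I (\<lambda>p. k1 p * g p) + ?I (\<lambda>p. k2 p * g p)"
    if [measurable]: "g \<in> borel_measurable (borel \<Otimes>\<^sub>M borel \<Otimes>\<^sub>M borel)" for g
  proof -
    have "e 1 w * e b v * e a u * g (u, v, w) = e 1 w * e b v * e a u * (k1 (u, v, w) * g (u, v, w)) + e 1 w * e b v * e a u * (k2 (u, v, w) * g (u, v, w))" for u v w
      by (auto simp: k1_def k2_def)
    then show ?thesis by (simp add: nn_integral_add)
  qed
  have 1: "?I (\<lambda>p. k1 p * f (T p)) = ?I (\<lambda>p. k1 p * f p)"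
  proof -
    have "?I (\<lambda>p. k1 p * f (T p)) = (\<integral>\<^sup>+w. \<integral>\<^sup>+v. \<integral>\<^sup>+u. e b w * e 1 v * e a u * (k1 (u, w, v) * f (u, w, v)) \<partial>lborel \<partial>lborel \<partial>lborel)"
    proof (rule nn_integral_cong, rule nn_integral_cong)
      fix w v :: real
      have "(\<integral>\<^sup>+u. e 1 w * e b v * e a u * (k1 (u, v, w) * f (T (u, v, w))) \<partial>lborel)
        = (\<integral>\<^sup>+u. e 1 w * e b v * e a (u + (v - w)) * (k1 (u + (v - w), v, w) * f (T (u + (v - w), v, w))) \<partial>lborel)"
        by (subst nn_integral_lborel_shift[of "\<lambda>u. e 1 w * e b v * e a u * (k1 (u, v, w) * f (T (u, v, w)))"]) auto
      also have "\<dots> = (\<integral>\<^sup>+u. e b w * e 1 v * e a u * (k1 (u, w, v) * f (u, w, v)) \<partial>lborel)"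
        using D1 by (intro nn_integral_cong) (auto simp: k1_def T_def)
      finally show "(\<integral>\<^sup>+u. e 1 w * e b v * e a u * (k1 (u, v, w) * f (T (u, v, w))) \<partial>lborel)
        = (\<integral>\<^sup>+u. e b w * e 1 v * e a u * (k1 (u, w, v) * f (u, w, v)) \<partial>lborel)" .
    qed
    also have "\<dots> = (\<integral>\<^sup>+v. \<integral>\<^sup>+w. \<integral>\<^sup>+u. e b w * e 1 v * e a u * (k1 (u, w, v) * f (u, w, v)) \<partial>lborel \<partial>lborel \<partial>lborel)"
      using fub[of "\<lambda>(w, v). \<integral>\<^sup>+u. e b w * e 1 v * e a u * (k1 (u, w, v) * f (u, w, v)) \<partial>lborel"] by simp
    finally show ?thesis by (simp add: mult.commute)
  qed
  have 2: "?I (\<lambda>p. k2 p * f (T p)) = ?I (\<lambda>p. k2 p * f p)"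
  proof -
    \<comment> \<open>Here the shift acts on v, so v must be the innermost variable; afterwards two
      more exchanges give the integration variables their original roles.\<close>
    have "?I (\<lambda>p. k2 p * f (T p)) = (\<integral>\<^sup>+w. \<integral>\<^sup>+u. \<integral>\<^sup>+v. e 1 w * e b v * e a u * (k2 (u, v, w) * f (T (u, v, w))) \<partial>lborel \<partial>lborel \<partial>lborel)"
      using fub[of "\<lambda>(v, u). e 1 w * e b v * e a u * (k2 (u, v, w) * f (T (u, v, w)))" for w] by simp
    also have "\<dots> = (\<integral>\<^sup>+w. \<integral>\<^sup>+u. \<integral>\<^sup>+v. e 1 u * e b v * e a w * (k2 (w, v, u) * f (w, v, u)) \<partial>lborel \<partial>lborel \<partial>lborel)"
    proof (rule nn_integral_cong, rule nn_integral_cong)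
      fix w u :: real
      have "(\<integral>\<^sup>+v. e 1 w * e b v * e a u * (k2 (u, v, w) * f (T (u, v, w))) \<partial>lborel)
        = (\<integral>\<^sup>+v. e 1 w * e b (v + (u - w)) * e a u * (k2 (u, v + (u - w), w) * f (T (u, v + (u - w), w))) \<partial>lborel)"
        by (subst nn_integral_lborel_shift[of "\<lambda>v. e 1 w * e b v * e a u * (k2 (u, v, w) * f (T (u, v, w)))"]) auto
      also have "\<dots> = (\<integral>\<^sup>+v. e 1 u * e b v * e a w * (k2 (w, v, u) * f (w, v, u)) \<partial>lborel)"
        using D2 by (intro nn_integral_cong) (auto simp: k2_def T_def)
      finally show "(\<integral>\<^sup>+v. e 1 w * e b v * e a u * (k2 (u, v, w) * f (T (u, v, w))) \<partial>lborel)
        = (\<integral>\<^sup>+v. e 1 u * e b v * e a w * (k2 (w, v, u) * f (w, v, u)) \<partial>lborel)" .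
    qed
    also have "\<dots> = (\<integral>\<^sup>+u. \<integral>\<^sup>+w. \<integral>\<^sup>+v. e 1 u * e b v * e a w * (k2 (w, v, u) * f (w, v, u)) \<partial>lborel \<partial>lborel \<partial>lborel)"
      using fub[of "\<lambda>(w, u). \<integral>\<^sup>+v. e 1 u * e b v * e a w * (k2 (w, v, u) * f (w, v, u)) \<partial>lborel"] by simp
    also have "\<dots> = (\<integral>\<^sup>+u. \<integral>\<^sup>+v. \<integral>\<^sup>+w. e 1 u * e b v * e a w * (k2 (w, v, u) * f (w, v, u)) \<partial>lborel \<partial>lborel \<partial>lborel)"
      using fub[of "\<lambda>(w, v). e 1 u * e b v * e a w * (k2 (w, v, u) * f (w, v, u))" for u] by simp
    finally show ?thesis .
  qed
  have "(\<integral>\<^sup>+w. \<integral>\<^sup>+v. \<integral>\<^sup>+u. f (T (u, v, w)) \<partial>exp_measure a \<partial>exp_measure b \<partial>exp_measure 1) = ?I (\<lambda>p. f (T p))"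
    by (rule dens) simp
  also have "\<dots> = ?I f" using split[of "\<lambda>p. f (T p)"] split[of f] 1 2 by simp
  also have "\<dots> = (\<integral>\<^sup>+w. \<integral>\<^sup>+v. \<integral>\<^sup>+u. f (u, v, w) \<partial>exp_measure a \<partial>exp_measure b \<partial>exp_measure 1)"
    by (rule dens[symmetric]) simp
  finally show ?thesis by (simp add: T_def)
qed

section \<open>Products of exponential laws and their invariance under one cell update\<close>

definition prod_exp :: "('i \<Rightarrow> real) \<Rightarrow> 'i set \<Rightarrow> ('i \<Rightarrow> real) measure" where
  "prod_exp r I = PiM I (\<lambda>k. exp_measure (r k))"

lemma sets_prod_exp [simp, measurable_cong]: "sets (prod_exp r I) = sets (PiM I (\<lambda>_. borel))"
  unfolding prod_exp_def by (intro sets_PiM_cong) auto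

lemma prob_space_prod_exp: "(\<And>k. 0 < r k) \<Longrightarrow> prob_space (prod_exp r I)"
  unfolding prod_exp_def by (intro prob_space_PiM prob_space_exp_measure)

text \<open>One cell of the recursion: p holds the horizontal increment below the cell, q the
  vertical increment to its left and s the weight of the cell. They become the increments above and
  to the right; the minimum is kept in s so that the map acts on the whole configuration and can
  preserve its law.\<close>

definition burke_map :: "'i \<Rightarrow> 'i \<Rightarrow> 'i \<Rightarrow> ('i \<Rightarrow> real) \<Rightarrow> ('i \<Rightarrow> real)" where
  "burke_map p q s x = x(p := x s + max 0 (x p - x q), q := x s + max 0 (x q - x p), s := min (x p) (x q))"

lemma measurable_burke_map:
  assumes "p \<in> I" "q \<in> I" "s \<in> I"
  shows "burke_map p q s \<in> PiM I (\<lambda>_. borel) \<rightarrow>\<^sub>M PiM I (\<lambda>_. borel)"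
proof -
  have [measurable]: "(\<lambda>x. x p) \<in> borel_measurable (PiM I (\<lambda>_. borel))" "(\<lambda>x. x q) \<in> borel_measurable (PiM I (\<lambda>_. borel))"
     "(\<lambda>x. x s) \<in> borel_measurable (PiM I (\<lambda>_. borel))" using assms by auto
  show ?thesis unfolding burke_map_def
    by (intro measurable_fun_upd[where J = I]) (use assms in auto)
qed

text \<open>The coordinates p, q and s are integrated first, the others being frozen, so the
  three-variable identity applies inside the integral.\<close>

lemma distr_burke_map:
  assumes I: "finite I" "p \<in> I" "q \<in> I" "s \<in> I" "p \<noteq> q" "p \<noteq> s" "q \<noteq> s"
    and r: "\<And>k. 0 < r k" "r p + r q = 1" "r s = 1"
  shows "distr (prod_exp r I) (PiM I (\<lambda>_. borel)) (burke_map p q s) = prod_exp r I"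
proof (rule measure_eqI)
  interpret P: product_prob_space "\<lambda>k. exp_measure (r k)" by (intro product_prob_spaceI prob_space_exp_measure r)
  have mb [measurable]: "burke_map p q s \<in> PiM I (\<lambda>_. borel) \<rightarrow>\<^sub>M PiM I (\<lambda>_. borel)"
    by (rule measurable_burke_map) (use I in auto)
  define R where "R = I - {p, q, s}"
  have R: "finite R" "p \<notin> R" "q \<notin> R" "s \<notin> R" "I = insert p (insert q (insert s R))" using I by (auto simp: R_def)
  \<comment> \<open>Partial integrals stay measurable, which allows the coordinates to be split off
    one after another.\<close>
  have mk: "(\<lambda>x. \<integral>\<^sup>+u. h (x(k := u)) \<partial>exp_measure (r k)) \<in> borel_measurable (PiM J (\<lambda>k. exp_measure (r k)))"
    if "h \<in> borel_measurable (PiM (insert k J) (\<lambda>k. exp_measure (r k)))" for h k J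
  proof -
    have "(\<lambda>z. h ((fst z)(k := snd z))) \<in> borel_measurable (PiM J (\<lambda>k. exp_measure (r k)) \<Otimes>\<^sub>M exp_measure (r k))"
      using measurable_compose[OF measurable_add_dim that] by (simp add: case_prod_unfold)
    from sigma_finite_measure.borel_measurable_nn_integral_fst[OF prob_space_imp_sigma_finite[OF prob_space_exp_measure[OF r(1)]] this] show ?thesis by simp
  qed
  have ins: "(\<integral>\<^sup>+x. g x \<partial>prod_exp r I) = (\<integral>\<^sup>+x. \<integral>\<^sup>+w. \<integral>\<^sup>+v. \<integral>\<^sup>+u. g (x(s := w, q := v, p := u)) \<partial>exp_measure (r p) \<partial>exp_measure (r q) \<partial>exp_measure (r s) \<partial>prod_exp r R)"
    if g [measurable]: "g \<in> borel_measurable (PiM I (\<lambda>_. borel))" for g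
  proof -
    have g1: "g \<in> borel_measurable (PiM (insert p (insert q (insert s R))) (\<lambda>k. exp_measure (r k)))"
      using g sets_prod_exp[of r I] unfolding prod_exp_def R(5) by (simp cong: measurable_cong_sets)
    have "(\<integral>\<^sup>+x. g x \<partial>prod_exp r I) = (\<integral>\<^sup>+x. \<integral>\<^sup>+u. g (x(p := u)) \<partial>exp_measure (r p) \<partial>PiM (insert q (insert s R)) (\<lambda>k. exp_measure (r k)))"
      unfolding prod_exp_def R(5) by (rule P.product_nn_integral_insert[OF _ _ g1]) (use R I in auto)
    also have "\<dots> = (\<integral>\<^sup>+x. \<integral>\<^sup>+v. \<integral>\<^sup>+u. g (x(q := v, p := u)) \<partial>exp_measure (r p) \<partial>exp_measure (r q) \<partial>PiM (insert s R) (\<lambda>k. exp_measure (r k)))"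
      by (rule P.product_nn_integral_insert[OF _ _ mk[OF g1]]) (use R I in auto)
    also have "\<dots> = (\<integral>\<^sup>+x. \<integral>\<^sup>+w. \<integral>\<^sup>+v. \<integral>\<^sup>+u. g (x(s := w, q := v, p := u)) \<partial>exp_measure (r p) \<partial>exp_measure (r q) \<partial>exp_measure (r s) \<partial>PiM R (\<lambda>k. exp_measure (r k)))"
      by (rule P.product_nn_integral_insert[OF _ _ mk[OF mk[OF g1]]]) (use R I in auto)
    finally show ?thesis by (simp add: prod_exp_def)
  qed
  fix B assume B: "B \<in> sets (distr (prod_exp r I) (PiM I (\<lambda>_. borel)) (burke_map p q s))"
  then have B' [measurable]: "B \<in> sets (PiM I (\<lambda>_. borel))" by simp
  have "emeasure (distr (prod_exp r I) (PiM I (\<lambda>_. borel)) (burke_map p q s)) B = (\<integral>\<^sup>+x. indicator B (burke_map p q s x) \<partial>prod_exp r I)"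
    by (subst nn_integral_indicator[symmetric], simp) (subst nn_integral_distr, auto)
  also have "\<dots> = (\<integral>\<^sup>+x. indicator B x \<partial>prod_exp r I)"
    unfolding ins[OF measurable_compose[OF mb borel_measurable_indicator[OF B']]] ins[OF borel_measurable_indicator[OF B']]
  proof (rule nn_integral_cong)
    fix x assume "x \<in> space (prod_exp r R)"
    then have x: "x \<in> space (PiM R (\<lambda>_. borel))" using sets_eq_imp_space_eq[OF sets_prod_exp[of r R]] by simp
    have T: "burke_map p q s (x(s := w, q := v, p := u)) = x(s := min u v, q := w + max 0 (v - u), p := w + max 0 (u - v))" for u v w
      using I by (auto simp: burke_map_def fun_eq_iff)
    have [measurable]: "(\<lambda>(u, v, w). x(s := w, q := v, p := u)) \<in> borel \<Otimes>\<^sub>M borel \<Otimes>\<^sub>M borel \<rightarrow>\<^sub>M PiM I (\<lambda>_. borel)"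
      unfolding case_prod_unfold R(5)
      by (intro measurable_fun_upd[where J = "insert q (insert s R)"] measurable_fun_upd[where J = "insert s R"] measurable_fun_upd[where J = R])
         (use x in auto)
    have m: "(\<lambda>z. indicator B ((\<lambda>(u, v, w). x(s := w, q := v, p := u)) z) :: ennreal) \<in> borel_measurable (borel \<Otimes>\<^sub>M borel \<Otimes>\<^sub>M borel)"
      by measurable
    show "(\<integral>\<^sup>+w. \<integral>\<^sup>+v. \<integral>\<^sup>+u. indicator B (burke_map p q s (x(s := w, q := v, p := u))) \<partial>exp_measure (r p) \<partial>exp_measure (r q) \<partial>exp_measure (r s))
      = (\<integral>\<^sup>+w. \<integral>\<^sup>+v. \<integral>\<^sup>+u. indicator B (x(s := w, q := v, p := u)) \<partial>exp_measure (r p) \<partial>exp_measure (r q) \<partial>exp_measure (r s))"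
      using burke_nn_integral[OF m, of "r p" "r q"] r by (simp add: T)
  qed
  also have "\<dots> = emeasure (prod_exp r I) B" using B' by simp
  finally show "emeasure (distr (prod_exp r I) (PiM I (\<lambda>_. borel)) (burke_map p q s)) B = emeasure (prod_exp r I) B" .
qed simp

section \<open>Stationary last passage percolation\<close>

lemma AE_exp_measure_nonneg: "AE x in exp_measure r. 0 \<le> x"
  unfolding exp_measure_def by (subst AE_density) (auto simp: exponential_density_def intro!: AE_I2)

lemma AE_prod_exp_nonneg:
  assumes "finite I" "\<And>k. 0 < r k"
  shows "AE w in prod_exp r I. \<forall>k\<in>I. 0 \<le> w k"
proof (rule AE_finite_allI[OF assms(1)])
  fix k assume "k \<in> I"
  then show "AE w in prod_exp r I. 0 \<le> w k"
    unfolding prod_exp_def using assms AE_exp_measure_nonneg by (intro AE_PiM_component prob_space_exp_measure) auto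
qed

text \<open>Exponential tilting: the factor \<open>exp (t * x)\<close> turns the density of rate a
  into a multiple of the density of rate a - t.\<close>

lemma nn_integral_exp_measure_exp:
  assumes "0 < a" "t < a"
  shows "(\<integral>\<^sup>+x. ennreal (exp (t * x)) \<partial>exp_measure a) = ennreal (a / (a - t))"
proof -
  interpret prob_space "exp_measure (a - t)" using assms by (intro prob_space_exp_measure) simp
  have "(\<integral>\<^sup>+x. ennreal (exp (t * x)) \<partial>exp_measure a) = (\<integral>\<^sup>+x. ennreal (exponential_density a x) * ennreal (exp (t * x)) \<partial>lborel)"
    unfolding exp_measure_def by (rule nn_integral_density) auto
  also have "\<dots> = (\<integral>\<^sup>+x. ennreal (a / (a - t)) * ennreal (exponential_density (a - t) x) \<partial>lborel)"
  proof (rule nn_integral_cong)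
    fix x :: real
    have "exponential_density a x * exp (t * x) = (a / (a - t)) * exponential_density (a - t) x"
    proof -
      have "exp (- x * a) * exp (t * x) = exp (- x * (a - t))" by (simp add: exp_add[symmetric] algebra_simps)
      then show ?thesis using assms by (simp add: exponential_density_def mult.assoc)
    qed
    then show "ennreal (exponential_density a x) * ennreal (exp (t * x)) = ennreal (a / (a - t)) * ennreal (exponential_density (a - t) x)"
      using assms by (simp add: ennreal_mult'[symmetric] ennreal_mult''[symmetric])
  qed
  also have "\<dots> = ennreal (a / (a - t)) * emeasure (exp_measure (a - t)) UNIV"
    unfolding exp_measure_def by (subst nn_integral_cmult) (auto simp: emeasure_density)
  also have "\<dots> = ennreal (a / (a - t))" using emeasure_space_1 by simp
  finally show ?thesis .
qed

text \<open>A Chernoff bound that covers both tails, since t may have either sign. The sum runs over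
  a subset J on which all rates agree, while the remaining coordinates are arbitrary.\<close>

lemma prod_exp_sum_tail:
  fixes a s t :: real
  assumes I: "finite I" "J \<subseteq> I" and r: "\<And>k. 0 < r k" "\<And>k. k \<in> J \<Longrightarrow> r k = a"
    and a: "0 < a" and t: "\<bar>t\<bar> \<le> a / 2"
  shows "measure (prod_exp r I) {w \<in> space (prod_exp r I). s \<le> t * ((\<Sum>k\<in>J. w k) - real (card J) / a)}
     \<le> exp (2 * real (card J) * t\<^sup>2 / a\<^sup>2 - s)"
proof -
  have mexp: "(\<lambda>x. if k \<in> J then ennreal (exp (t * x)) else 1) \<in> borel_measurable (exp_measure (r k))" for k
    by measurable
  interpret P: product_prob_space "\<lambda>k. exp_measure (r k)" by (intro product_prob_spaceI prob_space_exp_measure r)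
  interpret prob_space "prod_exp r I" by (intro prob_space_prod_exp r)
  have fJ: "finite J" using I finite_subset by blast
  have [measurable]: "(\<lambda>w. w k) \<in> borel_measurable (PiM I (\<lambda>_. borel))" if "k \<in> J" for k using that I by auto
  define S where "S w = (\<Sum>k\<in>J. w k)" for w :: "'a \<Rightarrow> real"
  have [measurable]: "S \<in> borel_measurable (PiM I (\<lambda>_. borel))" unfolding S_def by measurable
  \<comment> \<open>Coordinates outside J contribute the factor 1, so the product formula applies on
    the whole index set.\<close>
  have "(\<integral>\<^sup>+w. ennreal (exp (t * S w)) \<partial>prod_exp r I) = (\<integral>\<^sup>+w. (\<Prod>k\<in>I. if k \<in> J then ennreal (exp (t * w k)) else 1) \<partial>prod_exp r I)"
  proof (rule nn_integral_cong)
    fix w :: "'a \<Rightarrow> real"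
    have "(\<Prod>k\<in>I. if k \<in> J then ennreal (exp (t * w k)) else 1) = (\<Prod>k\<in>J. ennreal (exp (t * w k)))"
      using I by (subst prod.inter_restrict[symmetric]) (auto simp: Int_absorb1)
    also have "\<dots> = ennreal (exp (t * S w))"
      using fJ by (simp add: S_def sum_distrib_left exp_sum prod_ennreal)
    finally show "ennreal (exp (t * S w)) = (\<Prod>k\<in>I. if k \<in> J then ennreal (exp (t * w k)) else 1)" by (rule sym)
  qed
  also have "\<dots> = (\<Prod>k\<in>I. \<integral>\<^sup>+x. (if k \<in> J then ennreal (exp (t * x)) else 1) \<partial>exp_measure (r k))"
  proof -
    show ?thesis unfolding prod_exp_def using I(1) mexp
      by (intro P.product_nn_integral_prod[where f = "\<lambda>k x. if k \<in> J then ennreal (exp (t * x)) else 1"])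
  qed
  also have "\<dots> = (\<Prod>k\<in>I. if k \<in> J then ennreal (a / (a - t)) else 1)"
  proof (rule prod.cong)
    fix k assume "k \<in> I"
    show "(\<integral>\<^sup>+x. (if k \<in> J then ennreal (exp (t * x)) else 1) \<partial>exp_measure (r k)) = (if k \<in> J then ennreal (a / (a - t)) else 1)"
      using prob_space.emeasure_space_1[OF prob_space_exp_measure[OF r(1)[of k]]] t a
      by (auto simp: r nn_integral_exp_measure_exp abs_le_iff)
  qed simp
  also have "\<dots> = (\<Prod>k\<in>J. ennreal (a / (a - t)))"
    using I by (subst prod.inter_restrict[symmetric]) (auto simp: Int_absorb1)
  also have "\<dots> = ennreal ((a / (a - t)) ^ card J)"
    using a t by (simp add: ennreal_power abs_le_iff)
  finally have mgf: "(\<integral>\<^sup>+w. ennreal (exp (t * S w)) \<partial>prod_exp r I) = ennreal ((a / (a - t)) ^ card J)" .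
  define y where "y = t / a"
  have y: "\<bar>y\<bar> \<le> 1 / 2" using t a by (simp add: y_def abs_divide)
  \<comment> \<open>The hypothesis on t gives \<open>\<bar>y\<bar> \<le> 1 / 2\<close>, the range of
    this logarithm estimate and the origin of the factor 2 in the bound.\<close>
  have "\<bar>ln (1 + (- y)) - (- y)\<bar> \<le> 2 * (- y)\<^sup>2" using y by (intro abs_ln_one_plus_x_minus_x_bound) auto
  then have "- ln (1 - y) \<le> y + 2 * y\<^sup>2" by simp
  then have "exp (- ln (1 - y)) \<le> exp (y + 2 * y\<^sup>2)" by simp
  moreover have "exp (- ln (1 - y)) = a / (a - t)" using y a t by (simp add: exp_minus y_def abs_le_iff field_simps)
  ultimately have q: "a / (a - t) \<le> exp (y + 2 * y\<^sup>2)" by simp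
  let ?c = "t * (real (card J) / a) + s"
  have "emeasure (prod_exp r I) {w \<in> space (prod_exp r I). s \<le> t * (S w - real (card J) / a)}
    \<le> (\<integral>\<^sup>+w. ennreal (exp (- ?c)) * ennreal (exp (t * S w)) \<partial>prod_exp r I)"
  proof -
    have "emeasure (prod_exp r I) {w \<in> space (prod_exp r I). s \<le> t * (S w - real (card J) / a)} =
      (\<integral>\<^sup>+w. indicator {w \<in> space (prod_exp r I). s \<le> t * (S w - real (card J) / a)} w \<partial>prod_exp r I)"
      by (rule nn_integral_indicator[symmetric]) measurable
    also have "\<dots> \<le> (\<integral>\<^sup>+w. ennreal (exp (- ?c)) * ennreal (exp (t * S w)) \<partial>prod_exp r I)"
    proof (rule nn_integral_mono)
      fix w
      have "1 \<le> ennreal (exp (- ?c)) * ennreal (exp (t * S w))" if "s \<le> t * (S w - real (card J) / a)"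
      proof -
        have "1 \<le> exp (- ?c) * exp (t * S w)"
          using that by (simp add: exp_add[symmetric] right_diff_distrib)
        then have "ennreal 1 \<le> ennreal (exp (- ?c) * exp (t * S w))" by (rule ennreal_leI)
        then show ?thesis by (simp only: ennreal_mult exp_ge_zero ennreal_1)
      qed
      then show "indicator {w \<in> space (prod_exp r I). s \<le> t * (S w - real (card J) / a)} w \<le> ennreal (exp (- ?c)) * ennreal (exp (t * S w))"
        by (auto simp: indicator_def)
    qed
    finally show ?thesis .
  qed
  also have "\<dots> = ennreal (exp (- ?c) * (a / (a - t)) ^ card J)"
    using mgf a t by (subst nn_integral_cmult) (auto simp: ennreal_mult abs_le_iff)
  also have "\<dots> \<le> ennreal (exp (2 * real (card J) * t\<^sup>2 / a\<^sup>2 - s))"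
  proof (rule ennreal_leI)
    have "(a / (a - t)) ^ card J \<le> (exp (y + 2 * y\<^sup>2)) ^ card J"
      using q a t by (intro power_mono) (auto simp: abs_le_iff)
    also have "\<dots> = exp (real (card J) * (y + 2 * y\<^sup>2))" by (simp add: exp_of_nat_mult)
    finally have "exp (- ?c) * (a / (a - t)) ^ card J \<le> exp (- ?c) * exp (real (card J) * (y + 2 * y\<^sup>2))" by simp
    also have "\<dots> = exp (2 * real (card J) * t\<^sup>2 / a\<^sup>2 - s)"
      unfolding exp_add[symmetric] y_def using a by (simp add: field_simps power2_eq_square)
    finally show "exp (- ?c) * (a / (a - t)) ^ card J \<le> exp (2 * real (card J) * t\<^sup>2 / a\<^sup>2 - s)" .
  qed
  finally show ?thesis unfolding S_def emeasure_eq_measure by (simp add: ennreal_le_iff)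
qed

section \<open>The model with boundary weights and its row increments\<close>

definition grid :: "nat \<Rightarrow> nat \<Rightarrow> (nat \<times> nat) set" where "grid m n = {..m} \<times> {..n}"

lemma finite_grid [simp]: "finite (grid m n)" by (simp add: grid_def)
lemma grid_iff [simp]: "(i, j) \<in> grid m n \<longleftrightarrow> i \<le> m \<and> j \<le> n" by (simp add: grid_def)

text \<open>Rates on the horizontal axis, the vertical axis and in the bulk; the weight at the origin is ignored by
  \<open>stat_field\<close>.\<close>
definition boundary_rate :: "real \<Rightarrow> nat \<times> nat \<Rightarrow> real" where
  "boundary_rate \<rho> p = (if 0 < fst p \<and> snd p = 0 then 1 - \<rho> else if fst p = 0 \<and> 0 < snd p then \<rho> else 1)"

definition stat_field :: "(nat \<times> nat \<Rightarrow> real) \<Rightarrow> nat \<Rightarrow> nat \<Rightarrow> real" where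
  "stat_field w i j = (if i = 0 \<and> j = 0 then 0 else w (i, j))"

lemma boundary_rate_pos: "0 < \<rho> \<Longrightarrow> \<rho> < 1 \<Longrightarrow> 0 < boundary_rate \<rho> p" by (simp add: boundary_rate_def)

text \<open>The state stores the current horizontal increments at the sites \<open>(i, 0)\<close> and the current vertical increments at
  the sites \<open>(0, j)\<close>; processing the cell \<open>(i, j)\<close> consumes the weight stored there.\<close>
fun burke_row :: "nat \<Rightarrow> nat \<Rightarrow> (nat \<times> nat \<Rightarrow> real) \<Rightarrow> (nat \<times> nat \<Rightarrow> real)" where
  "burke_row j 0 w = w"
| "burke_row j (Suc i) w = burke_map (Suc i, 0) (0, j) (Suc i, j) (burke_row j i w)"

fun burke_rows :: "nat \<Rightarrow> nat \<Rightarrow> (nat \<times> nat \<Rightarrow> real) \<Rightarrow> (nat \<times> nat \<Rightarrow> real)" where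
  "burke_rows m 0 w = w"
| "burke_rows m (Suc j) w = burke_row (Suc j) m (burke_rows m j w)"

text \<open>The invariant of a sweep along a row: slots up to column i hold increments of the new
  row, later slots are untouched, and the slot (0, Suc j) carries the vertical increment at column i
  to the next cell. Rows further up keep their weights.\<close>

lemma burke_row_increments:
  assumes x0: "\<And>i. 0 < i \<Longrightarrow> i \<le> m \<Longrightarrow> x (i, 0) = lpp (stat_field w) i j - lpp (stat_field w) (i - 1) j"
    and x1: "\<And>i. i \<le> m \<Longrightarrow> x (i, Suc j) = w (i, Suc j)"
    and i: "i \<le> m"
  shows "(\<forall>k. 0 < k \<longrightarrow> k \<le> i \<longrightarrow> burke_row (Suc j) i x (k, 0) = lpp (stat_field w) k (Suc j) - lpp (stat_field w) (k - 1) (Suc j))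
    \<and> (\<forall>k. i < k \<longrightarrow> burke_row (Suc j) i x (k, 0) = x (k, 0) \<and> burke_row (Suc j) i x (k, Suc j) = x (k, Suc j))
    \<and> burke_row (Suc j) i x (0, Suc j) = lpp (stat_field w) i (Suc j) - lpp (stat_field w) i j
    \<and> (\<forall>k l. Suc j < l \<longrightarrow> burke_row (Suc j) i x (k, l) = x (k, l))"
  using i
proof (induction i)
  case 0
  have "lpp (stat_field w) 0 (Suc j) - lpp (stat_field w) 0 j = w (0, Suc j)" by (simp add: stat_field_def)
  then show ?case using x1 by simp
next
  case (Suc i)
  let ?y = "burke_row (Suc j) i x"
  have IH: "\<And>k. 0 < k \<Longrightarrow> k \<le> i \<Longrightarrow> ?y (k, 0) = lpp (stat_field w) k (Suc j) - lpp (stat_field w) (k - 1) (Suc j)"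
    "\<And>k. i < k \<Longrightarrow> ?y (k, 0) = x (k, 0) \<and> ?y (k, Suc j) = x (k, Suc j)"
    "?y (0, Suc j) = lpp (stat_field w) i (Suc j) - lpp (stat_field w) i j" "\<And>k l. Suc j < l \<Longrightarrow> ?y (k, l) = x (k, l)"
    using Suc.IH Suc.prems by auto
  have y: "?y (Suc i, 0) = lpp (stat_field w) (Suc i) j - lpp (stat_field w) i j" "?y (Suc i, Suc j) = w (Suc i, Suc j)"
    using IH(2)[of "Suc i"] x0[of "Suc i"] x1[of "Suc i"] Suc.prems by auto
  have L: "lpp (stat_field w) (Suc i) (Suc j) = max (lpp (stat_field w) i (Suc j)) (lpp (stat_field w) (Suc i) j) + w (Suc i, Suc j)"
    by (simp add: stat_field_def)
  have n0: "burke_row (Suc j) (Suc i) x (Suc i, 0) = lpp (stat_field w) (Suc i) (Suc j) - lpp (stat_field w) i (Suc j)"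
    unfolding L by (simp add: burke_map_def y IH(3) max_def)
  have n1: "burke_row (Suc j) (Suc i) x (0, Suc j) = lpp (stat_field w) (Suc i) (Suc j) - lpp (stat_field w) (Suc i) j"
    unfolding L by (simp add: burke_map_def y IH(3) max_def)
  have "burke_row (Suc j) (Suc i) x (k, 0) = lpp (stat_field w) k (Suc j) - lpp (stat_field w) (k - 1) (Suc j)" if "0 < k" "k \<le> Suc i" for k
    using that IH(1)[of k] n0 by (cases "k = Suc i") (auto simp: burke_map_def)
  then show ?case using n1 IH(2,4) by (auto simp: burke_map_def)
qed

lemma burke_rows_increments:
  "(\<forall>i. 0 < i \<longrightarrow> i \<le> m \<longrightarrow> burke_rows m j w (i, 0) = lpp (stat_field w) i j - lpp (stat_field w) (i - 1) j)
   \<and> (\<forall>i l. j < l \<longrightarrow> burke_rows m j w (i, l) = w (i, l))"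
proof (induction j)
  case 0
  have "lpp (stat_field w) i 0 - lpp (stat_field w) (i - 1) 0 = w (i, 0)" if "0 < i" for i
    using that by (cases i) (auto simp: stat_field_def)
  then show ?case by simp
next
  case (Suc j)
  then show ?case using burke_row_increments[of m "burke_rows m j w" w j m] by auto
qed

text \<open>Every cell combines a horizontal slot of rate 1 - \<rho>, a vertical slot of rate \<rho>
  and a bulk weight of rate 1. These are the rates that the single update preserves.\<close>

lemma distr_burke_row:
  assumes \<rho>: "0 < \<rho>" "\<rho> < 1" and j: "j \<le> n" "0 < j" and i: "i \<le> m"
  shows "burke_row j i \<in> PiM (grid m n) (\<lambda>_. borel) \<rightarrow>\<^sub>M PiM (grid m n) (\<lambda>_. borel) \<and>
    distr (prod_exp (boundary_rate \<rho>) (grid m n)) (PiM (grid m n) (\<lambda>_. borel)) (burke_row j i) = prod_exp (boundary_rate \<rho>) (grid m n)"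
  using i
proof (induction i)
  case 0
  have "burke_row j 0 = (\<lambda>w. w)" by auto
  then show ?case using distr_id2[OF sets_prod_exp[of "boundary_rate \<rho>" "grid m n", symmetric]] by simp
next
  case (Suc i)
  let ?P = "prod_exp (boundary_rate \<rho>) (grid m n)" and ?B = "PiM (grid m n) (\<lambda>_. borel :: real measure)" and ?b = "burke_map (Suc i, 0) (0, j) (Suc i, j)"
  have IH: "burke_row j i \<in> ?B \<rightarrow>\<^sub>M ?B" "distr ?P ?B (burke_row j i) = ?P" using Suc by auto
  have b: "?b \<in> ?B \<rightarrow>\<^sub>M ?B" using Suc.prems j by (intro measurable_burke_map) auto
  have eq: "burke_row j (Suc i) = ?b \<circ> burke_row j i" by auto
  have "distr ?P ?B (?b \<circ> burke_row j i) = distr (distr ?P ?B (burke_row j i)) ?B ?b"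
    using IH b by (intro distr_distr[symmetric]) auto
  also have "\<dots> = ?P" unfolding IH(2)
    using Suc.prems j \<rho> by (intro distr_burke_map boundary_rate_pos) (auto simp: boundary_rate_def)
  finally show ?case unfolding eq using measurable_comp[OF IH(1) b] by blast
qed

lemma distr_burke_rows:
  assumes \<rho>: "0 < \<rho>" "\<rho> < 1" and j: "j \<le> n"
  shows "burke_rows m j \<in> PiM (grid m n) (\<lambda>_. borel) \<rightarrow>\<^sub>M PiM (grid m n) (\<lambda>_. borel) \<and>
    distr (prod_exp (boundary_rate \<rho>) (grid m n)) (PiM (grid m n) (\<lambda>_. borel)) (burke_rows m j) = prod_exp (boundary_rate \<rho>) (grid m n)"
  using j
proof (induction j)
  case 0
  have "burke_rows m 0 = (\<lambda>w. w)" by auto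
  then show ?case using distr_id2[OF sets_prod_exp[of "boundary_rate \<rho>" "grid m n", symmetric]] by simp
next
  case (Suc j)
  let ?P = "prod_exp (boundary_rate \<rho>) (grid m n)" and ?B = "PiM (grid m n) (\<lambda>_. borel :: real measure)"
  have IH: "burke_rows m j \<in> ?B \<rightarrow>\<^sub>M ?B" "distr ?P ?B (burke_rows m j) = ?P" using Suc by auto
  have b: "burke_row (Suc j) m \<in> ?B \<rightarrow>\<^sub>M ?B" "distr ?P ?B (burke_row (Suc j) m) = ?P"
    using distr_burke_row[OF \<rho>, of "Suc j" n m m] Suc.prems by auto
  have eq: "burke_rows m (Suc j) = burke_row (Suc j) m \<circ> burke_rows m j" by auto
  have "distr ?P ?B (burke_row (Suc j) m \<circ> burke_rows m j) = distr (distr ?P ?B (burke_rows m j)) ?B (burke_row (Suc j) m)"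
    using IH b by (intro distr_distr[symmetric]) auto
  also have "\<dots> = ?P" unfolding IH(2) by (rule b(2))
  finally show ?case unfolding eq using measurable_comp[OF IH(1) b(1)] by blast
qed

lemma measurable_lpp [measurable (raw)]:
  "(\<And>i j. i \<le> m \<Longrightarrow> j \<le> n \<Longrightarrow> (\<lambda>x. f x i j) \<in> borel_measurable M) \<Longrightarrow> (\<lambda>x. lpp (f x) m n) \<in> borel_measurable M"
proof (induction "undefined :: nat \<Rightarrow> nat \<Rightarrow> real" m n rule: lpp.induct)
  case (4 m n)
  have "(\<lambda>x. lpp (f x) m (Suc n)) \<in> borel_measurable M" "(\<lambda>x. lpp (f x) (Suc m) n) \<in> borel_measurable M" "(\<lambda>x. f x (Suc m) (Suc n)) \<in> borel_measurable M"
    using 4 by auto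
  then show ?case by simp
qed simp_all

lemma measurable_stat_field: "i \<le> m \<Longrightarrow> j \<le> n \<Longrightarrow> (\<lambda>w. stat_field w i j) \<in> borel_measurable (PiM (grid m n) (\<lambda>_. borel))"
  unfolding stat_field_def by (cases "i = 0 \<and> j = 0") auto

lemma lpp_stat_field_axis: "lpp (stat_field w) 0 n = (\<Sum>k\<in>{0} \<times> {1..n}. w k)" "lpp (stat_field w) m 0 = (\<Sum>k\<in>{1..m} \<times> {0}. w k)"
proof -
  have "lpp (stat_field w) 0 n = (\<Sum>j=1..n. w (0, j))" by (induction n) (auto simp: stat_field_def)
  also have "\<dots> = (\<Sum>k\<in>{0} \<times> {1..n}. w k)" by (simp add: sum.cartesian_product' )
  finally show "lpp (stat_field w) 0 n = (\<Sum>k\<in>{0} \<times> {1..n}. w k)" .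
  have "lpp (stat_field w) m 0 = (\<Sum>j=1..m. w (j, 0))" by (induction m) (auto simp: stat_field_def)
  also have "\<dots> = (\<Sum>k\<in>{1..m} \<times> {0}. w k)" by (simp add: sum.cartesian_product')
  finally show "lpp (stat_field w) m 0 = (\<Sum>k\<in>{1..m} \<times> {0}. w k)" .
qed

text \<open>The value at (m, n) is the height gained on the vertical axis plus the horizontal
  increments of row n, which have the law of the horizontal axis weights. The two sums are
  dependent; a union bound splits \<open>2 * s\<close> evenly between them.\<close>

lemma stationary_tail:
  fixes \<rho> s t :: real
  assumes \<rho>: "0 < \<rho>" "\<rho> < 1" and t: "\<bar>t\<bar> \<le> \<rho> / 2" "\<bar>t\<bar> \<le> (1 - \<rho>) / 2"
  shows "measure (prod_exp (boundary_rate \<rho>) (grid m n)) {w \<in> space (prod_exp (boundary_rate \<rho>) (grid m n)).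
      2 * s \<le> t * (lpp (stat_field w) m n - (real m / (1 - \<rho>) + real n / \<rho>))}
    \<le> exp (2 * real m * t\<^sup>2 / (1 - \<rho>)\<^sup>2 - s) + exp (2 * real n * t\<^sup>2 / \<rho>\<^sup>2 - s)"
proof -
  let ?P = "prod_exp (boundary_rate \<rho>) (grid m n)" and ?B = "PiM (grid m n) (\<lambda>_. borel :: real measure)"
  interpret prob_space ?P by (intro prob_space_prod_exp boundary_rate_pos \<rho>)
  note burke_rows = distr_burke_rows[OF \<rho> order_refl, of m n]
  let ?U = "{1..m} \<times> {0::nat}" and ?V = "{0::nat} \<times> {1..n}"
  have mc: "(\<lambda>w. w k) \<in> borel_measurable ?B" if "k \<in> grid m n" for k using that by auto
  have mU: "(\<lambda>w. \<Sum>k\<in>?U. w k) \<in> borel_measurable ?B" by (intro borel_measurable_sum mc) (auto simp: grid_def)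
  have mV: "(\<lambda>w. \<Sum>k\<in>?V. w k) \<in> borel_measurable ?B" by (intro borel_measurable_sum mc) (auto simp: grid_def)
  note [measurable] = mU mV
  \<comment> \<open>Row increments telescope from column 0, where the value is the sum over the
    vertical axis.\<close>
  have dec: "lpp (stat_field w) m n = (\<Sum>k\<in>?U. burke_rows m n w k) + (\<Sum>k\<in>?V. w k)" for w
  proof -
    have "(\<Sum>k\<in>?U. burke_rows m n w k) = (\<Sum>i=1..m. burke_rows m n w (i, 0))" by (simp add: sum.cartesian_product')
    also have "\<dots> = (\<Sum>i=1..m. lpp (stat_field w) i n - lpp (stat_field w) (i - 1) n)"
      using burke_rows_increments[of m n w] by (intro sum.cong) auto
    also have "\<dots> = lpp (stat_field w) m n - lpp (stat_field w) 0 n" by (induction m) auto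
    finally show ?thesis by (simp add: lpp_stat_field_axis)
  qed
  let ?EU = "{w \<in> space ?P. s \<le> t * ((\<Sum>k\<in>?U. w k) - real (card ?U) / (1 - \<rho>))}"
  let ?EV = "{w \<in> space ?P. s \<le> t * ((\<Sum>k\<in>?V. w k) - real (card ?V) / \<rho>)}"
  let ?EA = "{w \<in> space ?P. s \<le> t * ((\<Sum>k\<in>?U. burke_rows m n w k) - real (card ?U) / (1 - \<rho>))}"
  have [measurable]: "(\<lambda>w. \<Sum>k\<in>?U. burke_rows m n w k) \<in> borel_measurable ?P"
    using measurable_compose[OF burke_rows[THEN conjunct1] mU] by (simp cong: measurable_cong_sets)
  have EU: "measure ?P ?EU \<le> exp (2 * real (card ?U) * t\<^sup>2 / (1 - \<rho>)\<^sup>2 - s)"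
    using \<rho> t by (intro prod_exp_sum_tail boundary_rate_pos) (auto simp: grid_def boundary_rate_def)
  have EV: "measure ?P ?EV \<le> exp (2 * real (card ?V) * t\<^sup>2 / \<rho>\<^sup>2 - s)"
    using \<rho> t by (intro prod_exp_sum_tail boundary_rate_pos) (auto simp: grid_def boundary_rate_def)
  \<comment> \<open>The sweep preserves the product law, so the row increments inherit the tail
    bound of the axis weights.\<close>
  have "measure ?P ?EU = measure (distr ?P ?B (burke_rows m n)) ?EU" using burke_rows by simp
  also have "\<dots> = measure ?P (burke_rows m n -` ?EU \<inter> space ?P)"
  proof (rule measure_distr)
    show "burke_rows m n \<in> ?P \<rightarrow>\<^sub>M ?B" using burke_rows by (simp cong: measurable_cong_sets)
    have "?EU \<in> sets ?P" by measurable
    then show "?EU \<in> sets ?B" by (simp only: sets_prod_exp)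
  qed
  also have "burke_rows m n -` ?EU \<inter> space ?P = ?EA"
  proof -
    have "burke_rows m n w \<in> space ?P" if "w \<in> space ?P" for w
      using measurable_space[OF burke_rows[THEN conjunct1]] that sets_eq_imp_space_eq[OF sets_prod_exp[of "boundary_rate \<rho>" "grid m n"]] by simp
    then show ?thesis by auto
  qed
  finally have EA: "measure ?P ?EA \<le> exp (2 * real (card ?U) * t\<^sup>2 / (1 - \<rho>)\<^sup>2 - s)" using EU by simp
  have "measure ?P {w \<in> space ?P. 2 * s \<le> t * (lpp (stat_field w) m n - (real m / (1 - \<rho>) + real n / \<rho>))} \<le> measure ?P (?EA \<union> ?EV)"
  proof (rule finite_measure_mono)
    show "{w \<in> space ?P. 2 * s \<le> t * (lpp (stat_field w) m n - (real m / (1 - \<rho>) + real n / \<rho>))} \<subseteq> ?EA \<union> ?EV"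
    proof clarify
      fix w assume w: "w \<in> space ?P" "2 * s \<le> t * (lpp (stat_field w) m n - (real m / (1 - \<rho>) + real n / \<rho>))"
        and nv: "\<not> s \<le> t * ((\<Sum>k\<in>?V. w k) - real (card ?V) / \<rho>)"
      have "t * (lpp (stat_field w) m n - (real m / (1 - \<rho>) + real n / \<rho>)) =
        t * ((\<Sum>k\<in>?U. burke_rows m n w k) - real (card ?U) / (1 - \<rho>)) + t * ((\<Sum>k\<in>?V. w k) - real (card ?V) / \<rho>)"
        unfolding dec by (simp add: algebra_simps)
      then show "s \<le> t * ((\<Sum>k\<in>?U. burke_rows m n w k) - real (card ?U) / (1 - \<rho>))" using w nv by linarith
    qed
  qed measurable
  also have "\<dots> \<le> measure ?P ?EA + measure ?P ?EV" by (rule measure_Un_le) measurable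
  finally show ?thesis using EA EV by simp
qed

text \<open>Reading off distinct coordinates of rate 1 yields independent weights of rate 1. It
  extracts bulk rectangles from the boundary model and sub-rectangles from the environment.\<close>

lemma distr_prod_exp_reindex:
  assumes "inj_on h J" "h ` J \<subseteq> I" "\<And>k. 0 < r k" "\<And>k. k \<in> J \<Longrightarrow> r (h k) = 1"
  shows "distr (prod_exp r I) (PiM J (\<lambda>_. borel)) (\<lambda>w. \<lambda>k\<in>J. w (h k)) = prod_exp (\<lambda>_. 1) J"
proof -
  have "distr (PiM I (\<lambda>k. exp_measure (r k))) (PiM J (\<lambda>k. exp_measure (r (h k)))) (\<lambda>w. \<lambda>k\<in>J. w (h k)) = PiM J (\<lambda>k. exp_measure (r (h k)))"
    using assms by (intro distr_PiM_reindex prob_space_exp_measure) auto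
  moreover have "PiM J (\<lambda>k. exp_measure (r (h k))) = prod_exp (\<lambda>_. 1) J"
    unfolding prod_exp_def using assms by (intro PiM_cong) auto
  ultimately show ?thesis by (metis prod_exp_def distr_cong sets_prod_exp)
qed

section \<open>Upper tail\<close>

definition shape :: "real \<Rightarrow> real \<Rightarrow> real" where
  "shape u v = (sqrt u + sqrt v)\<^sup>2"

lemma shape_commute: "shape u v = shape v u" by (simp add: shape_def add.commute)

lemma shape_expand: "0 \<le> u \<Longrightarrow> 0 \<le> v \<Longrightarrow> shape u v = u + v + 2 * sqrt (u * v)"
  by (simp add: shape_def power2_sum real_sqrt_mult)

text \<open>The mean is minimised at \<rho> = sqrt v / (sqrt u + sqrt v), with minimum
  \<open>shape u v\<close>. If this value lies within \<epsilon> of 0 or 1, the clamped rate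
  \<epsilon> or 1 - \<epsilon> costs at most 4 \<epsilon> B on the short side and 2 \<epsilon> B on
  the long side. A lower bound on the rates keeps the Chernoff parameter t uniform over all
  rectangles.\<close>

lemma exists_rate:
  assumes uv: "0 < u" "0 < v" "u \<le> B" "v \<le> B" and \<epsilon>: "0 < \<epsilon>" "\<epsilon> \<le> 1 / 2"
  shows "\<exists>\<rho>. \<epsilon> \<le> \<rho> \<and> \<epsilon> \<le> 1 - \<rho> \<and> u / (1 - \<rho>) + v / \<rho> \<le> shape u v + 6 * \<epsilon> * B"
proof -
  have aux: "v' / \<epsilon> + u' / (1 - \<epsilon>) \<le> shape u' v' + 6 * \<epsilon> * B"
    if "0 < u'" "0 < v'" "u' \<le> B" "v' \<le> B" "sqrt v' \<le> \<epsilon> * (sqrt u' + sqrt v')" for u' v'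
  proof -
    have "v' / \<epsilon> \<le> 4 * \<epsilon> * B"
    proof -
      have "v' = sqrt v' * sqrt v'" using that by simp
      also have "\<dots> \<le> (\<epsilon> * (sqrt u' + sqrt v')) * (\<epsilon> * (sqrt u' + sqrt v'))"
        using that \<epsilon> by (intro mult_mono) auto
      also have "\<dots> = \<epsilon> * \<epsilon> * shape u' v'" by (simp add: shape_def power2_eq_square)
      also have "shape u' v' \<le> 4 * B"
      proof -
        have "sqrt u' \<le> sqrt B" "sqrt v' \<le> sqrt B" using that by auto
        moreover have "0 \<le> sqrt u'" "0 \<le> sqrt v'" using that by auto
        ultimately have "(sqrt u' + sqrt v')\<^sup>2 \<le> (2 * sqrt B)\<^sup>2" by (intro power_mono) linarith+
        then show ?thesis using that by (simp add: shape_def power_mult_distrib)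
      qed
      finally have "v' \<le> \<epsilon> * \<epsilon> * (4 * B)" using \<epsilon> by (simp add: mult_left_mono)
      then show ?thesis using \<epsilon> by (simp add: pos_divide_le_eq mult_ac)
    qed
    moreover have "u' / (1 - \<epsilon>) \<le> u' + 2 * \<epsilon> * B"
    proof -
      have "1 / (1 - \<epsilon>) \<le> 1 + 2 * \<epsilon>"
      proof -
        have "\<epsilon> * \<epsilon> \<le> \<epsilon> * (1/2)" using \<epsilon> by (intro mult_left_mono) auto
        then show ?thesis using \<epsilon> by (simp add: divide_le_eq algebra_simps)
      qed
      then have "u' * (1 / (1 - \<epsilon>)) \<le> u' * (1 + 2 * \<epsilon>)" using that by (intro mult_left_mono) auto
      also have "\<dots> \<le> u' + 2 * \<epsilon> * B" using that \<epsilon> by (simp add: algebra_simps)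
      finally show ?thesis by simp
    qed
    moreover have "u' \<le> shape u' v'" using that by (simp add: shape_expand)
    ultimately show ?thesis by linarith
  qed
  define s t where "s = sqrt u" and "t = sqrt v"
  have st: "0 < s" "0 < t" "u = s * s" "v = t * t" using uv by (auto simp: s_def t_def)
  have "t \<le> \<epsilon> * (s + t) \<or> s \<le> \<epsilon> * (t + s) \<or> \<epsilon> \<le> t / (s + t) \<and> \<epsilon> \<le> s / (s + t)"
    using st by (simp add: pos_le_divide_eq add.commute) linarith
  then consider "t \<le> \<epsilon> * (s + t)" | "s \<le> \<epsilon> * (t + s)" | "\<epsilon> \<le> t / (s + t)" "\<epsilon> \<le> s / (s + t)" by blast
  then show ?thesis
  proof cases
    case 1
    then show ?thesis using aux[of u v] uv \<epsilon> by (intro exI[of _ \<epsilon>]) (auto simp: s_def t_def)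
  next
    case 2
    then show ?thesis using aux[of v u] uv \<epsilon> by (intro exI[of _ "1 - \<epsilon>"]) (auto simp: s_def t_def shape_commute)
  next
    case 3
    have "1 - t / (s + t) = s / (s + t)" using st by (simp add: field_simps)
    moreover have "u / (s / (s + t)) + v / (t / (s + t)) = shape u v"
      using st by (simp add: shape_def s_def[symmetric] t_def[symmetric]) (simp add: st power2_eq_square field_simps)
    moreover have "0 \<le> 6 * \<epsilon> * B" using uv \<epsilon> by simp
    ultimately show ?thesis using 3 by (intro exI[of _ "t / (s + t)"]) auto
  qed
qed

text \<open>The quadratic term of the Chernoff exponent is at most half of the margin t \<eta> N / 4
  for which it is used; the origin of 16 in the choice of t.\<close>

lemma chernoff_exponent:
  fixes N :: real
  assumes "0 \<le> u" "u \<le> R * N" "0 < R" "0 \<le> N" "0 < \<epsilon>" "\<epsilon> \<le> a" "0 \<le> t" "t \<le> \<eta> * \<epsilon>\<^sup>2 / (16 * R)"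
  shows "2 * u * t\<^sup>2 / a\<^sup>2 \<le> t * \<eta> * N / 8"
proof -
  have "2 * u * t\<^sup>2 / a\<^sup>2 \<le> 2 * u * t\<^sup>2 / \<epsilon>\<^sup>2"
    using assms by (intro divide_left_mono power_mono mult_nonneg_nonneg mult_pos_pos) auto
  also have "\<dots> \<le> 2 * (R * N) * t\<^sup>2 / \<epsilon>\<^sup>2"
    using assms by (intro divide_right_mono mult_right_mono mult_left_mono) auto
  also have "\<dots> = (2 * R * N * t / \<epsilon>\<^sup>2) * t" by (simp add: power2_eq_square)
  also have "\<dots> \<le> (2 * R * N * t / \<epsilon>\<^sup>2) * (\<eta> * \<epsilon>\<^sup>2 / (16 * R))"
    using assms by (intro mult_left_mono) auto
  also have "\<dots> = t * \<eta> * N / 8" using assms by (simp add: field_simps)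
  finally show ?thesis .
qed

section \<open>Transport of passage probabilities between models\<close>

definition passage_prob :: "nat \<Rightarrow> nat \<Rightarrow> real set \<Rightarrow> real" where
  "passage_prob m n A = measure (prod_exp (\<lambda>_. 1) (grid m n)) {w \<in> space (prod_exp (\<lambda>_. 1) (grid m n)). lpp (curry w) m n \<in> A}"

lemma prob_lpp_eq:
  assumes Y: "Y \<in> M \<rightarrow>\<^sub>M PiM (grid m n) (\<lambda>_. borel)" "distr M (PiM (grid m n) (\<lambda>_. borel)) Y = prod_exp (\<lambda>_. 1) (grid m n)"
    and A: "A \<in> sets borel"
  shows "measure M {\<omega> \<in> space M. lpp (curry (Y \<omega>)) m n \<in> A} =
    passage_prob m n A"
proof -
  let ?B = "PiM (grid m n) (\<lambda>_. borel :: real measure)"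
  have "(\<lambda>w. lpp (curry w) m n) \<in> borel_measurable ?B"
    by (intro measurable_lpp) auto
  then have s: "{w \<in> space ?B. lpp (curry w) m n \<in> A} \<in> sets ?B" using A by measurable
  have sp: "space (prod_exp (\<lambda>_. 1) (grid m n)) = space ?B" by (rule sets_eq_imp_space_eq) simp
  have "measure (prod_exp (\<lambda>_. 1) (grid m n)) {w \<in> space ?B. lpp (curry w) m n \<in> A} = measure M (Y -` {w \<in> space ?B. lpp (curry w) m n \<in> A} \<inter> space M)"
    unfolding Y(2)[symmetric] by (rule measure_distr[OF Y(1) s])
  also have "Y -` {w \<in> space ?B. lpp (curry w) m n \<in> A} \<inter> space M = {\<omega> \<in> space M. lpp (curry (Y \<omega>)) m n \<in> A}"
    using measurable_space[OF Y(1)] by auto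
  finally show ?thesis unfolding passage_prob_def sp by (rule sym)
qed

text \<open>A rectangle avoiding both axes sees only weights of rate 1, so the boundary model
  contains a copy of the bulk model.\<close>

lemma prob_lpp_stationary:
  assumes \<rho>: "0 < \<rho>" "\<rho> < 1" and ab: "0 < a" "0 < b" "a + m \<le> m'" "b + n \<le> n'" and A: "A \<in> sets borel"
  shows "measure (prod_exp (boundary_rate \<rho>) (grid m' n')) {w \<in> space (prod_exp (boundary_rate \<rho>) (grid m' n')). lpp (shift (stat_field w) a b) m n \<in> A} =
    passage_prob m n A"
proof -
  define h where "h k = (a + fst k, b + snd k)" for k
  define Y where "Y w = (\<lambda>k\<in>grid m n. w (h k))" for w :: "nat \<times> nat \<Rightarrow> real"
  have h: "inj_on h (grid m n)" "h ` grid m n \<subseteq> grid m' n'" using ab by (auto simp: h_def inj_on_def)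
  have "distr (prod_exp (boundary_rate \<rho>) (grid m' n')) (PiM (grid m n) (\<lambda>_. borel)) Y = prod_exp (\<lambda>_. 1) (grid m n)"
    unfolding Y_def using \<rho> ab by (intro distr_prod_exp_reindex h boundary_rate_pos) (auto simp: boundary_rate_def h_def)
  moreover have "Y \<in> prod_exp (boundary_rate \<rho>) (grid m' n') \<rightarrow>\<^sub>M PiM (grid m n) (\<lambda>_. borel)"
  proof -
    have "Y \<in> PiM (grid m' n') (\<lambda>_. borel) \<rightarrow>\<^sub>M PiM (grid m n) (\<lambda>_. borel)"
      unfolding Y_def using h(2) by (intro measurable_restrict measurable_component_singleton) auto
    then show ?thesis by (simp cong: measurable_cong_sets)
  qed
  moreover have "lpp (curry (Y w)) m n = lpp (shift (stat_field w) a b) m n" for w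
    using ab by (intro lpp_cong) (auto simp: Y_def shift_def stat_field_def h_def)
  ultimately show ?thesis using prob_lpp_eq[of Y "prod_exp (boundary_rate \<rho>) (grid m' n')" m n A] A by simp
qed

text \<open>Of the margin \<eta> N one half pays for the clamped rate, the other half is the
  deviation of the stationary value. The constants c and C must not depend on the rectangle, hence
  the uniform choice of \<epsilon> and t.\<close>

lemma lpp_upper_tail:
  fixes \<eta> R :: real
  assumes \<eta>: "0 < \<eta>" and R: "0 < R"
  shows "\<exists>c::real. 0 < c \<and> (\<exists>C::real. 0 < C \<and> (\<forall>N m n :: nat. real (Suc m) \<le> R * real N \<longrightarrow> real (Suc n) \<le> R * real N \<longrightarrow>
    passage_prob m n {shape (Suc m) (Suc n) + \<eta> * real N ..} \<le> C * exp (- c * real N)))"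
proof -
  define \<epsilon> where "\<epsilon> = min (1/2) (\<eta> / (12 * R))"
  have \<epsilon>: "0 < \<epsilon>" "\<epsilon> \<le> 1/2" "6 * \<epsilon> * R \<le> \<eta> / 2"
  proof -
    show "0 < \<epsilon>" "\<epsilon> \<le> 1/2" using \<eta> R by (auto simp: \<epsilon>_def)
    have "\<epsilon> \<le> \<eta> / (12 * R)" by (simp add: \<epsilon>_def)
    then show "6 * \<epsilon> * R \<le> \<eta> / 2" using R by (simp add: pos_le_divide_eq mult_ac)
  qed
  define t where "t = min (\<epsilon> / 2) (\<eta> * \<epsilon>\<^sup>2 / (16 * R))"
  have t: "0 < t" "t \<le> \<epsilon> / 2" "t \<le> \<eta> * \<epsilon>\<^sup>2 / (16 * R)" using \<epsilon> \<eta> R by (auto simp: t_def)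
  have c: "0 < t * \<eta> / 8" using t \<eta> by simp
  show ?thesis
  proof (rule exI[of _ "t * \<eta> / 8"], rule conjI[OF c], rule exI[of _ 2], rule conjI[OF zero_less_numeral], intro allI impI)
    fix N m n :: nat assume mn: "real (Suc m) \<le> R * N" "real (Suc n) \<le> R * N"
    obtain \<rho> where \<rho>: "\<epsilon> \<le> \<rho>" "\<epsilon> \<le> 1 - \<rho>" "real (Suc m) / (1 - \<rho>) + real (Suc n) / \<rho> \<le> shape (Suc m) (Suc n) + 6 * \<epsilon> * (R * N)"
      using exists_rate[of "real (Suc m)" "real (Suc n)" "R * N" \<epsilon>] mn \<epsilon> by auto
    have \<rho>01: "0 < \<rho>" "\<rho> < 1" using \<rho> \<epsilon> by auto
    let ?P = "prod_exp (boundary_rate \<rho>) (grid (Suc m) (Suc n))"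
    interpret prob_space ?P by (intro prob_space_prod_exp boundary_rate_pos \<rho>01)
    let ?s = "t * \<eta> * N / 4"
    let ?E = "{w \<in> space ?P. 2 * ?s \<le> t * (lpp (stat_field w) (Suc m) (Suc n) - (real (Suc m) / (1 - \<rho>) + real (Suc n) / \<rho>))}"
    have mL: "(\<lambda>w. lpp (stat_field w) (Suc m) (Suc n)) \<in> borel_measurable (PiM (grid (Suc m) (Suc n)) (\<lambda>_. borel))"
      by (intro measurable_lpp measurable_stat_field)
    \<comment> \<open>The bulk rectangle is placed with its corner at (1, 1) in a boundary model of
      size (Suc m, Suc n). The mean there involves \<open>Suc m\<close> and \<open>Suc n\<close>, in
      agreement with the shape.\<close>
    have "passage_prob m n {shape (Suc m) (Suc n) + \<eta> * N ..}
      = measure ?P {w \<in> space ?P. lpp (shift (stat_field w) 1 1) m n \<in> {shape (Suc m) (Suc n) + \<eta> * N ..}}"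
      by (rule prob_lpp_stationary[symmetric]) (use \<rho>01 in auto)
    also have "\<dots> \<le> measure ?P ?E"
    proof (rule finite_measure_mono_AE)
      show "?E \<in> sets ?P" using mL by measurable
      show "AE w in ?P. w \<in> {w \<in> space ?P. lpp (shift (stat_field w) 1 1) m n \<in> {shape (Suc m) (Suc n) + \<eta> * N ..}} \<longrightarrow> w \<in> ?E"
        using AE_prod_exp_nonneg[OF finite_grid boundary_rate_pos[OF \<rho>01], of "Suc m" "Suc n"]
      proof eventually_elim
        case (elim w)
        have "lpp (shift (stat_field w) 1 1) m n \<le> lpp (stat_field w) (1 + m) (1 + n)"
          using elim by (intro lpp_shift_le) (auto simp: stat_field_def)
        then have "lpp (shift (stat_field w) 1 1) m n \<le> lpp (stat_field w) (Suc m) (Suc n)" by (simp del: lpp.simps)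
        moreover have "6 * \<epsilon> * (R * N) \<le> \<eta> / 2 * N" using mult_right_mono[OF \<epsilon>(3), of "real N"] by (simp add: mult_ac)
        ultimately have *: "\<eta> * N / 2 \<le> lpp (stat_field w) (Suc m) (Suc n) - (real (Suc m) / (1 - \<rho>) + real (Suc n) / \<rho>)"
          if "shape (Suc m) (Suc n) + \<eta> * N \<le> lpp (shift (stat_field w) 1 1) m n"
          using that \<rho>(3) by linarith
        have "2 * ?s = t * (\<eta> * N / 2)" by simp
        then show ?case using * t(1) by (auto simp del: lpp.simps intro!: mult_left_mono)
      qed
    qed
    also have "\<dots> \<le> exp (2 * real (Suc m) * t\<^sup>2 / (1 - \<rho>)\<^sup>2 - ?s) + exp (2 * real (Suc n) * t\<^sup>2 / \<rho>\<^sup>2 - ?s)"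
      using \<rho>01 \<rho> t by (intro stationary_tail) auto
    also have "\<dots> \<le> exp (- (t * \<eta> / 8) * N) + exp (- (t * \<eta> / 8) * N)"
      using chernoff_exponent[of "real (Suc m)" R N \<epsilon> "1 - \<rho>" t \<eta>] chernoff_exponent[of "real (Suc n)" R N \<epsilon> \<rho> t \<eta>] mn R \<epsilon> \<rho> t
      by (intro add_mono) auto
    finally show "passage_prob m n {shape (Suc m) (Suc n) + \<eta> * N ..}
      \<le> 2 * exp (- (t * \<eta> / 8) * N)" by simp
  qed
qed

text \<open>The factor \<open>1 + sqrt v / sqrt u\<close> is the derivative of \<open>shape\<close>
  in its first argument at (u, v), so the left side follows the tangent while the rest of the shape
  bends away. With s = sqrt u, t = sqrt v, r = sqrt (u - k) the deficit is exactly
  \<open>t * (s - r)\<^sup>2 / s\<close>, and k \<le> 2 s (s - r) makes it quadratic in k.\<close>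

lemma exit_deficit:
  assumes "0 < u" "0 \<le> v" "0 \<le> k" "k \<le> u"
  shows "k * (1 + sqrt v / sqrt u) + shape (u - k) v \<le> shape u v - sqrt v * k\<^sup>2 / (4 * sqrt u ^ 3)"
proof -
  define s t r where "s = sqrt u" and "t = sqrt v" and "r = sqrt (u - k)"
  have s: "0 < s" "0 \<le> t" "0 \<le> r" "r \<le> s" "u = s\<^sup>2" "v = t\<^sup>2" "k = s\<^sup>2 - r\<^sup>2"
    using assms by (auto simp: s_def t_def r_def)
  have "shape u v - (k * (1 + t / s) + shape (u - k) v) = t * (s - r)\<^sup>2 / s"
    unfolding shape_def s_def[symmetric] t_def[symmetric] r_def[symmetric] unfolding s(7)
    using s(1) by (simp add: field_simps power2_eq_square)
  moreover have "t * k\<^sup>2 / (4 * s ^ 3) \<le> t * (s - r)\<^sup>2 / s"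
  proof -
    have "k = (s - r) * (s + r)" unfolding s(7) by (simp add: power2_eq_square algebra_simps)
    also have "\<dots> \<le> (s - r) * (2 * s)" using s by (intro mult_left_mono) auto
    finally have "k\<^sup>2 \<le> ((s - r) * (2 * s))\<^sup>2" using assms by (intro power_mono) auto
    then have "t * k\<^sup>2 / (4 * s ^ 3) \<le> t * ((s - r) * (2 * s))\<^sup>2 / (4 * s ^ 3)"
      using s by (intro divide_right_mono mult_left_mono) auto
    also have "\<dots> = t * (s - r)\<^sup>2 / s" using s(1) by (simp add: field_simps power2_eq_square power3_eq_cube)
    finally show ?thesis .
  qed
  ultimately show ?thesis by (simp add: s_def t_def)
qed

text \<open>The deterministic core of the lower tail. L is the stationary value, A the part gained
  on an axis, \<open>Lk\<close> the bulk value after the exit and \<open>Lb\<close> the full bulk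
  value. If each part is at most slightly above its mean, the quadratic deficit forces k below
  \<epsilon>2 N; then A is small, and L - A bounds \<open>Lb\<close> from below.\<close>

lemma exit_close:
  fixes N :: real
  assumes N: "0 < N" and uv: "\<epsilon>1 * N \<le> u" "u \<le> R * N" "\<epsilon>1 * N \<le> v" "0 \<le> k" "k \<le> u" and pos: "0 < \<epsilon>1" "0 < R" "0 < \<epsilon>2" "0 < \<kappa>"
    and h: "shape u v - \<kappa> * N < L" "L \<le> A + Lk" "A < (k + 1) * (1 + sqrt v / sqrt u) + \<kappa> * N"
       "Lk < shape (u - k) v + \<kappa> * N" "Lk \<le> Lb"
    and D: "1 + sqrt v / sqrt u \<le> D" "D \<le> \<kappa> * N"
    and c: "4 * \<kappa> \<le> sqrt \<epsilon>1 * \<epsilon>2\<^sup>2 / (4 * sqrt R ^ 3)" "D * \<epsilon>2 \<le> \<eta> / 2" "3 * \<kappa> \<le> \<eta> / 2"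
  shows "shape u v - \<eta> * N < Lb"
proof -
  have eN: "0 < \<epsilon>1 * N" using N pos by simp
  have u: "0 < u" "0 < v" using eN uv by linarith+
  \<comment> \<open>Four errors of size \<kappa> N: in L, in A, in \<open>Lk\<close>, and the one
    extra axis step in k + 1, which is at most D.\<close>
  have "sqrt v * k\<^sup>2 / (4 * sqrt u ^ 3) < 4 * \<kappa> * N"
  proof -
    have "(k + 1) * (1 + sqrt v / sqrt u) = k * (1 + sqrt v / sqrt u) + (1 + sqrt v / sqrt u)"
      by (simp only: distrib_right mult_1)
    moreover have "k * (1 + sqrt v / sqrt u) + shape (u - k) v \<le> shape u v - sqrt v * k\<^sup>2 / (4 * sqrt u ^ 3)"
      using u uv by (intro exit_deficit) auto
    ultimately show ?thesis using h D by linarith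
  qed
  have k: "k < \<epsilon>2 * N"
  proof (rule ccontr)
    assume "\<not> k < \<epsilon>2 * N"
    then have k2: "\<epsilon>2 * N \<le> k" by simp
    have "4 * \<kappa> * N \<le> sqrt \<epsilon>1 * \<epsilon>2\<^sup>2 / (4 * sqrt R ^ 3) * N" using c(1) N by (intro mult_right_mono) auto
    also have "\<dots> = sqrt (\<epsilon>1 * N) * (\<epsilon>2 * N)\<^sup>2 / (4 * sqrt (R * N) ^ 3)"
    proof -
      have "sqrt N ^ 3 = N * sqrt N" using N by (simp add: power3_eq_cube)
      then show ?thesis using N pos by (simp add: real_sqrt_mult power_mult_distrib field_simps power2_eq_square)
    qed
    also have "\<dots> \<le> sqrt v * k\<^sup>2 / (4 * sqrt u ^ 3)"
      using uv k2 N pos u by (intro frac_le mult_mono power_mono mult_left_mono) auto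
    finally show False using \<open>sqrt v * k\<^sup>2 / (4 * sqrt u ^ 3) < 4 * \<kappa> * N\<close> by simp
  qed
  have D0: "0 < D" using D(1) u by (smt (verit) divide_nonneg_nonneg real_sqrt_ge_zero)
  have "(k + 1) * (1 + sqrt v / sqrt u) \<le> (k + 1) * D" using D uv by (intro mult_left_mono) auto
  also have "\<dots> = k * D + D" by (simp add: algebra_simps)
  also have "k * D \<le> (\<epsilon>2 * N) * D" using k D0 by (intro mult_right_mono) auto
  also have "(\<epsilon>2 * N) * D = (D * \<epsilon>2) * N" by simp
  also have "\<dots> \<le> \<eta> / 2 * N" using c(2) N by (intro mult_right_mono) auto
  finally have "(k + 1) * (1 + sqrt v / sqrt u) \<le> \<eta> / 2 * N + \<kappa> * N" using D by linarith
  moreover have "3 * \<kappa> * N \<le> \<eta> / 2 * N" using c(3) N by (intro mult_right_mono) auto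
  ultimately show ?thesis using h by (simp add: algebra_simps)
qed

section \<open>Lower tail\<close>

text \<open>Absorbs the number of possible exit points, which is linear in N, at the price of half
  the rate.\<close>

lemma linear_times_exp_le:
  fixes c x :: real
  assumes "0 < c"
  shows "x * exp (- c * x) \<le> 2 / c * exp (- (c / 2) * x)"
proof -
  have "c / 2 * x \<le> exp (c / 2 * x)" using exp_ge_add_one_self[of "c / 2 * x"] by linarith
  then have "x \<le> 2 / c * exp (c / 2 * x)" using assms by (simp add: field_simps)
  then have "x * exp (- c * x) \<le> 2 / c * exp (c / 2 * x) * exp (- c * x)" by (intro mult_right_mono) auto
  also have "\<dots> = 2 / c * exp (- (c / 2) * x)" by (simp add: exp_add[symmetric] mult.assoc)
  finally show ?thesis .
qed

lemma chernoff_bound: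
  fixes N :: real
  assumes "0 \<le> u" "u \<le> R * N" "0 < R" "0 \<le> N" "0 < \<epsilon>" "\<epsilon> \<le> a" "0 \<le> t" "t \<le> \<eta> * \<epsilon>\<^sup>2 / (16 * R)"
    and "t * \<eta> * N / 4 \<le> s"
  shows "exp (2 * u * t\<^sup>2 / a\<^sup>2 - s) \<le> exp (- (t * \<eta> / 8) * N)"
proof -
  have "2 * u * t\<^sup>2 / a\<^sup>2 \<le> t * \<eta> * N / 8" using assms by (intro chernoff_exponent)
  then have "2 * u * t\<^sup>2 / a\<^sup>2 - s \<le> - (t * \<eta> * N / 8)" using assms(9) by linarith
  then show ?thesis by simp
qed

lemma lpp_axis_le:
  assumes "\<And>i j. i \<le> m \<Longrightarrow> j \<le> n \<Longrightarrow> 0 \<le> f i j"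
  shows "lpp f m 0 \<le> lpp f m n" "lpp f 0 n \<le> lpp f m n"
proof -
  have "j \<le> n \<Longrightarrow> lpp f m 0 \<le> lpp f m j" for j
  proof (induction j)
    case (Suc j) then show ?case using lpp_step_up[of f m j] assms[of m "Suc j"] by simp
  qed simp
  then show "lpp f m 0 \<le> lpp f m n" by simp
  have "i \<le> m \<Longrightarrow> lpp f 0 n \<le> lpp f i n" for i
  proof (induction i)
    case (Suc i) then show ?case using lpp_step_right[of f i n] assms[of "Suc i" n] by simp
  qed simp
  then show "lpp f 0 n \<le> lpp f m n" by simp
qed

lemma lpp_curry_axis: "lpp (curry w) m 0 = (\<Sum>k\<in>{..m} \<times> {0}. w k)" "lpp (curry w) 0 n = (\<Sum>k\<in>{0} \<times> {..n}. w k)"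
proof -
  have "lpp (curry w) m 0 = (\<Sum>i\<le>m. w (i, 0))" by (induction m) auto
  then show "lpp (curry w) m 0 = (\<Sum>k\<in>{..m} \<times> {0}. w k)" by (simp add: sum.cartesian_product')
  have "lpp (curry w) 0 n = (\<Sum>i\<le>n. w (0, i))" by (induction n) auto
  then show "lpp (curry w) 0 n = (\<Sum>k\<in>{0} \<times> {..n}. w k)" by (simp add: sum.cartesian_product')
qed

text \<open>On a thin rectangle the shape exceeds the number of sites of the long side by at most
  \<eta> N / 2, and the path along this side collects a sum of independent weights. The lower tail
  of that sum suffices.\<close>

lemma lpp_lower_tail_thin:
  fixes \<eta> R :: real
  assumes \<eta>: "0 < \<eta>" and R: "0 < R" and \<epsilon>1: "0 < \<epsilon>1" "\<epsilon>1 \<le> \<eta> / 4" "\<epsilon>1 \<le> \<eta>\<^sup>2 / (64 * R)"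
  shows "\<exists>c::real. 0 < c \<and> (\<forall>N m n :: nat. real (Suc m) \<le> R * real N \<longrightarrow> real (Suc n) \<le> R * real N \<longrightarrow>
    (real (Suc m) < \<epsilon>1 * real N \<or> real (Suc n) < \<epsilon>1 * real N) \<longrightarrow>
    passage_prob m n {.. shape (Suc m) (Suc n) - \<eta> * real N} \<le> exp (- c * real N))"
proof -
  define t where "t = min (1 / 2) (\<eta> * 1\<^sup>2 / (16 * R))"
  have t: "0 < t" "t \<le> 1 / 2" "t \<le> \<eta> * 1\<^sup>2 / (16 * R)" using \<eta> R by (auto simp: t_def)
  have thin: "shape u v \<le> u + \<eta> * x / 2" if "0 \<le> u" "0 \<le> v" "u \<le> R * x" "v < \<epsilon>1 * x" "0 \<le> x" for u v x :: real
  proof -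
    \<comment> \<open>The two bounds on \<epsilon>1 serve two terms: this one keeps
      \<open>2 * sqrt (u * v)\<close> below \<eta> x / 4, the other keeps v below \<eta> x /
      4.\<close>
    have "\<epsilon>1 * R \<le> (\<eta> / 8)\<^sup>2" using \<epsilon>1(3) R by (simp add: field_simps power2_eq_square)
    then have sq: "sqrt (\<epsilon>1 * R) \<le> \<eta> / 8" using \<eta> by (intro real_le_lsqrt) auto
    have "u * v \<le> (R * x) * (\<epsilon>1 * x)" using that R by (intro mult_mono) auto
    also have "\<dots> = (\<epsilon>1 * R) * x\<^sup>2" by (simp add: power2_eq_square)
    finally have "sqrt (u * v) \<le> sqrt ((\<epsilon>1 * R) * x\<^sup>2)" by simp
    also have "\<dots> = sqrt (\<epsilon>1 * R) * x" using that by (simp add: real_sqrt_mult)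
    also have "\<dots> \<le> \<eta> / 8 * x" using sq that by (intro mult_right_mono) auto
    finally have "2 * sqrt (u * v) \<le> \<eta> / 4 * x" by simp
    moreover have "v \<le> \<eta> / 4 * x" using that(4) mult_right_mono[OF \<epsilon>1(2) that(5)] by linarith
    ultimately show ?thesis using that by (simp add: shape_expand)
  qed
  \<comment> \<open>J is the long side. The Chernoff bound is used with the negative parameter -
    t.\<close>
  have key: "passage_prob m n {.. shape (Suc m) (Suc n) - \<eta> * real N} \<le> exp (- (t * \<eta> / 8) * real N)"
    if J: "J \<subseteq> grid m n" "real (card J) \<le> R * real N" "shape (Suc m) (Suc n) \<le> real (card J) + \<eta> * real N / 2"
      and le: "\<And>w. (\<forall>k\<in>grid m n. 0 \<le> w k) \<Longrightarrow> (\<Sum>k\<in>J. w k) \<le> lpp (curry w) m n" for J and N m n :: nat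
  proof -
    let ?P = "prod_exp (\<lambda>_. 1) (grid m n)"
    interpret prob_space ?P by (intro prob_space_prod_exp) simp
    let ?s = "t * \<eta> * N / 2"
    let ?E = "{w \<in> space ?P. ?s \<le> - t * ((\<Sum>k\<in>J. w k) - real (card J) / 1)}"
    have mc: "(\<lambda>w. \<Sum>k\<in>J. w k) \<in> borel_measurable (PiM (grid m n) (\<lambda>_. borel :: real measure))"
      using J by (intro borel_measurable_sum measurable_component_singleton) auto
    have "measure ?P {w \<in> space ?P. lpp (curry w) m n \<in> {.. shape (Suc m) (Suc n) - \<eta> * real N}} \<le> measure ?P ?E"
    proof (rule finite_measure_mono_AE)
      show "?E \<in> sets ?P" using mc by measurable
      show "AE w in ?P. w \<in> {w \<in> space ?P. lpp (curry w) m n \<in> {.. shape (Suc m) (Suc n) - \<eta> * real N}} \<longrightarrow> w \<in> ?E"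
        using AE_prod_exp_nonneg[of "grid m n" "\<lambda>_. 1", OF finite_grid zero_less_one]
      proof eventually_elim
        case (elim w)
        have "\<eta> * N / 2 \<le> real (card J) - (\<Sum>k\<in>J. w k)" if "lpp (curry w) m n \<le> shape (Suc m) (Suc n) - \<eta> * real N"
          using that le[of w] J(3) elim by linarith
        then have "t * (\<eta> * N / 2) \<le> t * (real (card J) - (\<Sum>k\<in>J. w k))" if "lpp (curry w) m n \<le> shape (Suc m) (Suc n) - \<eta> * real N"
          using that t by (intro mult_left_mono) auto
        then show ?case by (auto simp: algebra_simps)
      qed
    qed
    also have "\<dots> \<le> exp (2 * real (card J) * (- t)\<^sup>2 / 1\<^sup>2 - ?s)"
      using t J by (intro prod_exp_sum_tail) auto
    also have "\<dots> \<le> exp (- (t * \<eta> / 8) * real N)"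
      unfolding power2_minus using J R t \<eta> by (intro chernoff_bound[where \<epsilon> = 1 and R = R]) auto
    finally show ?thesis unfolding passage_prob_def .
  qed
  have c: "0 < t * \<eta> / 8" using t \<eta> by simp
  show ?thesis
  proof (rule exI[of _ "t * \<eta> / 8"], rule conjI[OF c], intro allI impI)
    fix N m n :: nat
    assume mn: "real (Suc m) \<le> R * real N" "real (Suc n) \<le> R * real N"
      and "real (Suc m) < \<epsilon>1 * real N \<or> real (Suc n) < \<epsilon>1 * real N"
    then consider "real (Suc m) < \<epsilon>1 * real N" | "real (Suc n) < \<epsilon>1 * real N" by blast
    then show "passage_prob m n {.. shape (Suc m) (Suc n) - \<eta> * real N} \<le> exp (- (t * \<eta> / 8) * real N)"
    proof cases
      case 1
      have "shape (Suc m) (Suc n) \<le> real (Suc n) + \<eta> * real N / 2"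
        using thin[of "real (Suc n)" "real (Suc m)" "real N"] 1 mn by (simp add: shape_commute)
      then show ?thesis using mn lpp_axis_le(2)[of m n "curry w" for w]
        by (intro key[of "{0} \<times> {..n}"]) (auto simp: grid_def lpp_curry_axis[symmetric])
    next
      case 2
      have "shape (Suc m) (Suc n) \<le> real (Suc m) + \<eta> * real N / 2"
        using thin[of "real (Suc m)" "real (Suc n)" "real N"] 2 mn by simp
      then show ?thesis using mn lpp_axis_le(1)[of m n "curry w" for w]
        by (intro key[of "{..m} \<times> {0}"]) (auto simp: grid_def lpp_curry_axis[symmetric])
    qed
  qed
qed

text \<open>To be read with a = sqrt u and b = sqrt v: at the critical rate the mean axis weights
  are the partial derivatives of the shape, and the stationary mean is the shape itself.\<close>

lemma optimal_rate:
  fixes a b :: real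
  assumes "0 < a" "0 < b"
  shows "0 < b / (a + b)" "b / (a + b) < 1" "x / (1 - b / (a + b)) = x * (1 + b / a)" "x / (b / (a + b)) = x * (1 + a / b)"
    "a\<^sup>2 / (1 - b / (a + b)) + b\<^sup>2 / (b / (a + b)) = (a + b)\<^sup>2"
proof -
  have 1: "1 - b / (a + b) = a / (a + b)" using assms by (simp add: field_simps)
  show "0 < b / (a + b)" "b / (a + b) < 1" "x / (1 - b / (a + b)) = x * (1 + b / a)" "x / (b / (a + b)) = x * (1 + a / b)"
    "a\<^sup>2 / (1 - b / (a + b)) + b\<^sup>2 / (b / (a + b)) = (a + b)\<^sup>2"
    unfolding 1 using assms by (simp_all add: field_simps power2_eq_square)
qed

lemma measurable_lpp_shift_stat_field:
  "a + m \<le> m' \<Longrightarrow> b + n \<le> n' \<Longrightarrow> (\<lambda>w. lpp (shift (stat_field w) a b) m n) \<in> borel_measurable (PiM (grid m' n') (\<lambda>_. borel))"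
  unfolding shift_def by (intro measurable_lpp measurable_stat_field) auto

text \<open>Both sides exceed \<epsilon>1 N, so the critical rate stays in a compact part of (0, 1)
  and can be used itself. Outside a union of unlikely events, one pair for each exit point,
  \<open>exit_close\<close> applies.\<close>

lemma lpp_lower_tail_thick:
  fixes \<eta> R :: real
  assumes \<eta>: "0 < \<eta>" and R: "0 < R" and \<epsilon>1: "0 < \<epsilon>1"
  shows "\<exists>c::real. 0 < c \<and> (\<exists>C::real. 0 < C \<and> (\<forall>N m n :: nat. real (Suc m) \<le> R * real N \<longrightarrow> real (Suc n) \<le> R * real N \<longrightarrow>
    \<epsilon>1 * real N \<le> real (Suc m) \<longrightarrow> \<epsilon>1 * real N \<le> real (Suc n) \<longrightarrow>
    passage_prob m n {.. shape (Suc m) (Suc n) - \<eta> * real N} \<le> C * exp (- c * real N)))"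
proof -
  \<comment> \<open>Bounds both partial derivatives of the shape, hence also the reciprocals of
    \<rho> and 1 - \<rho>, on all thick rectangles.\<close>
  define D where "D = 1 + sqrt (R / \<epsilon>1)"
  have D: "1 \<le> D" using R \<epsilon>1 by (simp add: D_def)
  define \<epsilon>2 where "\<epsilon>2 = \<eta> / (2 * D)"
  have \<epsilon>2: "0 < \<epsilon>2" "D * \<epsilon>2 \<le> \<eta> / 2" using D \<eta> by (auto simp: \<epsilon>2_def)
  \<comment> \<open>Small enough that an exit beyond \<epsilon>2 N has a deficit of at least 4
    \<kappa> N, and that three errors \<kappa> N together use at most half of \<eta> N.\<close>
  define \<kappa> where "\<kappa> = min (\<eta> / 6) (sqrt \<epsilon>1 * \<epsilon>2\<^sup>2 / (4 * sqrt R ^ 3) / 4)"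
  have \<kappa>: "0 < \<kappa>" "3 * \<kappa> \<le> \<eta> / 2" "4 * \<kappa> \<le> sqrt \<epsilon>1 * \<epsilon>2\<^sup>2 / (4 * sqrt R ^ 3)"
    using \<eta> \<epsilon>1 \<epsilon>2 R by (auto simp: \<kappa>_def)
  define t where "t = min (1 / D / 2) (\<kappa> * (1 / D)\<^sup>2 / (16 * R))"
  have t: "0 < t" "t \<le> 1 / D / 2" "t \<le> \<kappa> * (1 / D)\<^sup>2 / (16 * R)" using \<kappa> D R by (auto simp: t_def)
  obtain c1 C1 where c1: "0 < c1" "0 < C1" and up: "\<And>N m n :: nat. real (Suc m) \<le> R * real N \<Longrightarrow> real (Suc n) \<le> R * real N \<Longrightarrow>
    passage_prob m n {shape (Suc m) (Suc n) + \<kappa> * real N ..} \<le> C1 * exp (- c1 * real N)"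
    using lpp_upper_tail[OF \<kappa>(1) R] by blast
  define c where "c = min c1 (t * \<kappa> / 8)"
  have c: "0 < c" "c \<le> c1" "c \<le> t * \<kappa> / 8" using c1 t \<kappa> by (auto simp: c_def)
  \<comment> \<open>The summands pay for the lower tail of the stationary value, for all exit
    points, and for the finitely many N with \<kappa> N < D, where the resulting bound exceeds
    1.\<close>
  define C where "C = 2 + 2 * R * (1 + C1) * (2 / c) + exp (c / 2 * (D / \<kappa>))"
  have C: "0 < C" using R c1 c by (auto simp: C_def intro!: add_nonneg_pos)
  have c2: "0 < c / 2" using c by simp
  show ?thesis
  proof (rule exI[of _ "c / 2"], rule conjI[OF c2], rule exI[of _ C], rule conjI[OF C], intro allI impI)
    fix N m n :: nat
    assume mn: "real (Suc m) \<le> R * real N" "real (Suc n) \<le> R * real N" "\<epsilon>1 * real N \<le> real (Suc m)" "\<epsilon>1 * real N \<le> real (Suc n)"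
    define u v where "u = real (Suc m)" and "v = real (Suc n)"
    have uv: "0 < u" "0 < v" by (auto simp: u_def v_def)
    have N: "0 < real N" using mn(1) R by (cases N) auto
    let ?Q = "passage_prob m n {.. shape u v - \<eta> * real N}"
    have "?Q \<le> C * exp (- (c / 2) * real N)"
    proof (cases "D \<le> \<kappa> * real N")
      case False
      interpret Q: prob_space "prod_exp (\<lambda>_. 1) (grid m n)" by (intro prob_space_prod_exp) simp
      have "real N \<le> D / \<kappa>" using False \<kappa> by (simp add: pos_le_divide_eq mult.commute)
      then have "c / 2 * real N \<le> c / 2 * (D / \<kappa>)" using c by (intro mult_left_mono) auto
      then have "1 \<le> exp (c / 2 * (D / \<kappa>)) * exp (- (c / 2) * real N)" by (simp add: exp_add[symmetric])
      also have "\<dots> \<le> C * exp (- (c / 2) * real N)"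
        using R c1 c by (intro mult_right_mono) (auto simp: C_def)
      finally show ?thesis unfolding passage_prob_def using Q.prob_le_1 by (rule order_trans[rotated])
    next
      case True
      define \<rho> where "\<rho> = sqrt v / (sqrt u + sqrt v)"
      have sp: "0 < sqrt u" "0 < sqrt v" using uv by auto
      have \<rho>01: "0 < \<rho>" "\<rho> < 1"
        and r1: "\<And>x. x / (1 - \<rho>) = x * (1 + sqrt v / sqrt u)" "\<And>x. x / \<rho> = x * (1 + sqrt u / sqrt v)"
        unfolding \<rho>_def by (rule optimal_rate[OF sp])+
      have g2e: "u / (1 - \<rho>) + v / \<rho> = shape u v"
        using optimal_rate(5)[OF sp] uv unfolding \<rho>_def shape_def by simp
      have ratio: "1 + sqrt v' / sqrt u' \<le> D" if "0 < u'" "v' \<le> R * real N" "\<epsilon>1 * real N \<le> u'" "0 \<le> v'" for u' v'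
      proof -
        have "v' / u' \<le> (R * real N) / (\<epsilon>1 * real N)" using that N \<epsilon>1 R by (intro frac_le) auto
        then have "v' / u' \<le> R / \<epsilon>1" using N by simp
        then have "sqrt (v' / u') \<le> sqrt (R / \<epsilon>1)" by simp
        then show ?thesis by (simp add: D_def real_sqrt_divide)
      qed
      have Du: "1 + sqrt v / sqrt u \<le> D" "1 + sqrt u / sqrt v \<le> D"
        using ratio[of u v] ratio[of v u] mn uv by (auto simp: u_def v_def)
      have "1 / (1 - \<rho>) \<le> D" "1 / \<rho> \<le> D" unfolding r1 using Du by simp_all
      then have "1 \<le> D * (1 - \<rho>)" "1 \<le> D * \<rho>" using \<rho>01 by (simp_all add: pos_divide_le_eq)
      then have \<rho>D: "1 / D \<le> 1 - \<rho>" "1 / D \<le> \<rho>" using D by (simp_all add: pos_divide_le_eq mult.commute)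
      let ?P = "prod_exp (boundary_rate \<rho>) (grid (Suc m) (Suc n))" and ?B = "PiM (grid (Suc m) (Suc n)) (\<lambda>_. borel :: real measure)"
      interpret prob_space ?P by (intro prob_space_prod_exp boundary_rate_pos \<rho>01)
      define S1 where "S1 k = {1..Suc k} \<times> {0::nat}" for k
      define S2 where "S2 k = {0::nat} \<times> {1..Suc k}" for k
      \<comment> \<open>\<open>B0\<close>: the stationary value is too small. \<open>B1 k\<close>
        and \<open>B2 k\<close>: for an exit from the horizontal axis the axis part, respectively
        the remaining bulk part, is too large. \<open>B3 k\<close> and \<open>B4 k\<close> are the
        analogues for the vertical axis.\<close>
      define B0 where "B0 = {w \<in> space ?P. 2 * (t * \<kappa> * real N / 2) \<le> - t * (lpp (stat_field w) (Suc m) (Suc n) - (real (Suc m) / (1 - \<rho>) + real (Suc n) / \<rho>))}"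
      define B1 where "B1 k = {w \<in> space ?P. t * \<kappa> * real N \<le> t * ((\<Sum>i\<in>S1 k. w i) - real (card (S1 k)) / (1 - \<rho>))}" for k
      define B2 where "B2 k = {w \<in> space ?P. lpp (shift (stat_field w) (Suc k) 1) (m - k) n \<in> {shape (Suc (m - k)) (Suc n) + \<kappa> * real N ..}}" for k
      define B3 where "B3 k = {w \<in> space ?P. t * \<kappa> * real N \<le> t * ((\<Sum>i\<in>S2 k. w i) - real (card (S2 k)) / \<rho>)}" for k
      define B4 where "B4 k = {w \<in> space ?P. lpp (shift (stat_field w) 1 (Suc k)) m (n - k) \<in> {shape (Suc m) (Suc (n - k)) + \<kappa> * real N ..}}" for k
      have cS: "card (S1 k) = Suc k" "card (S2 k) = Suc k" for k by (auto simp: S1_def S2_def card_cartesian_product)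
      have subS: "k \<le> m \<Longrightarrow> S1 k \<subseteq> grid (Suc m) (Suc n)" "k \<le> n \<Longrightarrow> S2 k \<subseteq> grid (Suc m) (Suc n)" for k
        by (auto simp: S1_def S2_def)
      have mB0: "B0 \<in> sets ?P"
      proof -
        have "(\<lambda>w. lpp (stat_field w) (Suc m) (Suc n)) \<in> borel_measurable ?B" by (intro measurable_lpp measurable_stat_field)
        then show ?thesis unfolding B0_def by measurable
      qed
      have mB1: "B1 k \<in> sets ?P" if "k \<le> m" for k
      proof -
        have "(\<lambda>w. \<Sum>i\<in>S1 k. w i) \<in> borel_measurable ?B"
          using subS(1)[OF that] by (intro borel_measurable_sum measurable_component_singleton) auto
        then show ?thesis unfolding B1_def by measurable
      qed
      have mB3: "B3 k \<in> sets ?P" if "k \<le> n" for k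
      proof -
        have "(\<lambda>w. \<Sum>i\<in>S2 k. w i) \<in> borel_measurable ?B"
          using subS(2)[OF that] by (intro borel_measurable_sum measurable_component_singleton) auto
        then show ?thesis unfolding B3_def by measurable
      qed
      have mB2: "B2 k \<in> sets ?P" if "k \<le> m" for k
      proof -
        have "(\<lambda>w. lpp (shift (stat_field w) (Suc k) 1) (m - k) n) \<in> borel_measurable ?B"
          using that by (intro measurable_lpp_shift_stat_field) auto
        then show ?thesis unfolding B2_def by measurable
      qed
      have mB4: "B4 k \<in> sets ?P" if "k \<le> n" for k
      proof -
        have "(\<lambda>w. lpp (shift (stat_field w) 1 (Suc k)) m (n - k)) \<in> borel_measurable ?B"
          using that by (intro measurable_lpp_shift_stat_field) auto
        then show ?thesis unfolding B4_def by measurable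
      qed
      define e where "e = exp (- c * real N)"
      have ec: "exp (- (t * \<kappa> / 8) * real N) \<le> e" "C1 * exp (- c1 * real N) \<le> C1 * e"
        using mult_right_mono[OF c(2), of "real N"] mult_right_mono[OF c(3), of "real N"] c1 by (auto simp: e_def)
      have P0: "measure ?P B0 \<le> 2 * e"
      proof -
        have "measure ?P B0 \<le> exp (2 * real (Suc m) * (- t)\<^sup>2 / (1 - \<rho>)\<^sup>2 - t * \<kappa> * real N / 2) + exp (2 * real (Suc n) * (- t)\<^sup>2 / \<rho>\<^sup>2 - t * \<kappa> * real N / 2)"
          unfolding B0_def using \<rho>01 \<rho>D t by (intro stationary_tail) auto
        also have "\<dots> \<le> exp (- (t * \<kappa> / 8) * real N) + exp (- (t * \<kappa> / 8) * real N)"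
          unfolding power2_minus using mn R D \<rho>D t \<kappa> by (intro add_mono chernoff_bound[where \<epsilon> = "1 / D" and R = R]) auto
        finally show ?thesis using ec by linarith
      qed
      have P1: "measure ?P (B1 k) \<le> e" if "k \<le> m" for k
      proof -
        have "measure ?P (B1 k) \<le> exp (2 * real (card (S1 k)) * t\<^sup>2 / (1 - \<rho>)\<^sup>2 - t * \<kappa> * real N)"
          unfolding B1_def using \<rho>01 \<rho>D t subS(1)[OF that] by (intro prod_exp_sum_tail boundary_rate_pos) (auto simp: S1_def boundary_rate_def)
        also have "\<dots> \<le> exp (- (t * \<kappa> / 8) * real N)"
          using that mn R D \<rho>D t \<kappa> by (intro chernoff_bound[where \<epsilon> = "1 / D" and R = R]) (auto simp: cS)
        finally show ?thesis using ec by linarith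
      qed
      have P3: "measure ?P (B3 k) \<le> e" if "k \<le> n" for k
      proof -
        have "measure ?P (B3 k) \<le> exp (2 * real (card (S2 k)) * t\<^sup>2 / \<rho>\<^sup>2 - t * \<kappa> * real N)"
          unfolding B3_def using \<rho>01 \<rho>D t subS(2)[OF that] by (intro prod_exp_sum_tail boundary_rate_pos) (auto simp: S2_def boundary_rate_def)
        also have "\<dots> \<le> exp (- (t * \<kappa> / 8) * real N)"
          using that mn R D \<rho>D t \<kappa> by (intro chernoff_bound[where \<epsilon> = "1 / D" and R = R]) (auto simp: cS)
        finally show ?thesis using ec by linarith
      qed
      have P2: "measure ?P (B2 k) \<le> C1 * e" if "k \<le> m" for k
      proof -
        have "measure ?P (B2 k) = passage_prob (m - k) n {shape (Suc (m - k)) (Suc n) + \<kappa> * real N ..}"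
          unfolding B2_def using \<rho>01 that by (intro prob_lpp_stationary) auto
        also have "\<dots> \<le> C1 * exp (- c1 * real N)" using mn that by (intro up) auto
        finally show ?thesis using ec by linarith
      qed
      have P4: "measure ?P (B4 k) \<le> C1 * e" if "k \<le> n" for k
      proof -
        have "measure ?P (B4 k) = passage_prob m (n - k) {shape (Suc m) (Suc (n - k)) + \<kappa> * real N ..}"
          unfolding B4_def using \<rho>01 that by (intro prob_lpp_stationary) auto
        also have "\<dots> \<le> C1 * exp (- c1 * real N)" using mn that by (intro up) auto
        finally show ?thesis using ec by linarith
      qed
      let ?U1 = "\<Union>k\<in>{..m}. B1 k \<union> B2 k" and ?U2 = "\<Union>k\<in>{..n}. B3 k \<union> B4 k"
      have mU: "?U1 \<in> sets ?P" "?U2 \<in> sets ?P" using mB1 mB2 mB3 mB4 by (auto intro!: sets.finite_UN sets.Un)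
      have "?Q = measure ?P {w \<in> space ?P. lpp (shift (stat_field w) 1 1) m n \<in> {.. shape u v - \<eta> * real N}}"
        by (rule prob_lpp_stationary[symmetric]) (use \<rho>01 in auto)
      also have "\<dots> \<le> measure ?P (B0 \<union> (?U1 \<union> ?U2))"
      proof (rule finite_measure_mono_AE)
        show "B0 \<union> (?U1 \<union> ?U2) \<in> sets ?P" using mB0 mU by auto
        show "AE w in ?P. w \<in> {w \<in> space ?P. lpp (shift (stat_field w) 1 1) m n \<in> {.. shape u v - \<eta> * real N}} \<longrightarrow> w \<in> B0 \<union> (?U1 \<union> ?U2)"
          using AE_prod_exp_nonneg[OF finite_grid boundary_rate_pos[OF \<rho>01], of "Suc m" "Suc n"]
        proof eventually_elim
          case (elim w)
          have nn: "0 \<le> shift (stat_field w) 1 1 i j" if "i \<le> m" "j \<le> n" for i j using elim that by (auto simp: shift_def stat_field_def)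
          show ?case
          proof (intro impI, rule ccontr)
            assume A: "w \<in> {w \<in> space ?P. lpp (shift (stat_field w) 1 1) m n \<in> {.. shape u v - \<eta> * real N}}" and nB: "w \<notin> B0 \<union> (?U1 \<union> ?U2)"
            have ws: "w \<in> space ?P" and Lb: "lpp (shift (stat_field w) 1 1) m n \<le> shape u v - \<eta> * real N" using A by auto
            let ?L = "lpp (stat_field w) (Suc m) (Suc n)"
            have "- t * (?L - shape u v) < t * (\<kappa> * real N)"
              using nB ws g2e unfolding B0_def u_def v_def by (simp add: not_le mult.assoc del: lpp.simps of_nat_Suc)
            then have "t * (shape u v - ?L) < t * (\<kappa> * real N)" by (simp add: algebra_simps del: lpp.simps)
            then have h0: "shape u v - \<kappa> * real N < ?L" using t(1) by (simp del: lpp.simps)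
            from lpp_exit[of m "stat_field w" n] show False
            proof (elim disjE exE conjE)
              fix k assume k: "k \<le> m" "?L \<le> lpp (stat_field w) (Suc k) 0 + lpp (shift (stat_field w) (Suc k) 1) (m - k) n"
              have "\<not> w \<in> B1 k" "\<not> w \<in> B2 k" using nB k by auto
              then have b: "(\<Sum>i\<in>S1 k. w i) - real (Suc k) / (1 - \<rho>) < \<kappa> * real N" "lpp (shift (stat_field w) (Suc k) 1) (m - k) n < shape (Suc (m - k)) (Suc n) + \<kappa> * real N"
                using ws t(1) unfolding B1_def B2_def by (auto simp: cS not_le mult.assoc simp del: of_nat_Suc)
              have "lpp (shift (shift (stat_field w) 1 1) k 0) (m - k) n \<le> lpp (shift (stat_field w) 1 1) (k + (m - k)) (0 + n)"
                using nn k by (intro lpp_shift_le) auto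
              then have b2: "lpp (shift (stat_field w) (Suc k) 1) (m - k) n \<le> lpp (shift (stat_field w) 1 1) m n" using k by (simp add: shift_shift)
              have "shape u v - \<eta> * real N < lpp (shift (stat_field w) 1 1) m n"
              proof (rule exit_close[where k = "real k" and A = "lpp (stat_field w) (Suc k) 0" and R = R and \<kappa> = \<kappa> and D = D, OF N _ _ _ _ _ \<epsilon>1 R \<epsilon>2(1) \<kappa>(1) h0 k(2) _ _ b2 Du(1) True \<kappa>(3) \<epsilon>2(2) \<kappa>(2)])
                show "lpp (stat_field w) (Suc k) 0 < (real k + 1) * (1 + sqrt v / sqrt u) + \<kappa> * real N"
                  using b(1) unfolding lpp_stat_field_axis(2) S1_def r1 by (simp add: add.commute)
                have "real (Suc (m - k)) = u - real k" using k by (simp add: u_def)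
                then show "lpp (shift (stat_field w) (Suc k) 1) (m - k) n < shape (u - real k) v + \<kappa> * real N" using b(2) by (simp add: v_def)
              qed (use mn k in \<open>auto simp: u_def v_def\<close>)
              then show False using Lb by simp
            next
              fix k assume k: "k \<le> n" "?L \<le> lpp (stat_field w) 0 (Suc k) + lpp (shift (stat_field w) 1 (Suc k)) m (n - k)"
              have "\<not> w \<in> B3 k" "\<not> w \<in> B4 k" using nB k by auto
              then have b: "(\<Sum>i\<in>S2 k. w i) - real (Suc k) / \<rho> < \<kappa> * real N" "lpp (shift (stat_field w) 1 (Suc k)) m (n - k) < shape (Suc m) (Suc (n - k)) + \<kappa> * real N"
                using ws t(1) unfolding B3_def B4_def by (auto simp: cS not_le mult.assoc simp del: of_nat_Suc)
              have "lpp (shift (shift (stat_field w) 1 1) 0 k) m (n - k) \<le> lpp (shift (stat_field w) 1 1) (0 + m) (k + (n - k))"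
                using nn k by (intro lpp_shift_le) auto
              then have b2: "lpp (shift (stat_field w) 1 (Suc k)) m (n - k) \<le> lpp (shift (stat_field w) 1 1) m n" using k by (simp add: shift_shift)
              \<comment> \<open>An exit from the vertical axis is the same situation with u and v
                exchanged.\<close>
              have "shape v u - \<eta> * real N < lpp (shift (stat_field w) 1 1) m n"
              proof (rule exit_close[where k = "real k" and A = "lpp (stat_field w) 0 (Suc k)" and R = R and \<kappa> = \<kappa> and D = D, OF N _ _ _ _ _ \<epsilon>1 R \<epsilon>2(1) \<kappa>(1) h0[unfolded shape_commute[of u]] k(2) _ _ b2 Du(2) True \<kappa>(3) \<epsilon>2(2) \<kappa>(2)])
                show "lpp (stat_field w) 0 (Suc k) < (real k + 1) * (1 + sqrt u / sqrt v) + \<kappa> * real N"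
                  using b(1) unfolding lpp_stat_field_axis(1) S2_def r1 by (simp add: add.commute)
                have "real (Suc (n - k)) = v - real k" using k by (simp add: v_def)
                then show "lpp (shift (stat_field w) 1 (Suc k)) m (n - k) < shape (v - real k) u + \<kappa> * real N" using b(2) by (simp add: u_def shape_commute)
              qed (use mn k in \<open>auto simp: u_def v_def\<close>)
              then show False using Lb by (simp add: shape_commute)
            qed
          qed
        qed
      qed
      also have "\<dots> \<le> measure ?P B0 + measure ?P (?U1 \<union> ?U2)" using mB0 mU by (intro measure_Un_le) auto
      also have "measure ?P (?U1 \<union> ?U2) \<le> measure ?P ?U1 + measure ?P ?U2" using mU by (intro measure_Un_le) auto
      also have "measure ?P ?U1 \<le> (\<Sum>k\<in>{..m}. measure ?P (B1 k \<union> B2 k))"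
        using mB1 mB2 by (intro measure_UNION_le) auto
      also have "\<dots> \<le> (\<Sum>k\<in>{..m}. e + C1 * e)"
      proof (rule sum_mono)
        fix k assume "k \<in> {..m}"
        then have k: "k \<le> m" by simp
        have "measure ?P (B1 k \<union> B2 k) \<le> measure ?P (B1 k) + measure ?P (B2 k)" by (rule measure_Un_le[OF mB1[OF k] mB2[OF k]])
        then show "measure ?P (B1 k \<union> B2 k) \<le> e + C1 * e" using P1[OF k] P2[OF k] by linarith
      qed
      also have "measure ?P ?U2 \<le> (\<Sum>k\<in>{..n}. measure ?P (B3 k \<union> B4 k))"
        using mB3 mB4 by (intro measure_UNION_le) auto
      also have "\<dots> \<le> (\<Sum>k\<in>{..n}. e + C1 * e)"
      proof (rule sum_mono)
        fix k assume "k \<in> {..n}"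
        then have k: "k \<le> n" by simp
        have "measure ?P (B3 k \<union> B4 k) \<le> measure ?P (B3 k) + measure ?P (B4 k)" by (rule measure_Un_le[OF mB3[OF k] mB4[OF k]])
        then show "measure ?P (B3 k \<union> B4 k) \<le> e + C1 * e" using P3[OF k] P4[OF k] by linarith
      qed
      \<comment> \<open>The sums over k have u and v terms, so their number is u + v, at most 2 R
        N.\<close>
      finally have "?Q \<le> 2 * e + (u + v) * (e + C1 * e)" using P0 by (simp add: u_def v_def algebra_simps)
      also have "\<dots> \<le> 2 * e + (2 * R * real N) * (e + C1 * e)"
        using mn c1 by (intro add_left_mono mult_right_mono) (auto simp: u_def v_def e_def)
      also have "\<dots> = 2 * e + 2 * R * (1 + C1) * (real N * e)" by (simp add: algebra_simps)
      also have "\<dots> \<le> 2 * exp (- (c / 2) * real N) + 2 * R * (1 + C1) * (2 / c * exp (- (c / 2) * real N))"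
        using linear_times_exp_le[OF c(1), of "real N"] R c1 c unfolding e_def
        by (intro add_mono mult_left_mono) auto
      also have "\<dots> = (2 + 2 * R * (1 + C1) * (2 / c)) * exp (- (c / 2) * real N)" by (simp only: distrib_right mult.assoc)
      also have "\<dots> \<le> C * exp (- (c / 2) * real N)" by (intro mult_right_mono) (auto simp: C_def)
      finally show ?thesis .
    qed
    then show "passage_prob m n {.. shape (Suc m) (Suc n) - \<eta> * real N} \<le> C * exp (- (c / 2) * real N)"
      by (simp only: u_def v_def)
  qed
qed

lemma lpp_tail:
  fixes \<eta> R :: real
  assumes \<eta>: "0 < \<eta>" and R: "0 < R"
  shows "\<exists>c::real. 0 < c \<and> (\<exists>C::real. 0 < C \<and> (\<forall>N m n :: nat. real (Suc m) \<le> R * real N \<longrightarrow> real (Suc n) \<le> R * real N \<longrightarrow>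
    passage_prob m n ({.. shape (Suc m) (Suc n) - \<eta> * real N} \<union> {shape (Suc m) (Suc n) + \<eta> * real N ..}) \<le> C * exp (- c * real N)))"
proof -
  define \<epsilon>1 where "\<epsilon>1 = min (\<eta> / 4) (\<eta>\<^sup>2 / (64 * R))"
  have \<epsilon>1: "0 < \<epsilon>1" "\<epsilon>1 \<le> \<eta> / 4" "\<epsilon>1 \<le> \<eta>\<^sup>2 / (64 * R)" using \<eta> R by (auto simp: \<epsilon>1_def)
  obtain c1 C1 where 1: "0 < c1" "0 < C1" "\<And>N m n :: nat. real (Suc m) \<le> R * real N \<Longrightarrow> real (Suc n) \<le> R * real N \<Longrightarrow>
    passage_prob m n {shape (Suc m) (Suc n) + \<eta> * real N ..} \<le> C1 * exp (- c1 * real N)"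
    using lpp_upper_tail[OF \<eta> R] by blast
  obtain c2 where 2: "0 < c2" "\<And>N m n :: nat. real (Suc m) \<le> R * real N \<Longrightarrow> real (Suc n) \<le> R * real N \<Longrightarrow>
    (real (Suc m) < \<epsilon>1 * real N \<or> real (Suc n) < \<epsilon>1 * real N) \<Longrightarrow>
    passage_prob m n {.. shape (Suc m) (Suc n) - \<eta> * real N} \<le> exp (- c2 * real N)"
    using lpp_lower_tail_thin[OF \<eta> R \<epsilon>1] by blast
  obtain c3 C3 where 3: "0 < c3" "0 < C3" "\<And>N m n :: nat. real (Suc m) \<le> R * real N \<Longrightarrow> real (Suc n) \<le> R * real N \<Longrightarrow>
    \<epsilon>1 * real N \<le> real (Suc m) \<Longrightarrow> \<epsilon>1 * real N \<le> real (Suc n) \<Longrightarrow>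
    passage_prob m n {.. shape (Suc m) (Suc n) - \<eta> * real N} \<le> C3 * exp (- c3 * real N)"
    using lpp_lower_tail_thick[OF \<eta> R \<epsilon>1(1)] by blast
  define c where "c = min c1 (min c2 c3)"
  have c: "0 < c" "c \<le> c1" "c \<le> c2" "c \<le> c3" using 1 2 3 by (auto simp: c_def)
  have C: "0 < C1 + (1 + C3)" using 1 3 by simp
  show ?thesis
  proof (rule exI[of _ c], rule conjI[OF c(1)], rule exI[of _ "C1 + (1 + C3)"], rule conjI[OF C], intro allI impI)
    fix N m n :: nat assume mn: "real (Suc m) \<le> R * real N" "real (Suc n) \<le> R * real N"
    let ?P = "prod_exp (\<lambda>_. 1) (grid m n)" and ?e = "exp (- c * real N)"
    interpret prob_space ?P by (intro prob_space_prod_exp) simp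
    let ?A = "{w \<in> space ?P. lpp (curry w) m n \<in> {.. shape (Suc m) (Suc n) - \<eta> * real N}}"
    let ?B = "{w \<in> space ?P. lpp (curry w) m n \<in> {shape (Suc m) (Suc n) + \<eta> * real N ..}}"
    have mL: "(\<lambda>w. lpp (curry w) m n) \<in> borel_measurable (PiM (grid m n) (\<lambda>_. borel))" by (intro measurable_lpp) auto
    have sL: "{w \<in> space ?P. lpp (curry w) m n \<in> X} \<in> sets ?P" if "X \<in> sets borel" for X
    proof -
      have eq: "(\<lambda>w. lpp (curry w) m n) -` X \<inter> space ?P = {w \<in> space ?P. lpp (curry w) m n \<in> X}" by auto
      have "(\<lambda>w. lpp (curry w) m n) \<in> borel_measurable ?P" using mL by (simp cong: measurable_cong_sets)
      from measurable_sets[OF this that] show ?thesis by (simp only: eq)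
    qed
    have e: "exp (- c1 * real N) \<le> ?e" "exp (- c2 * real N) \<le> ?e" "exp (- c3 * real N) \<le> ?e"
      using c by (auto simp: mult_right_mono)
    have "measure ?P ?A \<le> exp (- c2 * real N) \<or> measure ?P ?A \<le> C3 * exp (- c3 * real N)"
      using 2(2)[OF mn] 3(3)[OF mn] unfolding passage_prob_def by (meson not_le)
    moreover have "C3 * exp (- c3 * real N) \<le> C3 * ?e" "C1 * exp (- c1 * real N) \<le> C1 * ?e" "0 \<le> C3 * ?e"
      using e 1 3 by (auto intro!: mult_left_mono)
    ultimately have "measure ?P ?A \<le> (1 + C3) * ?e" "measure ?P ?B \<le> C1 * ?e"
      using e 1(3)[OF mn, unfolded passage_prob_def] exp_ge_zero[of "- c * real N"] unfolding distrib_right mult_1 by linarith+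
    moreover have "measure ?P (?A \<union> ?B) \<le> measure ?P ?A + measure ?P ?B"
      by (intro measure_Un_le sL) auto
    moreover have "?A \<union> ?B = {w \<in> space ?P. lpp (curry w) m n \<in> {.. shape (Suc m) (Suc n) - \<eta> * real N} \<union> {shape (Suc m) (Suc n) + \<eta> * real N ..}}" by auto
    ultimately show "passage_prob m n ({.. shape (Suc m) (Suc n) - \<eta> * real N} \<union> {shape (Suc m) (Suc n) + \<eta> * real N ..}) \<le> (C1 + (1 + C3)) * ?e"
      unfolding passage_prob_def by (simp add: algebra_simps)
  qed
qed

section \<open>Lattice paths in the rectangle\<close>

text \<open>The lattice point with coordinates \<open>u = i / N\<close> and \<open>v = j / N\<close>.\<close>
definition site :: "nat \<Rightarrow> nat \<times> nat \<Rightarrow> real \<times> real" where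
  "site N p = ((real (fst p) + real (snd p)) / real N, (real (fst p) - real (snd p)) / real N)"

text \<open>In rotated coordinates the corner (l, b) is ((l + b) / 2, (l - b) / 2); the largest
  lattice indices are N times these side lengths, rounded down.\<close>

definition num_u :: "real \<Rightarrow> real \<Rightarrow> nat \<Rightarrow> nat" where "num_u l b N = nat \<lfloor>real N * ((l + b) / 2)\<rfloor>"
definition num_v :: "real \<Rightarrow> real \<Rightarrow> nat \<Rightarrow> nat" where "num_v l b N = nat \<lfloor>real N * ((l - b) / 2)\<rfloor>"

lemma Qreg_iff: "(x, y) \<in> Qreg l b \<longleftrightarrow> 0 \<le> x + y \<and> 0 \<le> x - y \<and> x + y \<le> l + b \<and> x - y \<le> l - b"
  by (auto simp: Qreg_def abs_le_iff)

lemma le_nat_floor_iff: "0 \<le> x \<Longrightarrow> i \<le> nat \<lfloor>x\<rfloor> \<longleftrightarrow> real i \<le> x"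
  by (simp add: le_nat_iff le_floor_iff)

lemma site_in_Qreg_iff:
  assumes N: "1 \<le> N" and b: "\<bar>b\<bar> < l"
  shows "site N (i, j) \<in> Qreg l b \<longleftrightarrow> i \<le> num_u l b N \<and> j \<le> num_v l b N"
proof -
  have N0: "0 < real N" using N by simp
  have "(real i + real j) / real N + (real i - real j) / real N = 2 * real i / real N"
    "(real i + real j) / real N - (real i - real j) / real N = 2 * real j / real N"
    by (simp_all add: add_divide_distrib[symmetric] diff_divide_distrib[symmetric])
  then have "site N (i, j) \<in> Qreg l b \<longleftrightarrow> 2 * real i / real N \<le> l + b \<and> 2 * real j / real N \<le> l - b"
    using N0 by (simp add: site_def Qreg_iff)
  also have "\<dots> \<longleftrightarrow> real i \<le> real N * ((l + b) / 2) \<and> real j \<le> real N * ((l - b) / 2)"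
    using N0 by (auto simp: field_simps)
  also have "\<dots> \<longleftrightarrow> i \<le> num_u l b N \<and> j \<le> num_v l b N"
    using b N0 unfolding num_u_def num_v_def by (subst (1 2) le_nat_floor_iff) auto
  finally show ?thesis .
qed

lemma inj_site: "1 \<le> N \<Longrightarrow> inj (site N)"
proof (rule injI)
  fix p q assume N: "1 \<le> N" and "site N p = site N q"
  then have "real (fst p) + real (snd p) = real (fst q) + real (snd q)" "real (fst p) - real (snd p) = real (fst q) - real (snd q)"
    by (auto simp: site_def)
  then have "real (fst p) = real (fst q)" "real (snd p) = real (snd q)" by linarith+
  then show "p = q" by (simp add: prod_eq_iff)
qed

text \<open>The parity condition on i + j is what makes the rotated coordinates (i + j) / 2 and (i -
  j) / 2 integers; membership in the region makes them nonnegative and bounds them.\<close>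

lemma SN_eq:
  assumes N: "1 \<le> N" and b: "\<bar>b\<bar> < l"
  shows "SN l b N = site N ` grid (num_u l b N) (num_v l b N)"
proof (intro set_eqI iffI)
  fix p assume "p \<in> SN l b N"
  then obtain i j :: int where ij: "even (i + j)" "p = (of_int i / real N, of_int j / real N)" and Q: "p \<in> Qreg l b"
    by (auto simp: SN_def)
  have N0: "0 < real N" using N by simp
  have "0 \<le> of_int i / real N + of_int j / real N" "0 \<le> of_int i / real N - of_int j / real N"
    using Q ij by (auto simp: Qreg_iff)
  then have "0 \<le> (of_int (i + j) :: real)" "0 \<le> (of_int (i - j) :: real)"
    using N0 by (auto simp: add_divide_distrib[symmetric] diff_divide_distrib[symmetric] zero_le_divide_iff)
  then have nn: "0 \<le> i + j" "0 \<le> i - j" by (simp_all only: of_int_0_le_iff)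
  obtain a where a: "i + j = 2 * a" using ij(1) by (rule evenE)
  define c where "c = i - a"
  have ac: "0 \<le> a" "0 \<le> c" "i = a + c" "j = a - c" using a nn by (auto simp: c_def)
  then have "p = site N (nat a, nat c)" using ij by (simp add: site_def)
  moreover from this have "nat a \<le> num_u l b N \<and> nat c \<le> num_v l b N" using site_in_Qreg_iff[OF N b] Q by metis
  ultimately show "p \<in> site N ` grid (num_u l b N) (num_v l b N)" by auto
next
  fix p assume "p \<in> site N ` grid (num_u l b N) (num_v l b N)"
  then obtain i j where ij: "p = site N (i, j)" "i \<le> num_u l b N" "j \<le> num_v l b N" by auto
  then have "p \<in> Qreg l b" using site_in_Qreg_iff[OF N b] by simp
  moreover have "p = (of_int (int i + int j) / real N, of_int (int i - int j) / real N)" using ij by (simp add: site_def)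
  moreover have "even ((int i + int j) + (int i - int j))" by simp
  ultimately show "p \<in> SN l b N" unfolding SN_def by blast
qed

lemma rightmost_eq:
  assumes N: "1 \<le> N" and b: "\<bar>b\<bar> < l"
  shows "rightmost l b N = site N (num_u l b N, num_v l b N)"
  unfolding rightmost_def
proof (rule the_equality)
  have N0: "0 < real N" using N by simp
  show "site N (num_u l b N, num_v l b N) \<in> SN l b N \<and> (\<forall>q\<in>SN l b N. fst q \<le> fst (site N (num_u l b N, num_v l b N)))"
  proof
    show "site N (num_u l b N, num_v l b N) \<in> SN l b N" unfolding SN_eq[OF N b] by (rule imageI) simp
    show "\<forall>q\<in>SN l b N. fst q \<le> fst (site N (num_u l b N, num_v l b N))"
      unfolding SN_eq[OF N b] by (auto simp: site_def divide_right_mono)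
  qed
  fix p assume p: "p \<in> SN l b N \<and> (\<forall>q\<in>SN l b N. fst q \<le> fst p)"
  then obtain i j where ij: "p = site N (i, j)" "i \<le> num_u l b N" "j \<le> num_v l b N" unfolding SN_eq[OF N b] by auto
  have "fst (site N (num_u l b N, num_v l b N)) \<le> fst p" using p unfolding SN_eq[OF N b] by auto
  then have "real (num_u l b N) + real (num_v l b N) \<le> real i + real j" using N0 ij by (simp add: site_def divide_le_cancel)
  then have "i = num_u l b N" "j = num_v l b N" using ij by linarith+
  then show "p = site N (num_u l b N, num_v l b N)" using ij by simp
qed

text \<open>Connects the path as a list of real points with the path as an indexed sequence of
  lattice sites. Every path has length A + B + 1, since each step raises exactly one index by
  one.\<close>

definition path_rep :: "nat \<Rightarrow> nat \<Rightarrow> nat \<Rightarrow> (nat \<Rightarrow> nat \<times> nat) \<Rightarrow> (real \<times> real) list \<Rightarrow> bool" where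
  "path_rep N A B P \<pi> \<longleftrightarrow> lattice_path P (A + B) \<and> P 0 = (0, 0) \<and> P (A + B) = (A, B) \<and> \<pi> = map (\<lambda>i. site N (P i)) [0..<Suc (A + B)]"

lemma paths_rep:
  assumes N: "1 \<le> N" and b: "\<bar>b\<bar> < l" and \<pi>: "\<pi> \<in> paths l b N"
  shows "\<exists>P. path_rep N (num_u l b N) (num_v l b N) P \<pi>"
proof -
  have N0: "0 < real N" using N by simp
  have ne: "\<pi> \<noteq> []" "hd \<pi> = (0, 0)" "set \<pi> \<subseteq> SN l b N" "last \<pi> = rightmost l b N"
    and st: "\<And>i. Suc i < length \<pi> \<Longrightarrow> fst (\<pi> ! Suc i) - fst (\<pi> ! i) = 1 / real N \<and>
        (snd (\<pi> ! Suc i) - snd (\<pi> ! i) = 1 / real N \<or> snd (\<pi> ! Suc i) - snd (\<pi> ! i) = - 1 / real N)"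
    using \<pi> by (auto simp: paths_def)
  have "\<exists>p. \<pi> ! i = site N p" if "i < length \<pi>" for i
    using nth_mem[OF that] ne(3) unfolding SN_eq[OF N b] by blast
  then obtain P where P: "\<And>i. i < length \<pi> \<Longrightarrow> \<pi> ! i = site N (P i)" by metis
  define k where "k = length \<pi> - 1"
  have k: "length \<pi> = Suc k" using ne by (cases \<pi>) (auto simp: k_def)
  have step_iff: "x / real N - z / real N = 1 / real N \<longleftrightarrow> x - z = 1" "x / real N - z / real N = - 1 / real N \<longleftrightarrow> x - z = - 1" for x z
    unfolding diff_divide_distrib[symmetric] divide_cancel_right using N0 by auto
  have lp: "lattice_path P k" unfolding lattice_path_def
  proof (intro allI impI)
    fix i assume i: "i < k"
    obtain a c a' c' where ac: "P i = (a, c)" "P (Suc i) = (a', c')" by (metis surj_pair)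
    have "fst (site N (a', c')) - fst (site N (a, c)) = 1 / real N \<and>
      (snd (site N (a', c')) - snd (site N (a, c)) = 1 / real N \<or> snd (site N (a', c')) - snd (site N (a, c)) = - 1 / real N)"
      using st[of i] i k P[of i] P[of "Suc i"] ac by simp
    then have "(real a' + real c') - (real a + real c) = 1 \<and> ((real a' - real c') - (real a - real c) = 1 \<or> (real a' - real c') - (real a - real c) = - 1)"
      unfolding site_def fst_conv snd_conv step_iff .
    then have "(a' = Suc a \<and> c' = c) \<or> (a' = a \<and> c' = Suc c)" by linarith
    then show "P (Suc i) = (Suc (fst (P i)), snd (P i)) \<or> P (Suc i) = (fst (P i), Suc (snd (P i)))"
      using ac by auto
  qed
  have "site N (P 0) = (0, 0)" using P[of 0] ne k by (simp add: hd_conv_nth)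
  then have "site N (P 0) = site N (0, 0)" by (simp add: site_def)
  then have P0: "P 0 = (0, 0)" using inj_site[OF N] by (simp add: inj_eq)
  have "site N (P k) = site N (num_u l b N, num_v l b N)" using P[of k] ne k by (simp add: last_conv_nth rightmost_eq[OF N b])
  then have Pk: "P k = (num_u l b N, num_v l b N)" using inj_site[OF N] by (simp add: inj_eq)
  have kk: "k = num_u l b N + num_v l b N" using lattice_path_sum[OF lp order_refl P0] Pk by simp
  have "\<pi> = map (\<lambda>i. site N (P i)) [0..<Suc k]"
    by (rule nth_equalityI) (use k P in \<open>auto simp del: upt_Suc\<close>)
  then show ?thesis using lp P0 Pk kk unfolding path_rep_def by auto
qed

lemma path_rep_in_paths:
  assumes N: "1 \<le> N" and b: "\<bar>b\<bar> < l" and r: "path_rep N (num_u l b N) (num_v l b N) P \<pi>"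
  shows "\<pi> \<in> paths l b N"
proof -
  let ?T = "num_u l b N + num_v l b N"
  have N0: "0 < real N" using N by simp
  have P: "lattice_path P ?T" "P 0 = (0, 0)" "P ?T = (num_u l b N, num_v l b N)" and \<pi>: "\<pi> = map (\<lambda>i. site N (P i)) [0..<Suc ?T]"
    using r by (auto simp: path_rep_def)
  have "hd \<pi> = (0, 0)" using P(2) by (simp add: \<pi> hd_map site_def del: upt_Suc)
  moreover have "last \<pi> = rightmost l b N" using P(3) by (simp add: \<pi> rightmost_eq[OF N b])
  moreover have "set \<pi> \<subseteq> SN l b N"
  proof -
    have "P i \<in> grid (num_u l b N) (num_v l b N)" if "i \<le> ?T" for i
      using lattice_path_mono[OF P(1) that order_refl] P(3) by (cases "P i") auto
    then show ?thesis unfolding SN_eq[OF N b] \<pi> by (auto simp del: upt_Suc)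
  qed
  moreover have "fst (\<pi> ! Suc i) - fst (\<pi> ! i) = 1 / real N \<and>
        (snd (\<pi> ! Suc i) - snd (\<pi> ! i) = 1 / real N \<or> snd (\<pi> ! Suc i) - snd (\<pi> ! i) = - 1 / real N)"
    if "Suc i < length \<pi>" for i
  proof -
    have i: "i < ?T" using that by (simp add: \<pi>)
    then have "\<pi> ! i = site N (P i)" "\<pi> ! Suc i = site N (P (Suc i))" by (auto simp: \<pi> nth_map simp del: upt_Suc)
    moreover have "P (Suc i) = (Suc (fst (P i)), snd (P i)) \<or> P (Suc i) = (fst (P i), Suc (snd (P i)))"
      using P(1) i by (auto simp: lattice_path_def)
    ultimately show ?thesis using N0 by (auto simp: site_def diff_divide_distrib[symmetric])
  qed
  moreover have "\<pi> \<noteq> []" by (simp add: \<pi>)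
  ultimately show ?thesis by (simp add: paths_def)
qed

lemma path_rep_weight:
  assumes "path_rep N A B P \<pi>"
  shows "weight \<alpha> E N \<omega> \<pi> = (\<Sum>i\<le>A + B. \<alpha> (site N (P i)) / real N * E N (site N (P i)) \<omega>)"
proof -
  have "\<pi> = map (\<lambda>i. site N (P i)) [0..<Suc (A + B)]" using assms by (simp add: path_rep_def)
  then have "weight \<alpha> E N \<omega> \<pi> = sum_list (map (\<lambda>i. \<alpha> (site N (P i)) / real N * E N (site N (P i)) \<omega>) [0..<Suc (A + B)])"
    by (simp add: weight_def o_def del: upt_Suc)
  also have "\<dots> = (\<Sum>i\<in>set [0..<Suc (A + B)]. \<alpha> (site N (P i)) / real N * E N (site N (P i)) \<omega>)"
    by (simp only: sum_list_distinct_conv_sum_set distinct_upt)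
  also have "set [0..<Suc (A + B)] = {..A + B}" by auto
  finally show ?thesis .
qed

section \<open>Curves interpolating lattice paths\<close>

lemma exists_lipschitz_through:
  fixes S :: "(real \<times> real) set"
  assumes S: "finite S" "S \<noteq> {}" and lip: "\<And>p q. p \<in> S \<Longrightarrow> q \<in> S \<Longrightarrow> \<bar>snd p - snd q\<bar> \<le> \<bar>fst p - fst q\<bar>"
  obtains f :: "real \<Rightarrow> real" where "1-lipschitz_on UNIV f" "\<And>p. p \<in> S \<Longrightarrow> f (fst p) = snd p"
proof -
  \<comment> \<open>McShane extension\<close>
  define f where "f x = Min ((\<lambda>p. snd p + \<bar>x - fst p\<bar>) ` S)" for x
  have le: "f x \<le> snd p + \<bar>x - fst p\<bar>" if "p \<in> S" for x p using S that by (auto simp: f_def)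
  have att: "\<exists>p\<in>S. f x = snd p + \<bar>x - fst p\<bar>" for x
  proof -
    have "f x \<in> (\<lambda>p. snd p + \<bar>x - fst p\<bar>) ` S" unfolding f_def using S by (intro Min_in) auto
    then show ?thesis by blast
  qed
  have one: "f x \<le> f z + \<bar>x - z\<bar>" for x z
  proof -
    obtain p where "p \<in> S" "f z = snd p + \<bar>z - fst p\<bar>" using att by blast
    then show ?thesis using le[of p x] by linarith
  qed
  show ?thesis
  proof (rule that)
    show "1-lipschitz_on UNIV f"
    proof (rule lipschitz_onI)
      fix x z show "dist (f x) (f z) \<le> 1 * dist x z" using one[of x z] one[of z x] by (simp add: dist_real_def abs_le_iff)
    qed simp
    fix p assume p: "p \<in> S"
    obtain q where q: "q \<in> S" "f (fst p) = snd q + \<bar>fst p - fst q\<bar>" using att by blast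
    then show "f (fst p) = snd p" using le[OF p, of "fst p"] lip[OF p q(1)] by linarith
  qed
qed

text \<open>The last site is in general not (l, b), so this point is added to the data. Membership
  of all sites in the region is exactly the Lipschitz condition towards (l, b).\<close>

lemma path_rep_Xset:
  assumes l: "0 < l" and b: "\<bar>b\<bar> < l" and N: "1 \<le> N" and r: "path_rep N (num_u l b N) (num_v l b N) P \<pi>"
  obtains y where "y \<in> Xset l b" "\<And>i. i \<le> num_u l b N + num_v l b N \<Longrightarrow> y (real i / real N) = snd (site N (P i))"
proof -
  let ?T = "num_u l b N + num_v l b N"
  have N0: "0 < real N" using N by simp
  have P: "lattice_path P ?T" "P 0 = (0, 0)" "P ?T = (num_u l b N, num_v l b N)"
    using r by (auto simp: path_rep_def)
  have Q: "site N (P i) \<in> Qreg l b" if "i \<le> ?T" for i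
    using lattice_path_mono[OF P(1) that order_refl] P(3) site_in_Qreg_iff[OF N b, of "fst (P i)" "snd (P i)"] by simp
  have fst_site: "fst (site N (P i)) = real i / real N" if "i \<le> ?T" for i
    using lattice_path_sum[OF P(1) that P(2)] by (simp add: site_def flip: of_nat_add)
  have mono: "\<bar>snd (site N (P i)) - snd (site N (P j))\<bar> \<le> fst (site N (P j)) - fst (site N (P i))" if "i \<le> j" "j \<le> ?T" for i j
    using lattice_path_mono[OF P(1) that] N0
    by (simp add: site_def abs_le_iff diff_divide_distrib[symmetric] divide_right_mono minus_divide_left)
  let ?S = "insert (l, b) ((\<lambda>i. site N (P i)) ` {..?T})"
  obtain y where y: "1-lipschitz_on UNIV y" "\<And>p. p \<in> ?S \<Longrightarrow> y (fst p) = snd p"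
  proof (rule exists_lipschitz_through[of ?S])
    fix p q assume pq: "p \<in> ?S" "q \<in> ?S"
    have lb: "\<bar>b - snd (site N (P i))\<bar> \<le> \<bar>l - fst (site N (P i))\<bar>" "\<bar>snd (site N (P i)) - b\<bar> \<le> \<bar>fst (site N (P i)) - l\<bar>" if "i \<le> ?T" for i
      using Q[OF that] by (auto simp: Qreg_def case_prod_unfold abs_minus_commute)
    have ij: "\<bar>snd (site N (P i)) - snd (site N (P j))\<bar> \<le> \<bar>fst (site N (P i)) - fst (site N (P j))\<bar>" if "i \<le> ?T" "j \<le> ?T" for i j
      using mono[of i j] mono[of j i] that by (cases "i \<le> j") (auto simp: abs_minus_commute)
    show "\<bar>snd p - snd q\<bar> \<le> \<bar>fst p - fst q\<bar>"
      using pq lb ij by auto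
  qed auto
  show ?thesis
  proof (rule that)
    have "y (fst (site N (P 0))) = snd (site N (P 0))" by (intro y(2)) auto
    then have "y 0 = 0" using P(2) by (simp add: site_def)
    moreover have "y l = b" using y(2)[of "(l, b)"] by simp
    ultimately show "y \<in> Xset l b" using lipschitz_on_subset[OF y(1)] by (auto simp: Xset_def)
    fix i assume i: "i \<le> ?T"
    then have "y (fst (site N (P i))) = snd (site N (P i))" by (intro y(2)) auto
    then show "y (real i / real N) = snd (site N (P i))" by (simp add: fst_site[OF i])
  qed
qed

text \<open>Both the path and \<open>ys\<close> move by at most 1 / N between neighbouring abscissae
  i / N, hence 2 / N.\<close>

lemma interp_dist_le:
  assumes b: "\<bar>b\<bar> < l" and N: "1 \<le> N" and r: "path_rep N (num_u l b N) (num_v l b N) P \<pi>"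
    and ys: "ys \<in> Xset l b" and d: "\<And>i. i \<le> num_u l b N + num_v l b N \<Longrightarrow> \<bar>snd (site N (P i)) - ys (real i / real N)\<bar> \<le> d"
  shows "supdist N \<pi> ys \<le> d + 2 / real N"
  unfolding supdist_def
proof (rule cSUP_least)
  let ?T = "num_u l b N + num_v l b N"
  have N0: "0 < real N" using N by simp
  have P: "lattice_path P ?T" "P 0 = (0, 0)" "P ?T = (num_u l b N, num_v l b N)" and \<pi>: "\<pi> = map (\<lambda>i. site N (P i)) [0..<Suc ?T]"
    using r by (auto simp: path_rep_def)
  have lst: "fst (last \<pi>) = real ?T / real N" by (simp add: \<pi> P(3) site_def)
  have TN: "real ?T / real N \<le> l"
  proof -
    have "site N (num_u l b N, num_v l b N) \<in> Qreg l b" using site_in_Qreg_iff[OF N b] by simp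
    then show ?thesis by (auto simp: Qreg_def site_def)
  qed
  show "{0..fst (last \<pi>)} \<noteq> {}" using N0 by (simp add: lst)
  fix x assume "x \<in> {0..fst (last \<pi>)}"
  then have x: "0 \<le> x" "real N * x \<le> real ?T" using N0 by (auto simp: lst pos_le_divide_eq mult.commute)
  define i where "i = nat \<lfloor>real N * x\<rfloor>"
  define t where "t = real N * x - real i"
  have i: "real i \<le> real N * x" "real N * x < real i + 1" using x N0 by (auto simp: i_def of_nat_nat)
  then have iT: "i \<le> ?T" and t: "0 \<le> t" "t < 1" using x by (auto simp: t_def)
  have \<pi>n: "\<pi> ! j = site N (P j)" if "j \<le> ?T" for j using that by (auto simp: \<pi> simp del: upt_Suc)
  have "\<bar>interp N \<pi> x - snd (site N (P i))\<bar> \<le> 1 / real N"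
  proof (cases "i = ?T")
    case True
    \<comment> \<open>At the right end \<open>interp\<close> would look up a position past the end
      of the list, but its coefficient is 0.\<close>
    then have "t = 0" using x i by (auto simp: t_def)
    then have "interp N \<pi> x = snd (site N (P i))"
      using \<pi>n[OF iT] by (simp add: interp_def Let_def i_def[symmetric] t_def[symmetric])
    then show ?thesis using N0 by simp
  next
    case False
    then have iT': "i < ?T" using iT by simp
    have "interp N \<pi> x = (1 - t) * snd (site N (P i)) + t * snd (site N (P (Suc i)))"
      using \<pi>n[OF iT] \<pi>n[of "Suc i"] iT' by (simp add: interp_def Let_def i_def[symmetric] t_def[symmetric])
    then have eq: "interp N \<pi> x - snd (site N (P i)) = t * (snd (site N (P (Suc i))) - snd (site N (P i)))"
      by (simp add: algebra_simps)
    have "P (Suc i) = (Suc (fst (P i)), snd (P i)) \<or> P (Suc i) = (fst (P i), Suc (snd (P i)))"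
      using P(1) iT' by (auto simp: lattice_path_def)
    then have "\<bar>snd (site N (P (Suc i))) - snd (site N (P i))\<bar> = 1 / real N"
      using N0 by (auto simp: site_def diff_divide_distrib[symmetric] abs_divide)
    then have "\<bar>interp N \<pi> x - snd (site N (P i))\<bar> = t * (1 / real N)" unfolding eq abs_mult using t by simp
    also have "\<dots> \<le> 1 * (1 / real N)" using t N0 by (intro mult_right_mono) auto
    finally show ?thesis by simp
  qed
  moreover have "\<bar>ys x - ys (real i / real N)\<bar> \<le> 1 / real N"
  proof -
    have 1: "real i / real N \<le> x" using i N0 by (simp add: pos_divide_le_eq mult.commute)
    have "real ?T \<le> real N * l" using TN N0 by (simp add: pos_divide_le_eq mult.commute)
    then have "real N * x \<le> real N * l" using x(2) by linarith
    then have 2: "x \<le> l" using N0 by (simp only: mult_le_cancel_left_pos)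
    have "x \<le> (real i + 1) / real N" using i N0 by (simp add: pos_le_divide_eq mult.commute)
    then have 3: "x - real i / real N \<le> 1 / real N" by (simp add: add_divide_distrib)
    show ?thesis using Xset_dist[OF ys _ 1 2] 3 N0 by simp
  qed
  ultimately show "\<bar>interp N \<pi> x - ys x\<bar> \<le> d + 2 / real N" using d[OF iT] by (simp add: add_divide_distrib[symmetric]) 
qed

section \<open>Comparison of path weights with the functional\<close>

text \<open>The probabilistic input needed for one N: closeness to the shape for all sub-rectangles
  at once, so that a path may be cut wherever it happens to run.\<close>

definition good_env :: "real \<Rightarrow> real \<Rightarrow> nat \<Rightarrow> real \<Rightarrow> (real \<times> real \<Rightarrow> real) \<Rightarrow> bool" where
  "good_env l b N \<eta> e \<longleftrightarrow> (\<forall>p\<in>SN l b N. 0 \<le> e p) \<and>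
     (\<forall>a c m n. a + m \<le> num_u l b N \<longrightarrow> c + n \<le> num_v l b N \<longrightarrow>
        \<bar>lpp (shift (\<lambda>i j. e (site N (i, j))) a c) m n - shape (Suc m) (Suc n)\<bar> \<le> \<eta> * real N)"

lemma shape_homogeneous: "0 \<le> c \<Longrightarrow> shape (c * u) (c * v) = c * shape u v"
  by (simp add: shape_def real_sqrt_mult distrib_left[symmetric] power_mult_distrib)

text \<open>Identifies the integrand of the functional with the limit shape in rotated coordinates;
  this is where \<open>gam\<close> comes from.\<close>

lemma seg_shape_eq_shape:
  assumes "\<bar>dy\<bar> \<le> dx"
  shows "seg_shape dx dy = shape ((dx + dy) / 2) ((dx - dy) / 2)"
proof -
  have "(dx + dy) / 2 * ((dx - dy) / 2) = (dx\<^sup>2 - dy\<^sup>2) / 2\<^sup>2" by (simp add: power2_eq_square algebra_simps)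
  then have "sqrt ((dx + dy) / 2 * ((dx - dy) / 2)) = sqrt (dx\<^sup>2 - dy\<^sup>2) / 2" by (simp add: real_sqrt_divide)
  then show ?thesis using assms by (simp add: shape_expand seg_shape_def field_simps)
qed

text \<open>The square roots are not Lipschitz at the axes, so rounding errors are controlled by
  uniform continuity on a compact square.\<close>

lemma shape_uniform:
  assumes "0 < w"
  obtains d where "0 < d" "\<And>u v u' v'. \<lbrakk>u \<in> {0..B}; v \<in> {0..B}; u' \<in> {0..B}; v' \<in> {0..B}; \<bar>u - u'\<bar> \<le> d; \<bar>v - v'\<bar> \<le> d\<rbrakk>
     \<Longrightarrow> \<bar>shape u v - shape u' v'\<bar> \<le> w"
proof -
  have "continuous_on (cbox (0, 0) (B, B)) (\<lambda>p. shape (fst p) (snd p))"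
    unfolding shape_def by (intro continuous_intros)
  then have "uniformly_continuous_on (cbox (0, 0) (B, B)) (\<lambda>p. shape (fst p) (snd p))"
    by (intro compact_uniformly_continuous) auto
  then obtain d where d: "d > 0" "\<And>p q. p \<in> cbox (0, 0) (B, B) \<Longrightarrow> q \<in> cbox (0, 0) (B, B) \<Longrightarrow> dist q p < d \<Longrightarrow>
     dist (shape (fst q) (snd q)) (shape (fst p) (snd p)) < w"
    using assms unfolding uniformly_continuous_on_def by metis
  show ?thesis
  proof (rule that[of "d / 3"])
    fix u v u' v' assume a: "u \<in> {0..B}" "v \<in> {0..B}" "u' \<in> {0..B}" "v' \<in> {0..B}" "\<bar>u - u'\<bar> \<le> d / 3" "\<bar>v - v'\<bar> \<le> d / 3"
    have "dist (u, v) (u', v') \<le> \<bar>u - u'\<bar> + \<bar>v - v'\<bar>"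
      by (simp add: dist_Pair_Pair dist_real_def sqrt_sum_squares_le_sum_abs)
    then have "dist (u, v) (u', v') < d" using a d(1) by linarith
    then show "\<bar>shape u v - shape u' v'\<bar> \<le> w" using d(2)[of "(u', v')" "(u, v)"] a by (auto simp: dist_real_def cbox_Pair_eq)
  qed (use d in auto)
qed

text \<open>Neighbouring blocks share an end point, and counting its nonnegative weight twice only
  enlarges the sum. Closed blocks are what the passage times see.\<close>

lemma sum_le_sum_blocks:
  fixes F :: "nat \<Rightarrow> real"
  assumes F: "\<And>i. i \<le> t J \<Longrightarrow> 0 \<le> F i" and t: "t 0 = 0" "\<And>j. j < J \<Longrightarrow> t j \<le> t (Suc j)" and J: "0 < J"
  shows "(\<Sum>i\<le>t J. F i) \<le> (\<Sum>j<J. \<Sum>i=t j..t (Suc j). F i)"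
  using F t(2) J
proof (induction J)
  case (Suc J)
  show ?case
  proof (cases "J = 0")
    case True then show ?thesis using t(1) by (simp add: atLeast0AtMost)
  next
    case False
    have tJ: "t J \<le> t (Suc J)" using Suc.prems by simp
    have "(\<Sum>i\<le>t J. F i) \<le> (\<Sum>j<J. \<Sum>i=t j..t (Suc j). F i)"
      using Suc False tJ by auto
    moreover have "(\<Sum>i\<le>t (Suc J). F i) \<le> (\<Sum>i\<le>t J. F i) + (\<Sum>i=t J..t (Suc J). F i)"
    proof -
      have "(\<Sum>i\<le>t (Suc J). F i) = (\<Sum>i\<in>{..t J} \<union> {t J<..t (Suc J)}. F i)"
        using tJ by (intro sum.cong) auto
      also have "\<dots> = (\<Sum>i\<le>t J. F i) + (\<Sum>i\<in>{t J<..t (Suc J)}. F i)" by (rule sum.union_disjoint) auto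
      also have "(\<Sum>i\<in>{t J<..t (Suc J)}. F i) \<le> (\<Sum>i=t J..t (Suc J). F i)"
        using Suc.prems(1) by (intro sum_mono2) auto
      finally show ?thesis by simp
    qed
    ultimately show ?thesis by simp
  qed
qed simp

lemma nat_floor_bounds: "0 \<le> x \<Longrightarrow> real (nat \<lfloor>x\<rfloor>) \<le> x" "0 \<le> x \<Longrightarrow> x < real (nat \<lfloor>x\<rfloor>) + 1"
  by (simp_all add: of_nat_nat)

lemma num_u_num_v_bounds:
  assumes "\<bar>b\<bar> < l"
  shows "real (num_u l b N) \<le> real N * ((l + b) / 2)" "real N * ((l + b) / 2) < real (num_u l b N) + 1"
    "real (num_v l b N) \<le> real N * ((l - b) / 2)" "real N * ((l - b) / 2) < real (num_v l b N) + 1"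
proof -
  have h: "0 \<le> real N * ((l + b) / 2)" "0 \<le> real N * ((l - b) / 2)" using assms by auto
  show "real (num_u l b N) \<le> real N * ((l + b) / 2)" "real N * ((l + b) / 2) < real (num_u l b N) + 1"
    "real (num_v l b N) \<le> real N * ((l - b) / 2)" "real N * ((l - b) / 2) < real (num_v l b N) + 1"
    unfolding num_u_def num_v_def by (rule nat_floor_bounds[OF h(1)] nat_floor_bounds[OF h(2)])+
qed

text \<open>The path is cut at K columns and each stretch is bounded by the passage time of the
  rectangle it spans. The error w stems from freezing the weight, w' from rounding to the lattice,
  and \<eta> from the environment.\<close>

lemma path_weight_le_disc_fun:
  assumes l: "0 < l" and b: "\<bar>b\<bar> < l" and N: "1 \<le> N" and K: "1 \<le> K"
    and r: "path_rep N (num_u l b N) (num_v l b N) P \<pi>"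
    and y: "y \<in> Xset l b" "\<And>i. i \<le> num_u l b N + num_v l b N \<Longrightarrow> y (real i / real N) = snd (site N (P i))"
    and good: "good_env l b N \<eta> e" and \<eta>: "0 \<le> \<eta>"
    and \<alpha>0: "\<forall>p\<in>Qreg l b. 0 \<le> \<alpha> p" and A: "\<And>p. p \<in> Qreg l b \<Longrightarrow> \<alpha> p \<le> A"
    and w: "0 \<le> w" "0 \<le> w'"
    and osc: "\<And>p q. p \<in> Qreg l b \<Longrightarrow> q \<in> Qreg l b \<Longrightarrow> \<bar>fst p - fst q\<bar> \<le> d \<Longrightarrow> \<bar>snd p - snd q\<bar> \<le> d \<Longrightarrow> \<bar>\<alpha> p - \<alpha> q\<bar> \<le> w"
    and d: "l / real K + 4 / real N \<le> d"
    and g2u: "\<And>u v u' v'. \<lbrakk>u \<in> {0..l + 1}; v \<in> {0..l + 1}; u' \<in> {0..l + 1}; v' \<in> {0..l + 1}; \<bar>u - u'\<bar> \<le> 5 / real N; \<bar>v - v'\<bar> \<le> 5 / real N\<rbrakk>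
     \<Longrightarrow> \<bar>shape u v - shape u' v'\<bar> \<le> w'"
  shows "(\<Sum>i\<le>num_u l b N + num_v l b N. \<alpha> (site N (P i)) / real N * e (site N (P i)))
     \<le> disc_fun l \<alpha> K y + 2 * l * w + real K * (A + w) * (w' + \<eta>)"
proof -
  define T where "T = num_u l b N + num_v l b N"
  have N0: "0 < real N" "1 / real N \<le> 1" using N by auto
  have K0: "0 < real K" using K by simp
  have P: "lattice_path P T" "P 0 = (0, 0)" "P T = (num_u l b N, num_v l b N)" using r by (auto simp: path_rep_def T_def)
  have Pb: "fst (P i) \<le> num_u l b N" "snd (P i) \<le> num_v l b N" if "i \<le> T" for i
    using lattice_path_mono[OF P(1) that order_refl] P(3) by auto
  have Ps: "real (fst (P i)) + real (snd (P i)) = real i" if "i \<le> T" for i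
    using lattice_path_sum[OF P(1) that P(2)] by linarith
  have ptS: "site N (P i) \<in> SN l b N" if "i \<le> T" for i
    using Pb[OF that] unfolding SN_eq[OF N b] by (intro imageI) (cases "P i", auto)
  have ptQ: "site N (P i) \<in> Qreg l b" if "i \<le> T" for i using ptS[OF that] by (auto simp: SN_def)
  have e0: "0 \<le> e (site N (P i))" if "i \<le> T" for i using good ptS[OF that] by (auto simp: good_env_def)
  have fst_site: "fst (site N (P i)) = real i / real N" if "i \<le> T" for i using Ps[OF that] by (simp add: site_def)
  have TN: "real T \<le> real N * l" "real N * l < real T + 2"
    using num_u_num_v_bounds[OF b, of N] by (auto simp: T_def field_simps)
  define X where "X j = l * real j / real K" for j
  define z where "z j = nat \<lfloor>real N * X j\<rfloor>" for j
  \<comment> \<open>Both side lengths are rounded down, so N l may exceed T by almost 2 and the last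
    column can lie beyond the path; the minimum with T corrects this.\<close>
  define t where "t j = min (z j) T" for j
  have X0: "0 \<le> X j" for j using l by (simp add: X_def)
  have Xl: "X j \<le> l" if "j \<le> K" for j using l that K0 by (simp add: X_def pos_divide_le_eq)
  have Xd: "X (Suc j) - X j = l / real K" for j by (simp add: X_def diff_divide_distrib[symmetric] algebra_simps)
  have Xm: "X j \<le> X (Suc j)" for j using Xd[of j] l K0 by (smt (verit) divide_nonneg_pos)
  have fl: "real (z j) \<le> real N * X j" "real N * X j < real (z j) + 1" for j
    unfolding z_def using X0[of j] N0 by (intro nat_floor_bounds; simp)+
  have tT: "t j \<le> T" for j by (simp add: t_def)
  have t0: "t 0 = 0" by (simp add: t_def z_def X_def)
  have tm: "t j \<le> t (Suc j)" for j
  proof -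
    have "real N * X j \<le> real N * X (Suc j)" using Xm N0 by (intro mult_left_mono) auto
    then have "nat \<lfloor>real N * X j\<rfloor> \<le> nat \<lfloor>real N * X (Suc j)\<rfloor>" by (intro nat_mono floor_mono)
    then show ?thesis by (auto simp: t_def z_def)
  qed
  have tK: "t K = T"
  proof -
    have "X K = l" using K0 by (simp add: X_def)
    then have "real N * X K = real N * l" by simp
    then have "real T < real (z K) + 1" using fl(2)[of K] TN by linarith
    then show ?thesis by (simp add: t_def)
  qed
  have tX: "\<bar>real (t j) / real N - X j\<bar> \<le> 2 / real N" if "j \<le> K" for j
  proof -
    have "real N * X j \<le> real N * l" using Xl[OF that] N0 by (intro mult_left_mono) auto
    then have "\<bar>real (t j) - real N * X j\<bar> \<le> 2" using fl[of j] TN by (auto simp: t_def min_def)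
    moreover have "real (t j) / real N - X j = (real (t j) - real N * X j) / real N" using N0 by (simp add: field_simps)
    ultimately show ?thesis using N0 by (simp add: abs_divide divide_right_mono)
  qed
  have ylip: "\<bar>y s - y z\<bar> \<le> \<bar>s - z\<bar>" if "0 \<le> s" "s \<le> l" "0 \<le> z" "z \<le> l" for s z
    using Xset_dist[OF y(1), of s z] Xset_dist[OF y(1), of z s] that by (cases "s \<le> z") auto
  have il: "real i / real N \<le> l" if "i \<le> T" for i
  proof -
    have "real i \<le> real N * l" using that TN(1) by linarith
    then show ?thesis using N0 by (simp add: pos_divide_le_eq mult.commute)
  qed
  have iN: "2 / real N = 2 * (1 / real N)" "4 / real N = 4 * (1 / real N)" "0 \<le> 1 / real N" using N0 by auto
  define f where "f = (\<lambda>i j. e (site N (i, j)))"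
  define \<Delta> where "\<Delta> j = y (X (Suc j)) - y (X j)" for j
  have \<Delta>: "\<bar>\<Delta> j\<bar> \<le> l / real K" if "j < K" for j
    using Xset_dist[OF y(1) X0 Xm Xl, of j] that Xd[of j] by (simp add: \<Delta>_def)
  have Gr: "(X j, y (X j)) \<in> Qreg l b" if "j \<le> K" for j using that l by (intro Xset_graph[OF _ y(1)] X0 Xl) auto
  have block: "(\<Sum>i=t j..t (Suc j). \<alpha> (site N (P i)) / real N * e (site N (P i))) \<le> (\<alpha> (X j, y (X j)) + w) * (seg_shape (l / real K) (\<Delta> j) + (w' + \<eta>))"
    if j: "j < K" for j
  proof -
    let ?a = "\<alpha> (X j, y (X j))"
    have a0: "0 \<le> ?a" using \<alpha>0 Gr j by auto
    have "(\<Sum>i=t j..t (Suc j). \<alpha> (site N (P i)) / real N * e (site N (P i))) \<le> (\<Sum>i=t j..t (Suc j). (?a + w) / real N * f (fst (P i)) (snd (P i)))"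
    proof (rule sum_mono)
      fix i assume i: "i \<in> {t j..t (Suc j)}"
      then have iT: "i \<le> T" using tT[of "Suc j"] by simp
      have "real (t j) / real N \<le> real i / real N" "real i / real N \<le> real (t (Suc j)) / real N" using i N0 by (auto simp: divide_right_mono)
      then have x: "\<bar>real i / real N - X j\<bar> \<le> d"
        using tX[of j] tX[of "Suc j"] j Xd[of j] d iN(3) divide_nonneg_pos[OF less_imp_le[OF l] K0]
        unfolding iN(1,2) by linarith
      have "\<bar>y (real i / real N) - y (X j)\<bar> \<le> \<bar>real i / real N - X j\<bar>"
        using il[OF iT] X0 Xl j by (intro ylip) auto
      then have "\<bar>\<alpha> (site N (P i)) - ?a\<bar> \<le> w"
        using x y(2)[of i] iT j fst_site[OF iT] unfolding T_def[symmetric] by (intro osc ptQ Gr) auto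
      then have "\<alpha> (site N (P i)) / real N * e (site N (P i)) \<le> (?a + w) / real N * e (site N (P i))"
        using e0[OF iT] N0 by (intro mult_right_mono divide_right_mono) auto
      then show "\<alpha> (site N (P i)) / real N * e (site N (P i)) \<le> (?a + w) / real N * f (fst (P i)) (snd (P i))" by (simp add: f_def)
    qed
    also have "\<dots> = (?a + w) / real N * (\<Sum>i=t j..t (Suc j). f (fst (P i)) (snd (P i)))" by (simp add: sum_distrib_left)
    also have "\<dots> \<le> (?a + w) / real N * (real N * (seg_shape (l / real K) (\<Delta> j) + (w' + \<eta>)))"
    proof (rule mult_left_mono)
      define m where "m = fst (P (t (Suc j))) - fst (P (t j))"
      define n where "n = snd (P (t (Suc j))) - snd (P (t j))"
      have mono: "fst (P (t j)) \<le> fst (P (t (Suc j)))" "snd (P (t j)) \<le> snd (P (t (Suc j)))"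
        using lattice_path_mono[OF P(1) tm[of j] tT] by auto
      have mr: "real m = real (fst (P (t (Suc j)))) - real (fst (P (t j)))" "real n = real (snd (P (t (Suc j)))) - real (snd (P (t j)))"
        using mono by (auto simp: m_def n_def)
      have "(\<Sum>i=t j..t (Suc j). f (fst (P i)) (snd (P i))) \<le> lpp (shift f (fst (P (t j))) (snd (P (t j)))) m n"
        unfolding m_def n_def by (rule lattice_path_le_lpp[OF P(1) tm tT])
      also have "\<dots> \<le> shape (Suc m) (Suc n) + \<eta> * real N"
      proof -
        have "fst (P (t j)) + m \<le> num_u l b N" "snd (P (t j)) + n \<le> num_v l b N"
          using mono Pb[OF tT[of "Suc j"]] by (auto simp: m_def n_def)
        then have "\<bar>lpp (shift f (fst (P (t j))) (snd (P (t j)))) m n - shape (Suc m) (Suc n)\<bar> \<le> \<eta> * real N"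
          using good unfolding good_env_def f_def by blast
        then show ?thesis by linarith
      qed
      also have "shape (Suc m) (Suc n) = real N * shape (real (Suc m) / real N) (real (Suc n) / real N)"
        using shape_homogeneous[of "real N" "real (Suc m) / real N" "real (Suc n) / real N"] N0 by simp
      also have "shape (real (Suc m) / real N) (real (Suc n) / real N) \<le> seg_shape (l / real K) (\<Delta> j) + w'"
      proof -
        have yt: "y (real (t i) / real N) = (real (fst (P (t i))) - real (snd (P (t i)))) / real N" for i
          using y(2)[of "t i"] tT[of i] by (simp add: T_def[symmetric] site_def)
        have yx: "\<bar>y (real (t i) / real N) - y (X i)\<bar> \<le> 2 / real N" if "i \<le> K" for i
          using order_trans[OF ylip tX[OF that]] il[OF tT] X0 Xl[OF that] by auto
        have tt: "\<bar>(real (t (Suc j)) / real N - real (t j) / real N) - l / real K\<bar> \<le> 4 / real N"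
          using tX[of j] tX[of "Suc j"] j Xd[of j] by (simp add: abs_le_iff add_divide_distrib[symmetric])
        have yy: "\<bar>(y (real (t (Suc j)) / real N) - y (real (t j) / real N)) - \<Delta> j\<bar> \<le> 4 / real N"
          using yx[of j] yx[of "Suc j"] j by (simp add: \<Delta>_def abs_le_iff add_divide_distrib[symmetric])
        have td: "real (t i) / real N = (real (fst (P (t i))) + real (snd (P (t i)))) / real N" for i using Ps[OF tT, of i] by simp
        have s1: "2 * (real m / real N) = (real (t (Suc j)) / real N - real (t j) / real N) + (y (real (t (Suc j)) / real N) - y (real (t j) / real N))"
          unfolding yt unfolding td mr by (simp add: add_divide_distrib diff_divide_distrib)
        have s2: "2 * (real n / real N) = (real (t (Suc j)) / real N - real (t j) / real N) - (y (real (t (Suc j)) / real N) - y (real (t j) / real N))"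
          unfolding yt unfolding td mr by (simp add: add_divide_distrib diff_divide_distrib)
        have S: "real (Suc m) / real N = real m / real N + 1 / real N" "real (Suc n) / real N = real n / real N + 1 / real N"
          by (simp_all add: add_divide_distrib)
        have fN: "4 / real N = 4 * (1 / real N)" "5 / real N = 5 * (1 / real N)" by simp_all
        \<comment> \<open>Errors of 4 / N in both increments are averaged by the rotation and
          contribute 4 / N; the successor contributes one more 1 / N.\<close>
        have lin: "\<bar>a - L\<bar> \<le> 4 * x \<Longrightarrow> \<bar>c - D\<bar> \<le> 4 * x \<Longrightarrow> 2 * k = a + c \<Longrightarrow> 0 \<le> x \<Longrightarrow> \<bar>k + x - (L + D) / 2\<bar> \<le> 5 * x"
          "\<bar>a - L\<bar> \<le> 4 * x \<Longrightarrow> \<bar>c - D\<bar> \<le> 4 * x \<Longrightarrow> 2 * k = a - c \<Longrightarrow> 0 \<le> x \<Longrightarrow> \<bar>k + x - (L - D) / 2\<bar> \<le> 5 * x"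
          for a c k x L D :: real by (auto simp: abs_le_iff field_simps)
        have c1: "\<bar>real (Suc m) / real N - (l / real K + \<Delta> j) / 2\<bar> \<le> 5 / real N" "\<bar>real (Suc n) / real N - (l / real K - \<Delta> j) / 2\<bar> \<le> 5 / real N"
          unfolding fN S by (rule lin(1)[OF tt[unfolded fN] yy[unfolded fN] s1 iN(3)] lin(2)[OF tt[unfolded fN] yy[unfolded fN] s2 iN(3)])+
        have lK: "l / real K \<le> l" using K l by (simp add: divide_le_eq)
        have "m \<le> T" "n \<le> T" using Pb[OF tT[of "Suc j"]] by (auto simp: m_def n_def T_def)
        then have "real m / real N \<le> l" "real n / real N \<le> l" using il by auto
        then have "real (Suc m) / real N \<le> l + 1" "real (Suc n) / real N \<le> l + 1" unfolding S using N0(2) by linarith+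
        then have mem: "real (Suc m) / real N \<in> {0..l + 1}" "real (Suc n) / real N \<in> {0..l + 1}" by auto
        have "\<bar>shape (real (Suc m) / real N) (real (Suc n) / real N) - shape ((l / real K + \<Delta> j) / 2) ((l / real K - \<Delta> j) / 2)\<bar> \<le> w'"
          using \<Delta>[OF j] lK l by (intro g2u c1 mem) (auto simp: abs_le_iff)
        then show ?thesis unfolding seg_shape_eq_shape[OF \<Delta>[OF j]] by linarith
      qed
      finally show "(\<Sum>i=t j..t (Suc j). f (fst (P i)) (snd (P i))) \<le> real N * (seg_shape (l / real K) (\<Delta> j) + (w' + \<eta>))"
        using N0 by (simp add: algebra_simps)
      show "0 \<le> (?a + w) / real N" using a0 w N0 by simp
    qed
    also have "\<dots> = (?a + w) * (seg_shape (l / real K) (\<Delta> j) + (w' + \<eta>))" using N0 by simp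
    finally show ?thesis .
  qed
  have "(\<Sum>i\<le>T. \<alpha> (site N (P i)) / real N * e (site N (P i))) \<le> (\<Sum>j<K. \<Sum>i=t j..t (Suc j). \<alpha> (site N (P i)) / real N * e (site N (P i)))"
    unfolding tK[symmetric] using K tT \<alpha>0 ptQ e0 by (intro sum_le_sum_blocks t0 tm) (auto simp: tK)
  also have "\<dots> \<le> (\<Sum>j<K. \<alpha> (X j, y (X j)) * seg_shape (l / real K) (\<Delta> j) + w * (2 * (l / real K)) + (A + w) * (w' + \<eta>))"
  proof (rule sum_mono)
    fix j assume "j \<in> {..<K}"
    then have j: "j < K" by simp
    have "w * seg_shape (l / real K) (\<Delta> j) \<le> w * (2 * (l / real K))" using w l by (intro mult_left_mono seg_shape_le) auto
    moreover have "(\<alpha> (X j, y (X j)) + w) * (w' + \<eta>) \<le> (A + w) * (w' + \<eta>)"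
      using A[OF Gr] j w \<eta> by (intro mult_right_mono) auto
    ultimately show "(\<Sum>i=t j..t (Suc j). \<alpha> (site N (P i)) / real N * e (site N (P i))) \<le> \<alpha> (X j, y (X j)) * seg_shape (l / real K) (\<Delta> j) + w * (2 * (l / real K)) + (A + w) * (w' + \<eta>)"
      using block[OF j] unfolding distrib_left distrib_right by linarith
  qed
  also have "\<dots> = disc_fun l \<alpha> K y + 2 * l * w + real K * (A + w) * (w' + \<eta>)"
    using K0 by (simp add: sum.distrib disc_fun_def X_def \<Delta>_def)
  finally show ?thesis by (simp only: T_def)
qed

text \<open>The converse estimate: points on the graph are rounded to lattice sites, and optimal
  paths between consecutive sites are joined by superadditivity.\<close>

lemma disc_fun_le_lpp:
  assumes l: "0 < l" and b: "\<bar>b\<bar> < l" and N: "1 \<le> N" and K: "1 \<le> K"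
    and y: "y \<in> Xset l b"
    and good: "good_env l b N \<eta> e" and \<eta>: "0 \<le> \<eta>"
    and \<alpha>0: "\<forall>p\<in>Qreg l b. 0 \<le> \<alpha> p" and A: "0 \<le> A" "\<And>p. p \<in> Qreg l b \<Longrightarrow> \<alpha> p \<le> A"
    and w: "0 \<le> w" "0 \<le> w'"
    and osc: "\<And>p q. p \<in> Qreg l b \<Longrightarrow> q \<in> Qreg l b \<Longrightarrow> \<bar>fst p - fst q\<bar> \<le> d \<Longrightarrow> \<bar>snd p - snd q\<bar> \<le> d \<Longrightarrow> \<bar>\<alpha> p - \<alpha> q\<bar> \<le> w"
    and d: "l / real K + 4 / real N \<le> d"
    and g2u: "\<And>u v u' v'. \<lbrakk>u \<in> {0..l + 1}; v \<in> {0..l + 1}; u' \<in> {0..l + 1}; v' \<in> {0..l + 1}; \<bar>u - u'\<bar> \<le> 5 / real N; \<bar>v - v'\<bar> \<le> 5 / real N\<rbrakk>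
     \<Longrightarrow> \<bar>shape u v - shape u' v'\<bar> \<le> w'"
  shows "disc_fun l \<alpha> K y - 2 * l * w - real K * A * (w' + \<eta>) - real K * A * (4 / real N + \<eta>)
     \<le> lpp (\<lambda>i j. \<alpha> (site N (i, j)) / real N * e (site N (i, j))) (num_u l b N) (num_v l b N)"
proof -
  have N0: "0 < real N" "1 / real N \<le> 1" using N by auto
  have K0: "0 < real K" using K by simp
  have iN: "4 / real N = 4 * (1 / real N)" "5 / real N = 5 * (1 / real N)" "0 \<le> 1 / real N" using N0 by auto
  define X where "X j = l * real j / real K" for j
  have X0: "0 \<le> X j" for j using l by (simp add: X_def)
  have Xl: "X j \<le> l" if "j \<le> K" for j using l that K0 by (simp add: X_def pos_divide_le_eq)
  have Xd: "X (Suc j) - X j = l / real K" for j by (simp add: X_def diff_divide_distrib[symmetric] algebra_simps)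
  have lK: "0 \<le> l / real K" "l / real K \<le> l" using K l by (auto simp: divide_le_eq)
  have Xm: "X j \<le> X (Suc j)" for j using Xd[of j] lK by linarith
  define \<Delta> where "\<Delta> j = y (X (Suc j)) - y (X j)" for j
  have \<Delta>: "\<bar>\<Delta> j\<bar> \<le> l / real K" if "j < K" for j
    using Xset_dist[OF y X0 Xm Xl, of j] that Xd[of j] by (simp add: \<Delta>_def)
  have Gr: "(X j, y (X j)) \<in> Qreg l b" if "j \<le> K" for j using that l by (intro Xset_graph[OF _ y] X0 Xl) auto
  define p where "p j = (X j + y (X j)) / 2" for j
  define q where "q j = (X j - y (X j)) / 2" for j
  have pq0: "0 \<le> p j" "0 \<le> q j" if "j \<le> K" for j using Gr[OF that] by (auto simp: p_def q_def Qreg_iff)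
  \<comment> \<open>Rounding down is done in rotated coordinates. There the curve is monotone in
    both, so the sites form an increasing chain; it starts at the origin and ends exactly at the
    rightmost site.\<close>
  define a where "a j = nat \<lfloor>real N * p j\<rfloor>" for j
  define c where "c j = nat \<lfloor>real N * q j\<rfloor>" for j
  have fl: "real (a j) \<le> real N * p j" "real N * p j < real (a j) + 1" "real (c j) \<le> real N * q j" "real N * q j < real (c j) + 1" if "j \<le> K" for j
    unfolding a_def c_def using pq0[OF that] by (intro nat_floor_bounds; simp)+
  have bd: "real (a j) / real N \<le> p j" "p j \<le> real (a j) / real N + 1 / real N" "real (c j) / real N \<le> q j" "q j \<le> real (c j) / real N + 1 / real N" if "j \<le> K" for j
    using fl[OF that] N0(1) by (simp_all add: add_divide_distrib[symmetric] pos_divide_le_eq pos_le_divide_eq mult.commute)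
  have pd: "p (Suc j) - p j = (l / real K + \<Delta> j) / 2" "q (Suc j) - q j = (l / real K - \<Delta> j) / 2" for j
    unfolding Xd[symmetric, of j] \<Delta>_def p_def q_def by (simp_all add: field_simps)
  have pqm: "p j \<le> p (Suc j)" "q j \<le> q (Suc j)" if "j < K" for j
    using pd[of j] \<Delta>[OF that] by (auto simp: abs_le_iff)
  have am: "a j \<le> a (Suc j)" "c j \<le> c (Suc j)" if "j < K" for j
    unfolding a_def c_def using pqm[OF that] N0 by (intro nat_mono floor_mono mult_left_mono; simp)+
  have XK: "X K = l" using K0 by (simp add: X_def)
  have aK: "a K = num_u l b N" "c K = num_v l b N"
    using y by (simp_all add: a_def c_def p_def q_def XK num_u_def num_v_def Xset_def)
  have a0: "a 0 = 0" "c 0 = 0" using y by (simp_all add: a_def c_def p_def q_def X_def Xset_def)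
  have aN: "a j \<le> num_u l b N \<and> c j \<le> num_v l b N" if "j \<le> K" for j
    using that
  proof (induction rule: inc_induct)
    case base then show ?case by (simp add: aK)
  next
    case (step j) then show ?case using am[of j] by simp
  qed
  define fE where "fE = (\<lambda>i j. e (site N (i, j)))"
  define fW where "fW = (\<lambda>i j. \<alpha> (site N (i, j)) / real N * fE i j)"
  have ptS: "site N (i, j) \<in> SN l b N" if "i \<le> num_u l b N" "j \<le> num_v l b N" for i j
    using that unfolding SN_eq[OF N b] by (intro imageI) auto
  have ptQ: "site N (i, j) \<in> Qreg l b" if "i \<le> num_u l b N" "j \<le> num_v l b N" for i j using ptS[OF that] by (auto simp: SN_def)
  have e0: "0 \<le> fE i j" if "i \<le> num_u l b N" "j \<le> num_v l b N" for i j using good ptS[OF that] by (auto simp: good_env_def fE_def)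
  have tail: "\<bar>lpp (shift fE i j) m n - shape (Suc m) (Suc n)\<bar> \<le> \<eta> * real N" if "i + m \<le> num_u l b N" "j + n \<le> num_v l b N" for i j m n
    using good that unfolding good_env_def fE_def by blast
  define m where "m j = a (Suc j) - a j" for j
  define n where "n j = c (Suc j) - c j" for j
  have chain: "(\<Sum>j<J. lpp (shift fW (a j) (c j)) (m j) (n j) - fW (a j) (c j)) \<le> lpp fW (a J) (c J)" if "J \<le> K" for J
    using that
  proof (induction J)
    case 0
    have "0 \<le> fW 0 0" unfolding fW_def using e0[of 0 0] \<alpha>0 ptQ[of 0 0] N0 by (intro mult_nonneg_nonneg divide_nonneg_pos) auto
    then show ?case by (simp add: a0)
  next
    case (Suc J)
    have "a J + m J = a (Suc J)" "c J + n J = c (Suc J)" using am[of J] Suc.prems by (auto simp: m_def n_def)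
    then have "lpp fW (a J) (c J) + lpp (shift fW (a J) (c J)) (m J) (n J) - fW (a J) (c J) \<le> lpp fW (a (Suc J)) (c (Suc J))"
      using lpp_superadditive[of fW "a J" "c J" "m J" "n J"] by simp
    then show ?case using Suc by simp
  qed
  have block: "\<alpha> (X j, y (X j)) * seg_shape (l / real K) (\<Delta> j) - w * (2 * (l / real K)) - A * (w' + \<eta>) \<le> lpp (shift fW (a j) (c j)) (m j) (n j)"
    and site: "fW (a j) (c j) \<le> A * (4 / real N + \<eta>)" if j: "j < K" for j
  proof -
    have mn: "a j + m j = a (Suc j)" "c j + n j = c (Suc j)" using am[OF j] by (auto simp: m_def n_def)
    have le: "a j + m j \<le> num_u l b N" "c j + n j \<le> num_v l b N" using aN[of "Suc j"] j mn by auto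
    let ?al = "\<alpha> (X j, y (X j))"
    \<comment> \<open>A lower bound for the weight on the whole block; the truncation at 0 keeps it
      admissible as a scaling factor.\<close>
    let ?p = "max 0 (?al - w)"
    let ?g = "seg_shape (l / real K) (\<Delta> j)"
    have al: "0 \<le> ?al" "?al \<le> A" using \<alpha>0 A(2) Gr[of j] j by auto
    have g0: "0 \<le> ?g" "?g \<le> 2 * (l / real K)" using \<Delta>[OF j] lK by (auto intro: seg_shape_nonneg seg_shape_le simp del: times_divide_eq_right)
    have "?p / real N * lpp (shift fE (a j) (c j)) (m j) (n j) = lpp (\<lambda>i k. ?p / real N * shift fE (a j) (c j) i k) (m j) (n j)"
      using N0 by (intro lpp_scale[symmetric]) auto
    also have "\<dots> \<le> lpp (shift fW (a j) (c j)) (m j) (n j)"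
    proof (rule lpp_mono)
      fix i k assume ik: "i \<le> m j" "k \<le> n j"
      let ?i = "a j + i" and ?k = "c j + k"
      have ii: "a j \<le> ?i" "?i \<le> a (Suc j)" "c j \<le> ?k" "?k \<le> c (Suc j)" using ik mn by auto
      then have iN': "?i \<le> num_u l b N" "?k \<le> num_v l b N" using le mn by linarith+
      have r: "real (a j) / real N \<le> real ?i / real N" "real ?i / real N \<le> real (a (Suc j)) / real N"
        "real (c j) / real N \<le> real ?k / real N" "real ?k / real N \<le> real (c (Suc j)) / real N"
        using ii by (auto intro!: divide_right_mono simp del: of_nat_add)
      have i1: "p j - 1 / real N \<le> real ?i / real N" "real ?i / real N \<le> p j + (l / real K + \<Delta> j) / 2"
         "q j - 1 / real N \<le> real ?k / real N" "real ?k / real N \<le> q j + (l / real K - \<Delta> j) / 2"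
        using r bd[of j] bd[of "Suc j"] j pd[of j] by linarith+
      have fp: "fst (site N (?i, ?k)) = real ?i / real N + real ?k / real N" "snd (site N (?i, ?k)) = real ?i / real N - real ?k / real N"
        by (simp_all add: site_def add_divide_distrib diff_divide_distrib)
      have xy: "X j = p j + q j" "y (X j) = p j - q j" by (simp_all add: p_def q_def field_simps)
      have D: "\<bar>\<Delta> j\<bar> \<le> l / real K" by (rule \<Delta>[OF j])
      have lin: "u - x \<le> s \<Longrightarrow> s \<le> u + (L + D) / 2 \<Longrightarrow> v - x \<le> t \<Longrightarrow> t \<le> v + (L - D) / 2 \<Longrightarrow> \<bar>D\<bar> \<le> L \<Longrightarrow> L + 4 * x \<le> d \<Longrightarrow> 0 \<le> x \<Longrightarrow> \<bar>s + t - (u + v)\<bar> \<le> d"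
        "u - x \<le> s \<Longrightarrow> s \<le> u + (L + D) / 2 \<Longrightarrow> v - x \<le> t \<Longrightarrow> t \<le> v + (L - D) / 2 \<Longrightarrow> \<bar>D\<bar> \<le> L \<Longrightarrow> L + 4 * x \<le> d \<Longrightarrow> 0 \<le> x \<Longrightarrow> \<bar>s - t - (u - v)\<bar> \<le> d"
        for u v s t x L D d :: real by (auto simp: abs_le_iff field_simps)
      have "\<bar>\<alpha> (site N (?i, ?k)) - ?al\<bar> \<le> w"
      proof (rule osc[OF ptQ[OF iN'] Gr])
        show "\<bar>fst (site N (?i, ?k)) - fst (X j, y (X j))\<bar> \<le> d"
          unfolding fp fst_conv xy(1) by (rule lin(1)[OF i1 D d[unfolded iN(1)] iN(3)])
        show "\<bar>snd (site N (?i, ?k)) - snd (X j, y (X j))\<bar> \<le> d"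
          unfolding fp snd_conv xy(2) by (rule lin(2)[OF i1 D d[unfolded iN(1)] iN(3)])
      qed (use j in simp)
      moreover have "0 \<le> \<alpha> (site N (?i, ?k))" using \<alpha>0 ptQ[OF iN'] by auto
      ultimately have "?p \<le> \<alpha> (site N (?i, ?k))" by simp
      then have "?p / real N * fE ?i ?k \<le> \<alpha> (site N (?i, ?k)) / real N * fE ?i ?k"
        using e0[OF iN'] N0 by (intro mult_right_mono divide_right_mono) auto
      then show "?p / real N * shift fE (a j) (c j) i k \<le> shift fW (a j) (c j) i k" by (simp add: shift_def fW_def)
    qed
    finally have lower: "?p / real N * lpp (shift fE (a j) (c j)) (m j) (n j) \<le> lpp (shift fW (a j) (c j)) (m j) (n j)" .
    have LE: "real N * (?g - (w' + \<eta>)) \<le> lpp (shift fE (a j) (c j)) (m j) (n j)"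
    proof -
      have mr: "real (m j) = real (a (Suc j)) - real (a j)" "real (n j) = real (c (Suc j)) - real (c j)"
        using am[OF j] by (auto simp: m_def n_def)
      have S: "real (Suc (m j)) / real N = real (a (Suc j)) / real N - real (a j) / real N + 1 / real N"
        "real (Suc (n j)) / real N = real (c (Suc j)) / real N - real (c j) / real N + 1 / real N"
        by (simp_all add: mr add_divide_distrib diff_divide_distrib)
      have lin: "s \<le> u \<Longrightarrow> u \<le> s + x \<Longrightarrow> s' \<le> u' \<Longrightarrow> u' \<le> s' + x \<Longrightarrow> u' - u = L \<Longrightarrow> 0 \<le> x \<Longrightarrow> \<bar>s' - s + x - L\<bar> \<le> 5 * x"
        for s s' u u' x L :: real by linarith
      have c1: "\<bar>real (Suc (m j)) / real N - (l / real K + \<Delta> j) / 2\<bar> \<le> 5 / real N" "\<bar>real (Suc (n j)) / real N - (l / real K - \<Delta> j) / 2\<bar> \<le> 5 / real N"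
        unfolding S iN(2) by (rule lin[OF bd(1,2)[OF less_imp_le[OF j]] bd(1,2)[OF Suc_leI[OF j]] pd(1) iN(3)]
          lin[OF bd(3,4)[OF less_imp_le[OF j]] bd(3,4)[OF Suc_leI[OF j]] pd(2) iN(3)])+
      have "real (m j) / real N \<le> l" "real (n j) / real N \<le> l"
      proof -
        have "p (Suc j) \<le> l" "q (Suc j) \<le> l" using Gr[of "Suc j"] j b by (auto simp: p_def q_def Qreg_iff)
        moreover have "0 \<le> real (a j) / real N" "0 \<le> real (c j) / real N" using N0 by auto
        ultimately show "real (m j) / real N \<le> l" "real (n j) / real N \<le> l"
          using bd[of "Suc j"] j unfolding mr diff_divide_distrib by linarith+
      qed
      moreover have "real (Suc i) / real N = real i / real N + 1 / real N" for i by (simp add: add_divide_distrib)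
      ultimately have "real (Suc (m j)) / real N \<le> l + 1" "real (Suc (n j)) / real N \<le> l + 1" using N0(2) by (metis add_mono)+
      then have mem: "real (Suc (m j)) / real N \<in> {0..l + 1}" "real (Suc (n j)) / real N \<in> {0..l + 1}" by auto
      have "\<bar>shape (real (Suc (m j)) / real N) (real (Suc (n j)) / real N) - shape ((l / real K + \<Delta> j) / 2) ((l / real K - \<Delta> j) / 2)\<bar> \<le> w'"
        using \<Delta>[OF j] lK l by (intro g2u c1 mem) (auto simp: abs_le_iff)
      then have "?g - w' \<le> shape (real (Suc (m j)) / real N) (real (Suc (n j)) / real N)" unfolding seg_shape_eq_shape[OF \<Delta>[OF j]] by linarith
      then have "real N * (?g - w') \<le> real N * shape (real (Suc (m j)) / real N) (real (Suc (n j)) / real N)" using N0 by (intro mult_left_mono) auto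
      also have "\<dots> = shape (Suc (m j)) (Suc (n j))"
        using shape_homogeneous[of "real N" "real (Suc (m j)) / real N" "real (Suc (n j)) / real N"] N0 by simp
      also have "\<dots> \<le> lpp (shift fE (a j) (c j)) (m j) (n j) + \<eta> * real N" using tail[OF le] by linarith
      finally show ?thesis by (simp add: algebra_simps)
    qed
    have "?p * (?g - (w' + \<eta>)) = ?p / real N * (real N * (?g - (w' + \<eta>)))" using N0 by simp
    also have "\<dots> \<le> ?p / real N * lpp (shift fE (a j) (c j)) (m j) (n j)" using LE N0 by (intro mult_left_mono) auto
    also note lower
    finally have 1: "?p * ?g - ?p * (w' + \<eta>) \<le> lpp (shift fW (a j) (c j)) (m j) (n j)" by (simp add: right_diff_distrib)
    have "(?al - w) * ?g \<le> ?p * ?g" using g0 by (intro mult_right_mono) auto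
    moreover have "?p * (w' + \<eta>) \<le> A * (w' + \<eta>)" using al A w \<eta> by (intro mult_right_mono) auto
    moreover have "w * ?g \<le> w * (2 * (l / real K))" using g0 w by (intro mult_left_mono) auto
    ultimately show "?al * ?g - w * (2 * (l / real K)) - A * (w' + \<eta>) \<le> lpp (shift fW (a j) (c j)) (m j) (n j)"
      using 1 unfolding left_diff_distrib by linarith
    have ajN: "a j \<le> num_u l b N" "c j \<le> num_v l b N" using aN[of j] j by auto
    \<comment> \<open>A joint between two blocks is counted twice. Its weight is the passage time of
      a one-site rectangle, whose shape value is 4, so the correction is small.\<close>
    have "shape 1 1 = 4" by (simp add: shape_def)
    then have "fE (a j) (c j) \<le> 4 + \<eta> * real N" using tail[of "a j" 0 "c j" 0] ajN by (simp add: shift_def abs_le_iff)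
    then have "\<alpha> (site N (a j, c j)) / real N * fE (a j) (c j) \<le> A / real N * (4 + \<eta> * real N)"
      using A ptQ[OF ajN] e0[OF ajN] N0 by (intro mult_mono divide_right_mono) auto
    also have "\<dots> = A * (4 / real N + \<eta>)" using N0 by (simp add: field_simps)
    finally show "fW (a j) (c j) \<le> A * (4 / real N + \<eta>)" by (simp add: fW_def)
  qed
  have "disc_fun l \<alpha> K y - 2 * l * w - real K * A * (w' + \<eta>) - real K * A * (4 / real N + \<eta>)
    = (\<Sum>j<K. (\<alpha> (X j, y (X j)) * seg_shape (l / real K) (\<Delta> j) - w * (2 * (l / real K)) - A * (w' + \<eta>)) - A * (4 / real N + \<eta>))"
    using K0 by (simp add: sum_subtractf disc_fun_def X_def \<Delta>_def)
  also have "\<dots> \<le> (\<Sum>j<K. lpp (shift fW (a j) (c j)) (m j) (n j) - fW (a j) (c j))"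
    by (intro sum_mono diff_mono block site) auto
  also have "\<dots> \<le> lpp fW (num_u l b N) (num_v l b N)" using chain[OF order_refl] by (simp add: aK)
  finally show ?thesis by (simp add: fW_def fE_def)
qed

text \<open>The geodesic has weight at least the partition sum of \<open>ys\<close>, up to small
  errors, and at most that of its interpolating curve. The latter sum thus misses the maximum by
  less than \<kappa>, and the gap keeps the curve near \<open>ys\<close>. The gap is used at
  \<delta> / 2, leaving room for the term 2 / N of the interpolation.\<close>

lemma geodesic_close:
  assumes l: "0 < l" and b: "\<bar>b\<bar> < l" and \<alpha>: "continuous_on (Qreg l b) \<alpha>" and \<alpha>0: "\<forall>p\<in>Qreg l b. 0 \<le> \<alpha> p"
    and ys: "ys \<in> Xset l b"
    and uniq: "\<And>y. y \<in> Xset l b \<Longrightarrow> Gfun l \<alpha> ys \<le> Gfun l \<alpha> y \<Longrightarrow> \<forall>x\<in>{0..l}. y x = ys x"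
    and \<delta>: "0 < \<delta>"
  shows "\<exists>\<eta> N0. 0 < \<eta> \<and> 1 \<le> N0 \<and> (\<forall>N \<omega> \<pi>. N0 \<le> N \<longrightarrow> good_env l b N \<eta> (\<lambda>p. E N p \<omega>) \<longrightarrow> is_geodesic l b \<alpha> E N \<omega> \<pi> \<longrightarrow> supdist N \<pi> ys < \<delta>)"
proof -
  let ?s = "Gfun l \<alpha> ys"
  obtain \<kappa> k0 where \<kappa>: "0 < \<kappa>" and gap: "\<And>k y x. k0 \<le> k \<Longrightarrow> y \<in> Xset l b \<Longrightarrow> x \<in> {0..l} \<Longrightarrow> \<delta> / 2 \<le> \<bar>y x - ys x\<bar> \<Longrightarrow> disc_fun l \<alpha> (2 ^ k) y \<le> ?s - \<kappa>"
    using disc_fun_gap[OF l \<alpha> \<alpha>0 uniq half_gt_zero[OF \<delta>]] by blast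
  obtain A where A: "0 < A" "\<And>p. p \<in> Qreg l b \<Longrightarrow> \<alpha> p \<le> A" using Qreg_bounded[OF \<alpha>] by blast
  \<comment> \<open>The oscillation allowance enters both comparisons as \<open>2 * l * w\<close>,
    here at most \<kappa> / 16. Order of choices: w and its modulus d, the level k, the allowance z,
    and finally N.\<close>
  define w where "w = min 1 (\<kappa> / (32 * l))"
  have w: "0 < w" "w \<le> 1" using \<kappa> l by (auto simp: w_def)
  have wl: "2 * l * w \<le> \<kappa> / 16"
  proof -
    have "w \<le> \<kappa> / (32 * l)" by (simp add: w_def)
    then show ?thesis using l by (simp add: field_simps)
  qed
  obtain d where d: "0 < d" and osc: "\<And>p q. p \<in> Qreg l b \<Longrightarrow> q \<in> Qreg l b \<Longrightarrow> \<bar>fst p - fst q\<bar> \<le> d \<Longrightarrow> \<bar>snd p - snd q\<bar> \<le> d \<Longrightarrow> \<bar>\<alpha> p - \<alpha> q\<bar> \<le> w"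
    using continuous_on_Qreg_oscillation[OF \<alpha> w(1)] by blast
  have "(\<lambda>k. l / 2 ^ k) \<longlonglongrightarrow> 0" by (rule LIMSEQ_divide_realpow_zero) simp
  then have ev1: "\<forall>\<^sub>F k in sequentially. l / 2 ^ k < d / 2" using d by (intro order_tendstoD(2)) auto
  have ev2: "\<forall>\<^sub>F k in sequentially. ?s - \<kappa> / 4 < disc_fun l \<alpha> (2 ^ k) ys"
    using \<kappa> by (intro order_tendstoD(1)[OF disc_fun_pow2_tendsto[OF l ys \<alpha>]]) auto
  have "\<forall>\<^sub>F k in sequentially. l / 2 ^ k < d / 2 \<and> ?s - \<kappa> / 4 < disc_fun l \<alpha> (2 ^ k) ys \<and> k0 \<le> k"
    using ev1 ev2 eventually_ge_at_top[of k0] by eventually_elim auto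
  then obtain k where k: "l / 2 ^ k < d / 2" "?s - \<kappa> / 4 < disc_fun l \<alpha> (2 ^ k) ys" "k0 \<le> k"
    by (auto simp: eventually_sequentially)
  define K :: nat where "K = 2 ^ k"
  have K: "1 \<le> K" "real K = 2 ^ k" by (auto simp: K_def)
  have KA: "0 < real K * (A + 1)" using A K by auto
  \<comment> \<open>One allowance for rounding and environment alike. It is divided by the number K
    of blocks because each block incurs it, so it can be chosen only after the level.\<close>
  define z where "z = \<kappa> / 32 / (real K * (A + 1))"
  have z: "0 < z" unfolding z_def using \<kappa> KA by (intro divide_pos_pos) auto
  have zK: "real K * (A + 1) * z = \<kappa> / 32"
  proof -
    have "B * (\<kappa> / 32 / B) = \<kappa> / 32" if "0 < B" for B :: real using that by simp
    from this[OF KA] show ?thesis by (simp only: z_def)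
  qed
  obtain d' where d': "0 < d'" and g2u: "\<And>u v u' v'. \<lbrakk>u \<in> {0..l + 1}; v \<in> {0..l + 1}; u' \<in> {0..l + 1}; v' \<in> {0..l + 1}; \<bar>u - u'\<bar> \<le> d'; \<bar>v - v'\<bar> \<le> d'\<rbrakk>
     \<Longrightarrow> \<bar>shape u v - shape u' v'\<bar> \<le> z" using shape_uniform[OF z, of "l + 1"] by blast
  have small: "\<forall>\<^sub>F N in sequentially. c / real N < x" if "0 < x" for c x :: real
    using that by (intro order_tendstoD(2)[OF lim_const_over_n]) auto
  have "\<forall>\<^sub>F N in sequentially. 4 / real N < d / 2 \<and> 5 / real N < d' \<and> 4 / real N < z \<and> 2 / real N < \<delta> / 2 \<and> 1 \<le> N"
    using small[of "d / 2" 4] small[of d' 5] small[of z 4] small[of "\<delta> / 2" 2] eventually_ge_at_top[of 1] d d' z \<delta>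
    by (auto intro!: eventually_conj)
  then obtain N0 where N0: "\<And>N. N0 \<le> N \<Longrightarrow> 4 / real N < d / 2 \<and> 5 / real N < d' \<and> 4 / real N < z \<and> 2 / real N < \<delta> / 2 \<and> 1 \<le> N"
    by (auto simp: eventually_sequentially)
  show ?thesis
  proof (intro exI conjI allI impI)
    show "0 < z" by (rule z)
    show "1 \<le> max 1 N0" by simp
    fix N \<omega> \<pi> assume "max 1 N0 \<le> N" and good: "good_env l b N z (\<lambda>p. E N p \<omega>)" and geo: "is_geodesic l b \<alpha> E N \<omega> \<pi>"
    then have N: "4 / real N < d / 2" "5 / real N < d'" "4 / real N < z" "2 / real N < \<delta> / 2" "1 \<le> N" using N0[of N] by auto
    let ?T = "num_u l b N + num_v l b N"
    have dd: "l / real K + 4 / real N \<le> d" using N(1) k(1) unfolding K(2) by linarith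
    have g2u': "\<bar>shape u v - shape u' v'\<bar> \<le> z" if "u \<in> {0..l + 1}" "v \<in> {0..l + 1}" "u' \<in> {0..l + 1}" "v' \<in> {0..l + 1}" "\<bar>u - u'\<bar> \<le> 5 / real N" "\<bar>v - v'\<bar> \<le> 5 / real N" for u v u' v'
      using that N by (intro g2u) auto
    obtain P where P: "path_rep N (num_u l b N) (num_v l b N) P \<pi>"
      using paths_rep[OF N(5) b] geo by (auto simp: is_geodesic_def)
    obtain y where y: "y \<in> Xset l b" "\<And>i. i \<le> ?T \<Longrightarrow> y (real i / real N) = snd (site N (P i))"
      using path_rep_Xset[OF l b N(5) P] by blast
    have up: "weight \<alpha> E N \<omega> \<pi> \<le> disc_fun l \<alpha> K y + 2 * l * w + real K * (A + w) * (z + z)"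
      unfolding path_rep_weight[OF P]
      using path_weight_le_disc_fun[OF l b N(5) K(1) P y good less_imp_le[OF z] \<alpha>0 A(2) less_imp_le[OF w(1)] less_imp_le[OF z] osc dd g2u']
      by simp
    have low: "disc_fun l \<alpha> K ys - 2 * l * w - real K * A * (z + z) - real K * A * (4 / real N + z)
      \<le> lpp (\<lambda>i j. \<alpha> (site N (i, j)) / real N * E N (site N (i, j)) \<omega>) (num_u l b N) (num_v l b N)"
      using disc_fun_le_lpp[OF l b N(5) K(1) ys good less_imp_le[OF z] \<alpha>0 less_imp_le[OF A(1)] A(2) less_imp_le[OF w(1)] less_imp_le[OF z] osc dd g2u']
      by simp
    obtain P' where P': "lattice_path P' ?T" "P' 0 = (0, 0)" "P' ?T = (num_u l b N, num_v l b N)"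
      "(\<Sum>i\<le>?T. (\<lambda>i j. \<alpha> (site N (i, j)) / real N * E N (site N (i, j)) \<omega>) (fst (P' i)) (snd (P' i))) = lpp (\<lambda>i j. \<alpha> (site N (i, j)) / real N * E N (site N (i, j)) \<omega>) (num_u l b N) (num_v l b N)"
      using lpp_attained[of "num_u l b N" "num_v l b N" "\<lambda>i j. \<alpha> (site N (i, j)) / real N * E N (site N (i, j)) \<omega>"] by blast
    define \<pi>' where "\<pi>' = map (\<lambda>i. site N (P' i)) [0..<Suc ?T]"
    have r': "path_rep N (num_u l b N) (num_v l b N) P' \<pi>'" using P' by (simp add: path_rep_def \<pi>'_def)
    have "weight \<alpha> E N \<omega> \<pi>' \<le> weight \<alpha> E N \<omega> \<pi>"
      using geo path_rep_in_paths[OF N(5) b r'] by (auto simp: is_geodesic_def)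
    then have le: "lpp (\<lambda>i j. \<alpha> (site N (i, j)) / real N * E N (site N (i, j)) \<omega>) (num_u l b N) (num_v l b N) \<le> weight \<alpha> E N \<omega> \<pi>"
      using P'(4) by (simp add: path_rep_weight[OF r'])
    have B1: "real K * (A + w) * (z + z) \<le> \<kappa> / 16"
    proof -
      have "real K * (A + w) * z \<le> real K * (A + 1) * z" using w K z by (intro mult_right_mono mult_left_mono) auto
      moreover have "real K * (A + w) * (z + z) = 2 * (real K * (A + w) * z)" by simp
      ultimately show ?thesis using zK by linarith
    qed
    have B2: "real K * A * z \<le> \<kappa> / 32"
    proof -
      have "real K * A * z \<le> real K * (A + 1) * z" using K z by (intro mult_right_mono mult_left_mono) auto
      then show ?thesis unfolding zK .
    qed
    have B3: "real K * A * (4 / real N) \<le> real K * A * z" using N A K by (intro mult_left_mono) auto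
    \<comment> \<open>The losses sum to at most \<kappa> (1/4 + 1/8 + 1/8 + 1/16): discretisation of
      \<open>ys\<close>, oscillation twice, four lower-bound terms, one upper-bound term.\<close>
    have lin: "t \<le> f + W + a \<Longrightarrow> f' - W - (c + c) - (c' + c) \<le> L \<Longrightarrow> L \<le> t \<Longrightarrow> a \<le> \<kappa> / 16 \<Longrightarrow> c \<le> \<kappa> / 32 \<Longrightarrow> c' \<le> c \<Longrightarrow>
        s - \<kappa> / 4 < f' \<Longrightarrow> W \<le> \<kappa> / 16 \<Longrightarrow> s - \<kappa> < f" for t f f' W a c c' L s :: real
      using \<kappa> by linarith
    have far: "?s - \<kappa> < disc_fun l \<alpha> K y"
      by (rule lin[OF up low[unfolded distrib_left] le B1 B2 B3 k(2)[folded K_def] wl])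
    have close: "\<bar>y x - ys x\<bar> < \<delta> / 2" if "x \<in> {0..l}" for x
      using gap[OF k(3) y(1) that] far unfolding K_def by (smt (verit))
    have iT: "real i / real N \<in> {0..l}" if "i \<le> ?T" for i
    proof -
      have "real i \<le> real N * l" using that num_u_num_v_bounds[OF b, of N] by (simp add: field_simps)
      then show ?thesis using N(5) by (simp add: pos_divide_le_eq mult.commute)
    qed
    have "supdist N \<pi> ys \<le> \<delta> / 2 + 2 / real N"
      using close[OF iT] y(2) by (intro interp_dist_le[OF b N(5) P ys]) (auto intro: less_imp_le)
    then show "supdist N \<pi> ys < \<delta>" using N(4) by linarith
  qed
qed

section \<open>Exponential concentration of the environment\<close>

text \<open>The fourth power counts sub-rectangles, each given by four indices.\<close>

lemma quartic_times_exp_le: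
  fixes c x :: real
  assumes "0 < c" "0 \<le> x"
  shows "x ^ 4 * exp (- c * x) \<le> (8 / c) ^ 4 * exp (- (c / 2) * x)"
proof -
  have "x * exp (- (c / 4) * x) \<le> 2 / (c / 4) * exp (- (c / 4 / 2) * x)"
    using assms by (intro linear_times_exp_le) auto
  then have "(x * exp (- (c / 4) * x)) ^ 4 \<le> (8 / c * exp (- (c / 8) * x)) ^ 4"
    using assms by (intro power_mono) auto
  moreover have "exp (- (c / 4) * x) ^ 4 = exp (- c * x)" "exp (- (c / 8) * x) ^ 4 = exp (- (c / 2) * x)"
    by (simp_all add: exp_of_nat_mult[symmetric])
  ultimately show ?thesis by (simp only: power_mult_distrib)
qed

context
  fixes l b :: real and M :: "'a measure" and E :: "nat \<Rightarrow> real \<times> real \<Rightarrow> 'a \<Rightarrow> real"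
  assumes l: "0 < l" and b: "\<bar>b\<bar> < l" and M: "prob_space M"
    and E_indep: "\<forall>N\<ge>1. prob_space.indep_vars M (\<lambda>_. borel) (E N) (SN l b N)"
    and E_exp: "\<forall>N\<ge>1. \<forall>p\<in>SN l b N. distributed M lborel (E N p) (exponential_density 1)"
begin

interpretation M: prob_space M by (rule M)

lemma env_measurable: "1 \<le> N \<Longrightarrow> p \<in> SN l b N \<Longrightarrow> E N p \<in> borel_measurable M"
  using E_exp distributed_measurable by fastforce

text \<open>Independence gives the joint law on the finite site set, and injectivity of
  \<open>site\<close> lets a rectangle be read off as distinct coordinates.\<close>

lemma env_subbox:
  assumes N: "1 \<le> N" and le: "a + m \<le> num_u l b N" "c + n \<le> num_v l b N"
  defines "Y \<equiv> \<lambda>\<omega>. \<lambda>k\<in>grid m n. E N (site N (a + fst k, c + snd k)) \<omega>"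
  shows "Y \<in> M \<rightarrow>\<^sub>M PiM (grid m n) (\<lambda>_. borel)" "distr M (PiM (grid m n) (\<lambda>_. borel)) Y = prod_exp (\<lambda>_. 1) (grid m n)"
proof -
  let ?S = "SN l b N"
  define h where "h k = site N (a + fst k, c + snd k)" for k
  have hS: "h ` grid m n \<subseteq> ?S" unfolding SN_eq[OF N b] h_def using le by (auto intro!: imageI)
  have inj: "inj_on h (grid m n)" by (auto simp: h_def inj_on_def inj_eq[OF inj_site[OF N]])
  have ne: "?S \<noteq> {}" using hS by (auto simp: grid_def)
  let ?W = "\<lambda>\<omega>. \<lambda>p\<in>?S. E N p \<omega>"
  have mW: "?W \<in> M \<rightarrow>\<^sub>M PiM ?S (\<lambda>_. borel)" using env_measurable[OF N] by (intro measurable_restrict) auto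
  have dE: "distr M borel (E N p) = exp_measure 1" if "p \<in> ?S" for p
  proof -
    have "distr M lborel (E N p) = density lborel (exponential_density 1)"
      using E_exp N that by (auto simp: distributed_def)
    then show ?thesis by (simp add: exp_measure_def cong: distr_cong)
  qed
  have "distr M (PiM ?S (\<lambda>_. borel)) ?W = PiM ?S (\<lambda>p. distr M borel (E N p))"
    using M.indep_vars_iff_distr_eq_PiM'[OF ne, where M' = "\<lambda>_. borel" and X = "E N"] env_measurable[OF N] E_indep N by auto
  also have "\<dots> = prod_exp (\<lambda>_. 1) ?S" unfolding prod_exp_def by (intro PiM_cong) (auto simp: dE)
  finally have dW: "distr M (PiM ?S (\<lambda>_. borel)) ?W = prod_exp (\<lambda>_. 1) ?S" .
  let ?H = "\<lambda>w. \<lambda>k\<in>grid m n. w (h k)"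
  have mH: "?H \<in> PiM ?S (\<lambda>_. borel) \<rightarrow>\<^sub>M PiM (grid m n) (\<lambda>_. borel :: real measure)"
    using hS by (intro measurable_restrict measurable_component_singleton) auto
  have Y: "Y = ?H \<circ> ?W" using hS by (auto simp: Y_def h_def[symmetric] fun_eq_iff restrict_def image_subset_iff)
  show "Y \<in> M \<rightarrow>\<^sub>M PiM (grid m n) (\<lambda>_. borel)" unfolding Y using mW mH by (rule measurable_comp)
  have "distr M (PiM (grid m n) (\<lambda>_. borel)) Y = distr (distr M (PiM ?S (\<lambda>_. borel)) ?W) (PiM (grid m n) (\<lambda>_. borel)) ?H"
    unfolding Y by (rule distr_distr[OF mH mW, symmetric])
  also have "\<dots> = prod_exp (\<lambda>_. 1) (grid m n)" unfolding dW by (rule distr_prod_exp_reindex[OF inj hS]) auto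
  finally show "distr M (PiM (grid m n) (\<lambda>_. borel)) Y = prod_exp (\<lambda>_. 1) (grid m n)" .
qed

text \<open>A union bound over all sub-rectangles. The exceptional set is produced as a measurable
  set B, so later statements about geodesics only need inclusion in B.\<close>

lemma bad_env_exponentially_small:
  assumes \<eta>: "0 < \<eta>"
  shows "\<exists>c C :: real. 0 < c \<and> 0 < C \<and> (\<forall>N\<ge>1. \<exists>B\<in>sets M. measure M B \<le> C * exp (- c * real N) \<and>
    (\<forall>\<omega>\<in>space M - B. good_env l b N \<eta> (\<lambda>p. E N p \<omega>)))"
proof -
  \<comment> \<open>Each side has at most N l + 1 sites, which is at most (l + 1) N once N \<ge>
    1.\<close>
  define R where "R = l + 1"
  have R: "0 < R" using l by (simp add: R_def)
  obtain c C where c: "0 < c" "0 < C" and tail: "\<And>N m n :: nat. real (Suc m) \<le> R * real N \<Longrightarrow> real (Suc n) \<le> R * real N \<Longrightarrow>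
    passage_prob m n ({.. shape (Suc m) (Suc n) - \<eta> * real N} \<union> {shape (Suc m) (Suc n) + \<eta> * real N ..}) \<le> C * exp (- c * real N)"
    using lpp_tail[OF \<eta> R] by blast
  have c2: "0 < c / 2" using c by simp
  have C2: "0 < R ^ 4 * C * (8 / c) ^ 4" using R c by simp
  show ?thesis
  proof (rule exI[of _ "c / 2"], rule exI[of _ "R ^ 4 * C * (8 / c) ^ 4"], rule conjI[OF c2], rule conjI[OF C2], intro allI impI)
    fix N :: nat assume N: "1 \<le> N"
    let ?A = "num_u l b N" and ?B = "num_v l b N"
    have AB: "real (Suc ?A) \<le> R * real N" "real (Suc ?B) \<le> R * real N"
    proof -
      have h: "(l + b) / 2 \<le> l" "(l - b) / 2 \<le> l" using b by auto
      have "real N * ((l + b) / 2) \<le> real N * l" "real N * ((l - b) / 2) \<le> real N * l"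
        using mult_left_mono[OF h(1)] mult_left_mono[OF h(2)] by (meson of_nat_0_le_iff)+
      moreover have "1 \<le> real N" using N by simp
      moreover have "R * real N = real N * l + real N" by (simp add: R_def algebra_simps)
      moreover have "real (Suc i) = real i + 1" for i by simp
      ultimately show "real (Suc ?A) \<le> R * real N" "real (Suc ?B) \<le> R * real N"
        using num_u_num_v_bounds[OF b, of N] by (metis add_mono order_trans)+
    qed
    define F where "F \<omega> = (\<lambda>i j. E N (site N (i, j)) \<omega>)" for \<omega>
    define X where "X m n = {.. shape (Suc m) (Suc n) - \<eta> * real N} \<union> {shape (Suc m) (Suc n) + \<eta> * real N ..}" for m n
    define D where "D = (\<lambda>(a, a', c, c'). {\<omega> \<in> space M. lpp (shift (F \<omega>) a c) (a' - a) (c' - c) \<in> X (a' - a) (c' - c)})"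
    define I where "I = {..?A} \<times> {..?A} \<times> {..?B} \<times> {..?B}"
    define I' where "I' = {(a, a', c, c') \<in> I. a \<le> a' \<and> c \<le> c'}"
    have fI: "finite I" "finite I'" "I' \<subseteq> I" by (auto simp: I_def I'_def intro: finite_subset[of _ I])
    have cI: "card I' \<le> Suc ?A * (Suc ?A * (Suc ?B * Suc ?B))"
      using card_mono[OF fI(1,3)] by (simp add: I_def card_cartesian_product)
    have ptS: "site N (i, j) \<in> SN l b N" if "i \<le> ?A" "j \<le> ?B" for i j
      using that unfolding SN_eq[OF N b] by (intro imageI) auto
    have D: "D k \<in> sets M \<and> measure M (D k) \<le> C * exp (- c * real N)" if k: "k \<in> I'" for k
    proof -
      obtain a a' c0 c' where k': "k = (a, a', c0, c')" by (cases k)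
      define m n where "m = a' - a" and "n = c' - c0"
      have le: "a + m \<le> ?A" "c0 + n \<le> ?B" using k unfolding k' by (auto simp: I'_def I_def m_def n_def)
      have mE: "(\<lambda>\<omega>. lpp (shift (F \<omega>) a c0) m n) \<in> borel_measurable M"
        unfolding shift_def F_def using le by (intro measurable_lpp env_measurable[OF N] ptS) auto
      have Dk: "D k = (\<lambda>\<omega>. lpp (shift (F \<omega>) a c0) m n) -` X m n \<inter> space M"
        by (auto simp: D_def k' m_def n_def)
      have X: "X m n \<in> sets borel" by (simp add: X_def)
      define Y where "Y = (\<lambda>\<omega>. \<lambda>k\<in>grid m n. E N (site N (a + fst k, c0 + snd k)) \<omega>)"
      have "lpp (shift (F \<omega>) a c0) m n = lpp (curry (Y \<omega>)) m n" for \<omega>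
        by (intro lpp_cong) (auto simp: shift_def F_def Y_def)
      then have "D k = {\<omega> \<in> space M. lpp (curry (Y \<omega>)) m n \<in> X m n}" by (auto simp: Dk)
      then have "measure M (D k) = passage_prob m n (X m n)"
        using prob_lpp_eq[OF env_subbox[OF N le, folded Y_def] X] by simp
      also have "\<dots> \<le> C * exp (- c * real N)"
        unfolding X_def using le AB by (intro tail) auto
      finally show ?thesis using measurable_sets[OF mE X] Dk by simp
    qed
    \<comment> \<open>The weights are nonnegative only almost surely, while \<open>good_env\<close>
      asks for it at every site; this null set repairs the difference.\<close>
    define Z where "Z = {\<omega> \<in> space M. \<exists>p\<in>SN l b N. E N p \<omega> < 0}"
    have fS: "finite (SN l b N)" unfolding SN_eq[OF N b] by simp
    have Z: "Z \<in> sets M" "measure M Z = 0"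
    proof -
      have Zu: "Z = (\<Union>p\<in>SN l b N. {\<omega> \<in> space M. E N p \<omega> < 0})" by (auto simp: Z_def)
      have Zp: "{\<omega> \<in> space M. E N p \<omega> < 0} \<in> null_sets M" if "p \<in> SN l b N" for p
      proof -
        note [measurable] = env_measurable[OF N that]
        have "AE \<omega> in M. 0 \<le> E N p \<omega>"
        proof (rule AE_distrD[where M' = lborel])
          show "E N p \<in> measurable M lborel" using env_measurable[OF N that] by simp
          have eq: "distr M lborel (E N p) = exp_measure 1" using E_exp N that by (auto simp: distributed_def exp_measure_def)
          show "AE x in distr M lborel (E N p). 0 \<le> x" unfolding eq by (rule AE_exp_measure_nonneg)
        qed
        then have "AE \<omega> in M. \<omega> \<notin> {\<omega> \<in> space M. E N p \<omega> < 0}" by eventually_elim auto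
        then show ?thesis by (subst AE_iff_null_sets) auto
      qed
      have "Z \<in> null_sets M" unfolding Zu using fS Zp by (intro null_sets_UN') (auto intro: countable_finite)
      then show "Z \<in> sets M" "measure M Z = 0" by (auto simp: measure_eq_0_null_sets)
    qed
    let ?Bad = "Z \<union> (\<Union>k\<in>I'. D k)"
    have mU: "(\<Union>k\<in>I'. D k) \<in> sets M" using D fI by (intro sets.finite_UN) auto
    show "\<exists>B\<in>sets M. measure M B \<le> R ^ 4 * C * (8 / c) ^ 4 * exp (- (c / 2) * real N) \<and> (\<forall>\<omega>\<in>space M - B. good_env l b N \<eta> (\<lambda>p. E N p \<omega>))"
    proof (intro bexI[of _ ?Bad] conjI ballI)
      show "?Bad \<in> sets M" using Z mU by auto
      have "measure M ?Bad \<le> measure M Z + measure M (\<Union>k\<in>I'. D k)" using Z mU by (intro measure_Un_le) auto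
      also have "measure M (\<Union>k\<in>I'. D k) \<le> (\<Sum>k\<in>I'. measure M (D k))" using D fI by (intro measure_UNION_le) auto
      also have "\<dots> \<le> (\<Sum>k\<in>I'. C * exp (- c * real N))" using D by (intro sum_mono) auto
      also have "\<dots> = real (card I') * (C * exp (- c * real N))" by simp
      also have "\<dots> \<le> (R * real N) ^ 4 * (C * exp (- c * real N))"
      proof (rule mult_right_mono)
        have "real (card I') \<le> real (Suc ?A * (Suc ?A * (Suc ?B * Suc ?B)))" using cI by (simp only: of_nat_le_iff)
        also have "\<dots> = real (Suc ?A) * (real (Suc ?A) * (real (Suc ?B) * real (Suc ?B)))" by (simp only: of_nat_mult)
        also have "\<dots> \<le> (R * real N) * ((R * real N) * ((R * real N) * (R * real N)))"
          using AB R by (intro mult_mono mult_nonneg_nonneg) auto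
        also have "\<dots> = (R * real N) ^ 4" by (simp add: power4_eq_xxxx)
        finally show "real (card I') \<le> (R * real N) ^ 4" .
        show "0 \<le> C * exp (- c * real N)" using c by simp
      qed
      also have "\<dots> = R ^ 4 * C * (real N ^ 4 * exp (- c * real N))" by (simp add: power_mult_distrib)
      also have "\<dots> \<le> R ^ 4 * C * ((8 / c) ^ 4 * exp (- (c / 2) * real N))"
        using c R quartic_times_exp_le[OF c(1), of "real N"] by (intro mult_left_mono) auto
      finally show "measure M ?Bad \<le> R ^ 4 * C * (8 / c) ^ 4 * exp (- (c / 2) * real N)" using Z by (simp add: mult.assoc)
      fix \<omega> assume \<omega>: "\<omega> \<in> space M - ?Bad"
      show "good_env l b N \<eta> (\<lambda>p. E N p \<omega>)"
        unfolding good_env_def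
      proof (intro conjI ballI allI impI)
        fix p assume "p \<in> SN l b N" then show "0 \<le> E N p \<omega>" using \<omega> by (auto simp: Z_def not_less)
      next
        fix a c0 m n assume le: "a + m \<le> ?A" "c0 + n \<le> ?B"
        have "(a, a + m, c0, c0 + n) \<in> I'" using le by (auto simp: I'_def I_def)
        then have "\<omega> \<notin> D (a, a + m, c0, c0 + n)" using \<omega> by blast
        then have "lpp (shift (F \<omega>) a c0) m n \<notin> X m n" using \<omega> by (simp add: D_def)
        then show "\<bar>lpp (shift (\<lambda>i j. E N (site N (i, j)) \<omega>) a c0) m n - shape (Suc m) (Suc n)\<bar> \<le> \<eta> * real N"
          by (simp add: X_def F_def abs_le_iff)
      qed
    qed
  qed
qed

end

section \<open>Existence, almost sure convergence and the exponential bound\<close>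

theorem theorem2:
  fixes l b :: real
    and \<alpha> :: "real \<times> real \<Rightarrow> real"
    and M :: "'a measure"
    and E :: "nat \<Rightarrow> real \<times> real \<Rightarrow> 'a \<Rightarrow> real"
  assumes l_pos: "0 < l"
    and b_lt: "\<bar>b\<bar> < l"
    and \<alpha>_cont: "continuous_on (Qreg l b) \<alpha>"
    and \<alpha>_nonneg: "\<forall>p \<in> Qreg l b. 0 \<le> \<alpha> p"
    and M: "prob_space M"
    and E_indep: "\<forall>N \<ge> 1. prob_space.indep_vars M (\<lambda>_. borel) (E N) (SN l b N)"
    and E_exp: "\<forall>N \<ge> 1. \<forall>p \<in> SN l b N. distributed M lborel (E N p) (exponential_density 1)"
  shows "(\<exists>ys \<in> Xset l b. Gfun l \<alpha> ys = (SUP y \<in> Xset l b. Gfun l \<alpha> y))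
    \<and> (\<forall>ys \<in> Xset l b.
         (Gfun l \<alpha> ys = (SUP y \<in> Xset l b. Gfun l \<alpha> y) \<and>
          (\<forall>y \<in> Xset l b. Gfun l \<alpha> y = (SUP y \<in> Xset l b. Gfun l \<alpha> y) \<longrightarrow> (\<forall>x \<in> {0..l}. y x = ys x)))
       \<longrightarrow>
         (AE \<omega> in M. \<forall>\<epsilon> > 0. \<forall>\<^sub>F N in sequentially.
              \<forall>\<pi>. is_geodesic l b \<alpha> E N \<omega> \<pi> \<longrightarrow> supdist N \<pi> ys < \<epsilon>)
       \<and> (\<forall>\<delta> > 0. \<exists>c C. 0 < c \<and> 0 < C \<and> (\<forall>N \<ge> 1.
              measure M {\<omega> \<in> space M. \<exists>\<pi>. is_geodesic l b \<alpha> E N \<omega> \<pi> \<and> supdist N \<pi> ys > \<delta>}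
                < C * exp (- c * real N))))"
proof (intro conjI ballI impI)
  show "\<exists>ys\<in>Xset l b. Gfun l \<alpha> ys = (SUP y\<in>Xset l b. Gfun l \<alpha> y)"
    by (rule Gfun_maximizer[OF l_pos b_lt \<alpha>_cont \<alpha>_nonneg])
next
  interpret prob_space M by (rule M)
  fix ys assume ys: "ys \<in> Xset l b"
    and max: "Gfun l \<alpha> ys = (SUP y\<in>Xset l b. Gfun l \<alpha> y) \<and>
          (\<forall>y\<in>Xset l b. Gfun l \<alpha> y = (SUP y\<in>Xset l b. Gfun l \<alpha> y) \<longrightarrow> (\<forall>x\<in>{0..l}. y x = ys x))"
  \<comment> \<open>Uniqueness is recast with an inequality: no value exceeds the supremum, so a
    curve that reaches the value of \<open>ys\<close> is a maximizer.\<close>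
  have uniq: "\<forall>x\<in>{0..l}. y x = ys x" if "y \<in> Xset l b" "Gfun l \<alpha> ys \<le> Gfun l \<alpha> y" for y
    using max that cSUP_upper[OF that(1) Gfun_bdd_above[OF l_pos \<alpha>_cont]] by (auto intro: antisym)
  have close: "\<exists>\<eta> N0. 0 < \<eta> \<and> 1 \<le> N0 \<and> (\<forall>N \<omega> \<pi>. N0 \<le> N \<longrightarrow> good_env l b N \<eta> (\<lambda>p. E N p \<omega>) \<longrightarrow> is_geodesic l b \<alpha> E N \<omega> \<pi> \<longrightarrow> supdist N \<pi> ys < \<delta>)"
    if "0 < \<delta>" for \<delta>
    by (rule geodesic_close[OF l_pos b_lt \<alpha>_cont \<alpha>_nonneg ys uniq that])
  have tail: "\<exists>c C N0. 0 < c \<and> 0 < C \<and> 1 \<le> N0 \<and> (\<forall>N\<ge>N0. \<exists>B\<in>sets M. measure M B \<le> C * exp (- c * real N) \<and>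
      (\<forall>\<omega>\<in>space M - B. \<forall>\<pi>. is_geodesic l b \<alpha> E N \<omega> \<pi> \<longrightarrow> supdist N \<pi> ys < \<delta>))" if \<delta>: "0 < \<delta>" for \<delta> :: real
  proof -
    obtain \<eta> N0 where \<eta>: "0 < \<eta>" "1 \<le> N0" "\<And>N \<omega> \<pi>. N0 \<le> N \<Longrightarrow> good_env l b N \<eta> (\<lambda>p. E N p \<omega>) \<Longrightarrow> is_geodesic l b \<alpha> E N \<omega> \<pi> \<Longrightarrow> supdist N \<pi> ys < \<delta>"
      using close[OF \<delta>] by blast
    obtain c C where c: "0 < c" "0 < C" "\<And>N. 1 \<le> N \<Longrightarrow> \<exists>B\<in>sets M. measure M B \<le> C * exp (- c * real N) \<and>
        (\<forall>\<omega>\<in>space M - B. good_env l b N \<eta> (\<lambda>p. E N p \<omega>))"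
      using bad_env_exponentially_small[OF l_pos b_lt M E_indep E_exp \<eta>(1)] by blast
    show ?thesis
    proof (intro exI conjI allI impI)
      show "0 < c" "0 < C" "1 \<le> N0" by fact+
      fix N assume N: "N0 \<le> N"
      then obtain B where "B \<in> sets M" "measure M B \<le> C * exp (- c * real N)" "\<forall>\<omega>\<in>space M - B. good_env l b N \<eta> (\<lambda>p. E N p \<omega>)"
        using c(3)[of N] \<eta>(2) by force
      then show "\<exists>B\<in>sets M. measure M B \<le> C * exp (- c * real N) \<and> (\<forall>\<omega>\<in>space M - B. \<forall>\<pi>. is_geodesic l b \<alpha> E N \<omega> \<pi> \<longrightarrow> supdist N \<pi> ys < \<delta>)"
        using \<eta>(3)[OF N] by blast
    qed
  qed
  show "AE \<omega> in M. \<forall>\<epsilon>>0. \<forall>\<^sub>F N in sequentially. \<forall>\<pi>. is_geodesic l b \<alpha> E N \<omega> \<pi> \<longrightarrow> supdist N \<pi> ys < \<epsilon>"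
  proof -
    \<comment> \<open>Countably many tolerances 1 / (k + 1) are used, so that the exceptional null
      sets can be united.\<close>
    have ae: "AE \<omega> in M. \<forall>\<^sub>F N in sequentially. \<forall>\<pi>. is_geodesic l b \<alpha> E N \<omega> \<pi> \<longrightarrow> supdist N \<pi> ys < 1 / real (Suc k)" for k
    proof -
      have "0 < 1 / real (Suc k)" by simp
      from tail[OF this] obtain c C N0 where c: "0 < c" "0 < C" "1 \<le> N0" "\<And>N. N0 \<le> N \<Longrightarrow> \<exists>B\<in>sets M. measure M B \<le> C * exp (- c * real N) \<and>
        (\<forall>\<omega>\<in>space M - B. \<forall>\<pi>. is_geodesic l b \<alpha> E N \<omega> \<pi> \<longrightarrow> supdist N \<pi> ys < 1 / real (Suc k))" by blast
      define B where "B N = (SOME B. B \<in> sets M \<and> measure M B \<le> C * exp (- c * real N) \<and>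
        (\<forall>\<omega>\<in>space M - B. \<forall>\<pi>. is_geodesic l b \<alpha> E N \<omega> \<pi> \<longrightarrow> supdist N \<pi> ys < 1 / real (Suc k)))" for N
      have B: "B N \<in> sets M \<and> measure M (B N) \<le> C * exp (- c * real N) \<and>
        (\<forall>\<omega>\<in>space M - B N. \<forall>\<pi>. is_geodesic l b \<alpha> E N \<omega> \<pi> \<longrightarrow> supdist N \<pi> ys < 1 / real (Suc k))" if "N0 \<le> N" for N
        unfolding B_def by (rule someI_ex) (use c(4)[OF that] in blast)
      \<comment> \<open>The sets are controlled from \<open>N0\<close> on only; the shift makes the
        bound valid for every index, as summability and Borel-Cantelli require.\<close>
      define B' where "B' N = B (N + N0)" for N
      have "summable (\<lambda>N. measure M (B' N))"
      proof (rule summable_comparison_test')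
        have "summable (\<lambda>N. C * exp (- c) ^ N)" using c by (intro summable_mult summable_geometric) auto
        then show "summable (\<lambda>N. C * exp (- c) ^ N)" .
        fix N
        have "measure M (B' N) \<le> C * exp (- c * real (N + N0))" using B[of "N + N0"] by (simp add: B'_def)
        also have "\<dots> \<le> C * exp (- c * real N)" using c by (intro mult_left_mono) auto
        also have "\<dots> = C * exp (- c) ^ N" by (simp add: exp_of_nat_mult[symmetric] mult.commute)
        finally show "norm (measure M (B' N)) \<le> C * exp (- c) ^ N" by simp
      qed
      then have "AE \<omega> in M. \<forall>\<^sub>F N in sequentially. \<omega> \<in> space M - B' N"
        using B by (intro borel_cantelli_AE1) (auto simp: B'_def emeasure_eq_measure)
      then show ?thesis
      proof eventually_elim
        case (elim \<omega>)
        have "\<forall>\<^sub>F N in sequentially. \<forall>\<pi>. is_geodesic l b \<alpha> E (N + N0) \<omega> \<pi> \<longrightarrow> supdist (N + N0) \<pi> ys < 1 / real (Suc k)"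
          using elim by eventually_elim (use B in \<open>auto simp: B'_def\<close>)
        then show ?case using eventually_sequentially_seg[of "\<lambda>N. \<forall>\<pi>. is_geodesic l b \<alpha> E N \<omega> \<pi> \<longrightarrow> supdist N \<pi> ys < 1 / real (Suc k)" N0] by simp
      qed
    qed
    then have "AE \<omega> in M. \<forall>k. \<forall>\<^sub>F N in sequentially. \<forall>\<pi>. is_geodesic l b \<alpha> E N \<omega> \<pi> \<longrightarrow> supdist N \<pi> ys < 1 / real (Suc k)"
      by (simp add: AE_all_countable)
    then show ?thesis
    proof eventually_elim
      case (elim \<omega>)
      show ?case
      proof (intro allI impI)
        fix \<epsilon> :: real assume "0 < \<epsilon>"
        then obtain k where k: "1 / real (Suc k) < \<epsilon>" using nat_approx_posE by blast
        have "\<forall>\<^sub>F N in sequentially. \<forall>\<pi>. is_geodesic l b \<alpha> E N \<omega> \<pi> \<longrightarrow> supdist N \<pi> ys < 1 / real (Suc k)" using elim by blast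
        then show "\<forall>\<^sub>F N in sequentially. \<forall>\<pi>. is_geodesic l b \<alpha> E N \<omega> \<pi> \<longrightarrow> supdist N \<pi> ys < \<epsilon>"
          by eventually_elim (use k in force)
      qed
    qed
  qed
  show "\<forall>\<delta>>0. \<exists>c C. 0 < c \<and> 0 < C \<and> (\<forall>N\<ge>1. measure M {\<omega> \<in> space M. \<exists>\<pi>. is_geodesic l b \<alpha> E N \<omega> \<pi> \<and> supdist N \<pi> ys > \<delta>} < C * exp (- c * real N))"
  proof (intro allI impI)
    fix \<delta> :: real assume "0 < \<delta>"
    from tail[OF this] obtain c C N0 where c: "0 < c" "0 < C" "1 \<le> N0" "\<And>N. N0 \<le> N \<Longrightarrow> \<exists>B\<in>sets M. measure M B \<le> C * exp (- c * real N) \<and>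
        (\<forall>\<omega>\<in>space M - B. \<forall>\<pi>. is_geodesic l b \<alpha> E N \<omega> \<pi> \<longrightarrow> supdist N \<pi> ys < \<delta>)" by blast
    let ?S = "\<lambda>N. {\<omega> \<in> space M. \<exists>\<pi>. is_geodesic l b \<alpha> E N \<omega> \<pi> \<and> supdist N \<pi> ys > \<delta>}"
    \<comment> \<open>The added term makes the bound exceed 1 for N below \<open>N0\<close>, and
      makes the inequality strict for the other N.\<close>
    define C' where "C' = C + exp (c * real N0)"
    have "measure M (?S N) < C' * exp (- c * real N)" if "1 \<le> N" for N
    proof (cases "N0 \<le> N")
      case True
      then obtain B where B: "B \<in> sets M" "measure M B \<le> C * exp (- c * real N)"
        "\<forall>\<omega>\<in>space M - B. \<forall>\<pi>. is_geodesic l b \<alpha> E N \<omega> \<pi> \<longrightarrow> supdist N \<pi> ys < \<delta>" using c(4) by blast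
      have "?S N \<subseteq> B"
      proof
        fix \<omega> assume "\<omega> \<in> ?S N"
        then obtain \<pi> where \<pi>: "\<omega> \<in> space M" "is_geodesic l b \<alpha> E N \<omega> \<pi>" "supdist N \<pi> ys > \<delta>" by auto
        show "\<omega> \<in> B"
        proof (rule ccontr)
          assume "\<omega> \<notin> B"
          then have "supdist N \<pi> ys < \<delta>" using B(3) \<pi> by blast
          then show False using \<pi>(3) by simp
        qed
      qed
      then have "measure M (?S N) \<le> measure M B" using B(1) by (rule finite_measure_mono)
      also have "\<dots> \<le> C * exp (- c * real N)" by (rule B(2))
      also have "\<dots> < C' * exp (- c * real N)" by (simp add: C'_def)
      finally show ?thesis .
    next
      case False
      then have "c * real N < c * real N0" using c by (intro mult_strict_left_mono) auto
      then have "1 < exp (c * real N0) * exp (- c * real N)" by (simp add: exp_add[symmetric])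
      also have "\<dots> \<le> C' * exp (- c * real N)" using c by (intro mult_right_mono) (auto simp: C'_def)
      finally show ?thesis using prob_le_1[of "?S N"] by linarith
    qed
    moreover have "0 < C'" using c by (simp add: C'_def add_pos_pos)
    ultimately show "\<exists>c C. 0 < c \<and> 0 < C \<and> (\<forall>N\<ge>1. measure M (?S N) < C * exp (- c * real N))" using c(1) by blast
  qed
qed

end
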